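(* Let $S\subseteq\mathbb R^2$ be a semialgebraic set which has exactly one tentacle and whose tentacle is regular, and let $f_S$ be the last key form of $\delta^*_S$. Then $\mathcal B_0(S)=\mathbb R$ if and only if one of the following holds: (1) $\delta^*_S(f_S)>0$; or (2) $\delta^*_S(f_S)=0$ and $f_S$ is not a polynomial (i.e. $f_S\in\mathbb C[u,u^{-1},v]\setminus\mathbb C[u,v]$, with $(u,v)$ the coordinates used to define $\delta^*_S$).
   Context: For $S\subseteq\mathbb R^2$ and $d\in\mathbb N=\{0,1,\dots\}$, $\mathcal B_d(S)=\{p\in\mathbb R[x,y] : \exists q\in\mathbb R[x,y],\ \deg(q)\le 2d,\ p^2\le q \text{ on } S\}$; $\mathcal B_0(S)$ is the algebra of polynomials bounded on $S$. Tentacles. For a semialgebraic $S\subseteq\mathbb R^2$, let $B_r$ be the ball of radius $r$ about the origin. For $r$ large the number of connected components of $S\setminus B_r$ is stable; these components (for $r$ large) are the tentacles of $S$. A tentacle is regular if it contains a dense open subset (i.e. it has a subset that is open in $\mathbb R^2$ and dense in it). Definition of $\delta^*_S$ (for $S$ with exactly one tentacle, which is regular). Let $\bar S$ be the closure of $S$ in $\mathbb{RP}^2$ and $L_\infty$ the line at infinity. If $\bar S\cap L_\infty$ has more than one point, put $\delta^*_S=\deg$, $(u,v)=(x,y)$, $\phi=0$, $\omega=1$. If $\bar S\cap L_\infty$ is a single point $P$, choose linear coordinates $(u,v)$ on $\mathbb R^2$ such that $P$ is not on the closure of the line $u=0$ and $u\to+\infty$ along the tentacle. For $u$ large, $S$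 is (up to boundary points) the region between two curve branches $v=\phi_1(u)$ and $v=\phi_2(u)$, where $\phi_1\neq\phi_2$ are real Puiseux series in $1/u$ (descending rational exponents with common denominator, all $\le 1$). Let $\omega\in\mathbb Q$ be the smallest number such that the coefficients of $u^{\omega'}$ in $\phi_1$ and $\phi_2$ agree for all $\omega'>\omega$, and let $\phi(u)$ be the (finite) sum of the common terms with exponent $>\omega$. With a new indeterminate $\xi$, $\delta^*_S(f)=\deg_u\big(f(u,\phi(u)+\xi u^\omega)\big)$ for $f\in\mathbb R[x,y]\setminus\{0\}=\mathbb R[u,v]\setminus\{0\}$, where $f$ is written in the coordinates $(u,v)$. In both cases $\delta^*_S(f)=\deg_u f(u,\phi(u)+\xi u^\omega)$, and this formula extends $\delta^*_S$ to $\mathbb C[u,u^{-1},v]\setminus\{0\}$. Key forms. For $\delta(f)=\deg_u f(u,\phi(u)+\xi u^\omega)$ on $\mathbb C[u,u^{-1},v]\setminus\{0\}$, the sequence of key forms of $\delta$ is the unique finite sequence $f_0=u,\ f_1=v,\ f_2,\dots,f_l\in\mathbb C[u,u^{-1},v]$, $l\ge1$, such that, with $\omega_j=\delta(f_j)$: (i) for $1\le j\le l-1$, letting $\alpha_j$ be the smallest positive integer with $\alpha_j\omega_j\in\mathbb Z\omega_0+\dots+\mathbb Z\omega_{j-1}$ and writing (uniquely) $\alpha_j\omega_j=\sum_{i=0}^{j-1}\beta_{j,i}\omega_i$ with $\beta_{j,i}\in\mathbb Z$ and $0\le\beta_{j,i}<\alpha_i$ for $1\le i<j$, one has $f_{j+1}=f_j^{\alpha_j}-\theta_j\prod_{i=0}^{j-1}f_i^{\beta_{j,i}}$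 for some $\theta_j\in\mathbb C\setminus\{0\}$, and $\omega_{j+1}<\alpha_j\omega_j$; (ii) for every $0\neq g\in\mathbb C[u,u^{-1},v]$, $\delta(g)=\min\{\eta(G) : G\in\mathbb C[u,u^{-1},y_1,\dots,y_l],\ G(u,f_1,\dots,f_l)=g\}$, where $\eta$ is the weighted degree with weight $\omega_0$ for $u$ and $\omega_j$ for $y_j$. The last key form is $f_l$; for $\delta=\delta^*_S$ it is denoted $f_S$. *)

theory Defs
  imports
    "HOL-Analysis.Analysis"
    "HOL-Computational_Algebra.Polynomial"
    "HOL-Library.Poly_Mapping"
begin

subsection \<open>Real bivariate polynomials and the algebras of bounded growth\<close>

text \<open>
  \<open>\<real>[x,y]\<close> is \<^typ>\<open>real poly poly\<close>, read as \<open>\<real>[x][y]\<close>: the inner variable is \<open>x\<close>, the outer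
  one is \<open>y\<close>.
\<close>

definition eval2 :: "real poly poly \<Rightarrow> real \<times> real \<Rightarrow> real" where
  "eval2 p z = poly (poly p [:snd z:]) (fst z)"

definition total_degree :: "real poly poly \<Rightarrow> nat" where
  "total_degree p =
     (if p = 0 then 0 else Max {degree (coeff p j) + j |j. coeff p j \<noteq> 0})"

definition \<B> :: "nat \<Rightarrow> (real \<times> real) set \<Rightarrow> real poly poly set" where
  "\<B> d S = {p. \<exists>q. total_degree q \<le> 2 * d \<and> (\<forall>z\<in>S. (eval2 p z)\<^sup>2 \<le> eval2 q z)}"

definition constant_polys :: "real poly poly set" where
  "constant_polys = range (\<lambda>c. [:[:c:]:])"

subsection \<open>Semialgebraic sets and tentacles\<close>

inductive semialgebraic :: "(real \<times> real) set \<Rightarrow> bool" where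
  positivity: "semialgebraic {z. eval2 p z > 0}"
| complement: "semialgebraic A \<Longrightarrow> semialgebraic (- A)"
| intersection: "semialgebraic A \<Longrightarrow> semialgebraic B \<Longrightarrow> semialgebraic (A \<inter> B)"

definition exactly_one_tentacle :: "(real \<times> real) set \<Rightarrow> bool" where
  "exactly_one_tentacle S \<longleftrightarrow> (\<forall>\<^sub>F r in at_top. card (components (S - ball 0 r)) = 1)"

definition contains_dense_open :: "'a::topological_space set \<Rightarrow> bool" where
  "contains_dense_open T \<longleftrightarrow> (\<exists>U. open U \<and> U \<subseteq> T \<and> T \<subseteq> closure U)"

definition tentacles_regular :: "(real \<times> real) set \<Rightarrow> bool" where
  "tentacles_regular S \<longleftrightarrow>
     (\<forall>\<^sub>F r in at_top. \<forall>T\<in>components (S - ball 0 r). contains_dense_open T)"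

subsection \<open>The real projective plane\<close>

text \<open>Points are the lines through the origin of \<open>\<real>\<^sup>3\<close>; the topology is the quotient topology.\<close>

definition RP2 :: "(real \<times> real \<times> real) set set" where
  "RP2 = {span {w} |w. w \<noteq> 0}"

definition RP2_topology :: "(real \<times> real \<times> real) set topology" where
  "RP2_topology = topology (\<lambda>U. U \<subseteq> RP2 \<and> open {w. w \<noteq> 0 \<and> span {w} \<in> U})"

lemma openin_RP2_topology:
  "openin RP2_topology U \<longleftrightarrow> U \<subseteq> RP2 \<and> open {w. w \<noteq> 0 \<and> span {w} \<in> U}"
proof -
  have "istopology (\<lambda>U. U \<subseteq> RP2 \<and> open {w. w \<noteq> 0 \<and> span {w} \<in> U})"
    unfolding istopology_def
  proof (intro conjI allI impI)
    fix A B :: "(real \<times> real \<times> real) set set"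
    assume A: "A \<subseteq> RP2 \<and> open {w. w \<noteq> 0 \<and> span {w} \<in> A}"
      and B: "B \<subseteq> RP2 \<and> open {w. w \<noteq> 0 \<and> span {w} \<in> B}"
    show "A \<inter> B \<subseteq> RP2" using A by blast
    have "{w. w \<noteq> 0 \<and> span {w} \<in> A \<inter> B}
        = {w. w \<noteq> 0 \<and> span {w} \<in> A} \<inter> {w. w \<noteq> 0 \<and> span {w} \<in> B}" by blast
    then show "open {w. w \<noteq> 0 \<and> span {w} \<in> A \<inter> B}" using A B by (simp only: open_Int)
  next
    fix K :: "(real \<times> real \<times> real) set set set"
    assume K: "\<forall>A\<in>K. A \<subseteq> RP2 \<and> open {w. w \<noteq> 0 \<and> span {w} \<in> A}"
    show "\<Union> K \<subseteq> RP2" using K by blast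
    have "{w. w \<noteq> 0 \<and> span {w} \<in> \<Union> K} = (\<Union>A\<in>K. {w. w \<noteq> 0 \<and> span {w} \<in> A})" by blast
    then show "open {w. w \<noteq> 0 \<and> span {w} \<in> \<Union> K}" using K by (auto intro!: open_UN)
  qed
  then show ?thesis by (simp add: RP2_topology_def topology_inverse')
qed

definition affine_chart :: "real \<times> real \<Rightarrow> (real \<times> real \<times> real) set" where
  "affine_chart z = span {(1, fst z, snd z)}"

definition line_at_infinity :: "(real \<times> real \<times> real) set set" where
  "line_at_infinity = {span {(0, a, b)} |a b. (a, b) \<noteq> (0, 0)}"

definition projective_closure :: "(real \<times> real) set \<Rightarrow> (real \<times> real \<times> real) set set" where
  "projective_closure S = RP2_topology closure_of (affine_chart ` S)"

definition points_at_infinity :: "(real \<times> real) set \<Rightarrow> (real \<times> real \<times> real) set set" where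
  "points_at_infinity S = projective_closure S \<inter> line_at_infinity"

subsection \<open>Puiseux series in \<open>1/u\<close>\<close>

text \<open>
  A series is given by its coefficient function: \<open>c q\<close> is the coefficient of \<open>u\<^sup>q\<close>. The exponents
  are at most 1 and have a common denominator.
\<close>

definition puiseux :: "(rat \<Rightarrow> real) \<Rightarrow> bool" where
  "puiseux c \<longleftrightarrow> (\<exists>N::nat. N > 0 \<and> (\<forall>q. c q \<noteq> 0 \<longrightarrow> q \<le> 1 \<and> of_nat N * q \<in> \<int>))"

definition puiseux_term :: "(rat \<Rightarrow> real) \<Rightarrow> real \<Rightarrow> rat \<Rightarrow> real" where
  "puiseux_term c u q = c q * u powr real_of_rat q"

definition puiseux_convergent :: "(rat \<Rightarrow> real) \<Rightarrow> bool" where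
  "puiseux_convergent c \<longleftrightarrow> (\<forall>\<^sub>F u in at_top. puiseux_term c u summable_on UNIV)"

definition puiseux_eval :: "(rat \<Rightarrow> real) \<Rightarrow> real \<Rightarrow> real" where
  "puiseux_eval c u = infsum (puiseux_term c u) UNIV"

subsection \<open>The ring \<open>\<complex>[u,u\<^sup>-\<^sup>1,v]\<close> and the degree-like functions on it\<close>

text \<open>
  \<open>\<complex>[u,u\<^sup>-\<^sup>1]\<close> is the monoid algebra of \<open>int\<close>, and \<open>v\<close> is the polynomial variable.
\<close>

type_synonym laurent = "int \<Rightarrow>\<^sub>0 complex"

definition laurent_monom :: "complex \<Rightarrow> int \<Rightarrow> laurent poly" where
  "laurent_monom \<theta> k = [:Poly_Mapping.single k \<theta>:]"

definition is_polynomial :: "laurent poly \<Rightarrow> bool" where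
  "is_polynomial f \<longleftrightarrow> (\<forall>i. \<forall>k\<in>Poly_Mapping.keys (coeff f i). k \<ge> 0)"

text \<open>
  Finite sums of terms \<open>a(\<xi>) u\<^sup>q\<close> with \<open>q\<close> rational and \<open>a \<in> \<complex>[\<xi>]\<close>, again as a monoid algebra.
\<close>

type_synonym puiseux_xi = "rat \<Rightarrow>\<^sub>0 complex poly"

definition laurent_embed :: "laurent \<Rightarrow> puiseux_xi" where
  "laurent_embed g = (\<Sum>k\<in>Poly_Mapping.keys g.
     Poly_Mapping.single (of_int k) [:Poly_Mapping.lookup g k:])"

definition generic_branch :: "(rat \<Rightarrow>\<^sub>0 real) \<Rightarrow> rat \<Rightarrow> puiseux_xi" where
  "generic_branch \<phi> \<omega> =
     Poly_Mapping.map (\<lambda>c. [:complex_of_real c:]) \<phi> + Poly_Mapping.single \<omega> [:0, 1:]"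

definition subst_branch :: "(rat \<Rightarrow>\<^sub>0 real) \<Rightarrow> rat \<Rightarrow> laurent poly \<Rightarrow> puiseux_xi" where
  "subst_branch \<phi> \<omega> f = poly (map_poly laurent_embed f) (generic_branch \<phi> \<omega>)"

text \<open>\<open>f \<mapsto> deg\<^sub>u f(u, \<phi>(u) + \<xi> u\<^sup>\<omega>)\<close>, meaningful for \<open>f \<noteq> 0\<close> only.\<close>

definition semidegree :: "(rat \<Rightarrow>\<^sub>0 real) \<Rightarrow> rat \<Rightarrow> laurent poly \<Rightarrow> rat" where
  "semidegree \<phi> \<omega> f = Max (Poly_Mapping.keys (subst_branch \<phi> \<omega> f))"

subsection \<open>The data defining \<open>\<delta>\<^sup>*\<^sub>S\<close>\<close>

text \<open>
  \<open>A\<close> is the linear change of coordinates \<open>(x,y) \<mapsto> (u,v)\<close>. The last two conditions say that \<open>\<omega>\<close>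
  is the smallest number above which all coefficients of \<open>c1\<close> and \<open>c2\<close> agree and that \<open>\<phi>\<close>
  consists of the common terms of exponent \<open>> \<omega>\<close>. The two branches are not ordered, which is why
  segments are used to describe the region between them.
\<close>

definition branch_data ::
  "(real \<times> real) set \<Rightarrow> (real \<times> real \<times> real) set \<Rightarrow> (real \<times> real \<Rightarrow> real \<times> real) \<Rightarrow>
   (rat \<Rightarrow>\<^sub>0 real) \<Rightarrow> rat \<Rightarrow> bool" where
  "branch_data S P A \<phi> \<omega> \<longleftrightarrow>
     linear A \<and> bij A \<and>
     P \<notin> projective_closure {z. fst (A z) = 0} \<and>
     filterlim (\<lambda>z. fst (A z)) at_top (inf at_infinity (principal S)) \<and>
     (\<exists>c1 c2. puiseux c1 \<and> puiseux c2 \<and> c1 \<noteq> c2 \<and>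
        puiseux_convergent c1 \<and> puiseux_convergent c2 \<and>
        (\<forall>\<^sub>F u in at_top.
           open_segment (puiseux_eval c1 u) (puiseux_eval c2 u) \<subseteq> {v. (u, v) \<in> A ` S} \<and>
           {v. (u, v) \<in> A ` S} \<subseteq> closed_segment (puiseux_eval c1 u) (puiseux_eval c2 u)) \<and>
        (\<forall>q>\<omega>. c1 q = c2 q) \<and> (\<forall>w. (\<forall>q>w. c1 q = c2 q) \<longrightarrow> \<omega> \<le> w) \<and>
        (\<forall>q. Poly_Mapping.lookup \<phi> q = (if q > \<omega> then c1 q else 0)))"

text \<open>
  \<open>delta_star_data S A \<phi> \<omega>\<close>: for the choice of coordinates \<open>A\<close>, \<open>\<delta>\<^sup>*\<^sub>S\<close> is
  \<^term>\<open>semidegree \<phi> \<omega>\<close>. For \<open>\<phi> = 0\<close>, \<open>\<omega> = 1\<close> this is the usual degree.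
\<close>

definition delta_star_data ::
  "(real \<times> real) set \<Rightarrow> (real \<times> real \<Rightarrow> real \<times> real) \<Rightarrow> (rat \<Rightarrow>\<^sub>0 real) \<Rightarrow> rat \<Rightarrow> bool" where
  "delta_star_data S A \<phi> \<omega> \<longleftrightarrow>
     ((\<exists>P\<in>points_at_infinity S. \<exists>Q\<in>points_at_infinity S. P \<noteq> Q) \<and> A = id \<and> \<phi> = 0 \<and> \<omega> = 1) \<or>
     (\<exists>P. points_at_infinity S = {P} \<and> branch_data S P A \<phi> \<omega>)"

subsection \<open>Key forms\<close>

text \<open>
  \<open>\<complex>[u,u\<^sup>-\<^sup>1,y\<^sub>1,\<dots>,y\<^sub>l]\<close>: a monomial in the \<open>y\<^sub>j\<close> is its exponent vector, a finitely supported
  function on indices.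
\<close>

type_synonym laurent_mpoly = "(nat \<Rightarrow>\<^sub>0 nat) \<Rightarrow>\<^sub>0 laurent"

definition mpoly_in :: "nat \<Rightarrow> laurent_mpoly \<Rightarrow> bool" where
  "mpoly_in l G \<longleftrightarrow> (\<forall>m\<in>Poly_Mapping.keys G. Poly_Mapping.keys m \<subseteq> {1..l})"

definition mpoly_eval :: "laurent_mpoly \<Rightarrow> (nat \<Rightarrow> laurent poly) \<Rightarrow> laurent poly" where
  "mpoly_eval G f = (\<Sum>m\<in>Poly_Mapping.keys G. [:Poly_Mapping.lookup G m:] *
     (\<Prod>j\<in>Poly_Mapping.keys m. f j ^ Poly_Mapping.lookup m j))"

text \<open>The weight of \<open>u\<close> is \<open>w 0\<close>, that of \<open>y\<^sub>j\<close> is \<open>w j\<close>; meaningful for \<open>G \<noteq> 0\<close> only.\<close>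

definition weighted_degree :: "(nat \<Rightarrow> rat) \<Rightarrow> laurent_mpoly \<Rightarrow> rat" where
  "weighted_degree w G = Max {of_int k * w 0 +
       (\<Sum>j\<in>Poly_Mapping.keys m. of_nat (Poly_Mapping.lookup m j) * w j) |m k.
     m \<in> Poly_Mapping.keys G \<and> k \<in> Poly_Mapping.keys (Poly_Mapping.lookup G m)}"

definition key_alpha :: "(nat \<Rightarrow> rat) \<Rightarrow> nat \<Rightarrow> nat" where
  "key_alpha w j =
     (LEAST a. a > 0 \<and> (\<exists>m::nat \<Rightarrow> int. of_nat a * w j = (\<Sum>i<j. of_int (m i) * w i)))"

definition key_step :: "(nat \<Rightarrow> rat) \<Rightarrow> (nat \<Rightarrow> laurent poly) \<Rightarrow> nat \<Rightarrow> bool" where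
  "key_step w f j \<longleftrightarrow>
     (\<exists>(\<beta>::nat \<Rightarrow> int) \<theta>. \<theta> \<noteq> 0 \<and>
        of_nat (key_alpha w j) * w j = (\<Sum>i<j. of_int (\<beta> i) * w i) \<and>
        (\<forall>i. 1 \<le> i \<and> i < j \<longrightarrow> 0 \<le> \<beta> i \<and> \<beta> i < int (key_alpha w i)) \<and>
        f (Suc j) = f j ^ key_alpha w j - laurent_monom \<theta> (\<beta> 0) * (\<Prod>i=1..<j. f i ^ nat (\<beta> i)) \<and>
        w (Suc j) < of_nat (key_alpha w j) * w j)"

text \<open>
  \<open>fs = [f\<^sub>0, \<dots>, f\<^sub>l]\<close> is the sequence of key forms of \<open>\<delta>\<close>. In \<^const>\<open>key_step\<close> the factor
  \<open>f\<^sub>0\<^bsup>\<beta>\<^sub>0\<^esup> = u\<^bsup>\<beta>\<^sub>0\<^esup>\<close>, whose exponent may be negative, is part of the Laurent monomial.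
\<close>

definition key_forms :: "(laurent poly \<Rightarrow> rat) \<Rightarrow> laurent poly list \<Rightarrow> bool" where
  "key_forms \<delta> fs \<longleftrightarrow>
     (\<exists>l\<ge>1. length fs = Suc l \<and>
        fs ! 0 = laurent_monom 1 1 \<and> fs ! 1 = [:0, 1:] \<and>
        (\<forall>j. 1 \<le> j \<and> j < l \<longrightarrow> key_step (\<lambda>i. \<delta> (fs ! i)) ((!) fs) j) \<and>
        (\<forall>g. g \<noteq> 0 \<longrightarrow>
           (let E = {weighted_degree (\<lambda>i. \<delta> (fs ! i)) G |G. mpoly_in l G \<and> mpoly_eval G ((!) fs) = g}
            in \<delta> g \<in> E \<and> (\<forall>e\<in>E. \<delta> g \<le> e))))"

end

theory Submission
  imports Defs "HOL-Computational_Algebra.Fundamental_Theorem_Algebra"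
begin

text \<open>
  If \<open>S\<close> has several points at infinity, then by connectedness of the tentacle it meets infinitely
  many lines through the origin in unbounded sets. A polynomial bounded on \<open>S\<close> is constant on each of
  them, hence constant; and \<open>\<delta>\<^sup>*\<^sub>S = deg\<close> has last key form \<open>v\<close>.

  If there is one point at infinity, then \<open>\<xi> = (v - \<phi>(u)) / u\<^sup>\<omega>\<close> ranges over a bounded set with
  nonempty interior along the tentacle, so a nonzero polynomial \<open>p\<close> is bounded on \<open>S\<close> if and only if
  \<open>\<delta>(p) \<le> 0\<close>. It remains to decide whether a nonconstant polynomial with \<open>\<delta>(p) \<le> 0\<close> exists.
  Let \<open>F\<close> be the last key form.

  If \<open>\<delta>(F) < 0\<close>, expand polynomials of weighted degree at most \<open>d\<close> in powers of \<open>F\<close>: for large \<open>d\<close> the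
  condition \<open>\<delta> \<le> 0\<close> consists of fewer linear equations than there are unknowns.

  If \<open>\<delta>(F) \<ge> 0\<close>, write \<open>p\<close> in the monomials \<open>u\<^sup>k f\<^sub>1\<^bsup>a\<^sub>1\<^esup> \<dots> f\<^sub>l\<^bsup>a\<^sub>l\<^esup>\<close> with \<open>a\<^sub>i < \<alpha>\<^sub>i\<close> for \<open>i < l\<close>, all of
  weight at most \<open>\<delta>(p)\<close>. Since \<open>\<delta>(f\<^sub>i) / deg f\<^sub>i\<close> is strictly decreasing, the monomial of highest
  degree in \<open>v\<close> has weight at least \<open>k\<close>, where \<open>k \<ge> 0\<close>. This forces \<open>p\<close> to be constant unless
  \<open>\<delta>(F) = 0\<close> and \<open>p\<close> is \<open>c F\<^sup>N\<close> plus lower powers of \<open>F\<close> with coefficients of weight at most \<open>0\<close>. In that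
  case, let \<open>f\<^sub>j\<^sub>+\<^sub>1 = f\<^sub>j\<^bsup>\<alpha>\<^esup> - \<theta> m\<close> be the first key form that is not a polynomial: up to lower weight
  \<open>p\<close> is a power of \<open>f\<^sub>j\<^sub>+\<^sub>1\<close>, and the coefficient of \<open>m\<close> contradicts the polynomiality of \<open>p\<close>.
\<close>

subsection \<open>Polynomials inside Laurent polynomials\<close>

lemma nonneg_keys_add:
  fixes a b :: laurent
  assumes "\<forall>k\<in>Poly_Mapping.keys a. k \<ge> 0" "\<forall>k\<in>Poly_Mapping.keys b. k \<ge> 0"
  shows "\<forall>k\<in>Poly_Mapping.keys (a + b). k \<ge> 0"
  using assms Poly_Mapping.keys_add[of a b] by blast

lemma is_polynomial_add:
  "is_polynomial f \<Longrightarrow> is_polynomial g \<Longrightarrow> is_polynomial (f + g)"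
  unfolding is_polynomial_def coeff_add using nonneg_keys_add by blast

lemma is_polynomial_uminus: "is_polynomial f \<Longrightarrow> is_polynomial (- f)"
  unfolding is_polynomial_def by (simp add: in_keys_iff)

lemma is_polynomial_diff:
  "is_polynomial f \<Longrightarrow> is_polynomial g \<Longrightarrow> is_polynomial (f - g)"
  using is_polynomial_add[of f "- g"] is_polynomial_uminus[of g] by simp

lemma is_polynomial_0: "is_polynomial 0"
  by (simp add: is_polynomial_def)

lemma is_polynomial_1: "is_polynomial 1"
  by (auto simp: is_polynomial_def coeff_1 split: if_splits)

lemma is_polynomial_sum:
  "(\<And>i. i \<in> I \<Longrightarrow> is_polynomial (f i)) \<Longrightarrow> is_polynomial (sum f I)"
  by (induction I rule: infinite_finite_induct) (auto simp: is_polynomial_0 is_polynomial_add)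

lemma nonneg_keys_sum:
  fixes a :: "'i \<Rightarrow> laurent"
  assumes "\<And>i. i \<in> I \<Longrightarrow> \<forall>k\<in>Poly_Mapping.keys (a i). k \<ge> 0"
  shows "\<forall>k\<in>Poly_Mapping.keys (sum a I). k \<ge> 0"
  using assms Poly_Mapping.keys_sum[of a I] by blast

lemma is_polynomial_mult:
  assumes "is_polynomial f" "is_polynomial g"
  shows "is_polynomial (f * g)"
proof -
  have "\<forall>k\<in>Poly_Mapping.keys (coeff f i * coeff g j). k \<ge> 0" for i j
  proof
    fix k assume "k \<in> Poly_Mapping.keys (coeff f i * coeff g j)"
    then obtain a b where "k = a + b" "a \<in> Poly_Mapping.keys (coeff f i)" "b \<in> Poly_Mapping.keys (coeff g j)"
      using keys_mult by blast
    then show "k \<ge> 0" using assms by (auto simp: is_polynomial_def)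
  qed
  then show ?thesis unfolding is_polynomial_def coeff_mult by (intro allI nonneg_keys_sum) auto
qed

lemma is_polynomial_power: "is_polynomial f \<Longrightarrow> is_polynomial (f ^ n)"
  by (induction n) (auto simp: is_polynomial_1 is_polynomial_mult)

lemma is_polynomial_prod:
  "(\<And>i. i \<in> I \<Longrightarrow> is_polynomial (f i)) \<Longrightarrow> is_polynomial (prod f I)"
  by (induction I rule: infinite_finite_induct) (auto simp: is_polynomial_1 is_polynomial_mult)

lemma is_polynomial_laurent_monom: "k \<ge> 0 \<Longrightarrow> is_polynomial (laurent_monom c k)"
  by (auto simp: is_polynomial_def laurent_monom_def coeff_pCons split: nat.splits if_splits)

text \<open>\<open>adic_is_polynomial\<close> proves a coefficient polynomial by showing that its
  part \<open>r\<close> vanishes.\<close>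

lemma negative_part:
  obtains h r where "x = h + r" "is_polynomial h" "\<And>i k. k \<in> Poly_Mapping.keys (coeff r i) \<Longrightarrow> k < 0"
proof -
  let ?neg = "Poly_Mapping.mapp (\<lambda>k c. if k < 0 then c else 0) :: laurent \<Rightarrow> laurent"
  have lk: "Poly_Mapping.lookup (?neg a) k = (if k < 0 then Poly_Mapping.lookup a k else 0)" for a k
    by (auto simp: lookup_mapp when_def in_keys_iff)
  have n0: "?neg 0 = 0" by (rule poly_mapping_eqI) (simp add: lk)
  let ?r = "map_poly ?neg x"
  have "is_polynomial (x - ?r)"
    unfolding is_polynomial_def
    by (auto simp: coeff_map_poly n0 in_keys_iff lookup_minus lk split: if_splits)
  moreover have "k < 0" if "k \<in> Poly_Mapping.keys (coeff ?r i)" for i k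
    using that by (auto simp: coeff_map_poly n0 in_keys_iff lk split: if_splits)
  ultimately show ?thesis by (intro that[of "x - ?r" ?r]) auto
qed

subsection \<open>Expansions in powers of a monic polynomial\<close>

lemma lead_coeff_monic_power: "lead_coeff g = 1 \<Longrightarrow> lead_coeff (g ^ n) = (1::'a::idom)"
  by (simp add: lead_coeff_power)

lemma degree_mult_monic:
  fixes g :: "'a::idom poly"
  assumes "lead_coeff g = 1" "x \<noteq> 0"
  shows "degree (x * g) = degree x + degree g" "lead_coeff (x * g) = lead_coeff x"
proof -
  have "g \<noteq> 0" using assms(1) by auto
  then show "degree (x * g) = degree x + degree g" using assms(2) by (simp add: degree_mult_eq)
  show "lead_coeff (x * g) = lead_coeff x" using assms(1) by (simp add: lead_coeff_mult)
qed

lemma degree_mult_monic_power: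
  fixes g :: "'a::idom poly"
  assumes "lead_coeff g = 1" "x \<noteq> 0"
  shows "degree (x * g ^ n) = degree x + n * degree g" "lead_coeff (x * g ^ n) = lead_coeff x"
proof -
  have "g \<noteq> 0" using assms(1) by auto
  then show "degree (x * g ^ n) = degree x + n * degree g"
    using degree_mult_monic[OF lead_coeff_monic_power[OF assms(1)] assms(2)]
    by (simp add: degree_power_eq)
  show "lead_coeff (x * g ^ n) = lead_coeff x"
    using degree_mult_monic(2)[OF lead_coeff_monic_power[OF assms(1)] assms(2)] .
qed

text \<open>A nonzero term of index \<open>n\<close> has degree below
  \<open>Suc n * degree g\<close>, which is at most \<open>N * degree g\<close>.\<close>

lemma coeff_adic_eq_0:
  fixes g :: "'a::idom poly"
  assumes g: "lead_coeff g = 1" "degree g > 0"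
    and b: "\<And>n. b n = 0 \<or> degree (b n) < degree g"
    and i: "i \<ge> N * degree g"
  shows "coeff (\<Sum>n<N. b n * g ^ n) i = 0"
proof -
  have "coeff (b n * g ^ n) i = 0" if "n < N" for n
  proof (cases "b n = 0")
    case False
    have "degree (b n * g ^ n) < degree g + n * degree g"
      using degree_mult_monic_power[OF g(1) False] b[of n] False by simp
    also have "\<dots> = Suc n * degree g" by simp
    also have "\<dots> \<le> N * degree g" using that by (intro mult_right_mono) auto
    finally show ?thesis using i by (intro coeff_eq_0) simp
  qed simp
  then show ?thesis by (simp add: coeff_sum)
qed

text \<open>The degrees of the nonzero terms lie in disjoint intervals, starting at
  \<open>n * degree g\<close> and of length \<open>degree g\<close>. So nothing cancels the leading
  term of the nonzero summand with largest index.\<close>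

lemma adic_top:
  fixes g :: "'a::idom poly"
  assumes g: "lead_coeff g = 1" "degree g > 0"
    and b: "\<And>n. b n = 0 \<or> degree (b n) < degree g"
    and "x = (\<Sum>n<N. b n * g ^ n)" "x \<noteq> 0"
  shows "\<exists>n<N. b n \<noteq> 0 \<and> degree x = degree (b n) + n * degree g \<and> lead_coeff x = lead_coeff (b n)
      \<and> x = (\<Sum>n<Suc n. b n * g ^ n)"
  using assms(4,5)
proof (induction N arbitrary: x)
  case (Suc N)
  let ?y = "\<Sum>n<N. b n * g ^ n"
  show ?case
  proof (cases "b N = 0")
    case True
    then have "x = ?y" using Suc.prems by simp
    then show ?thesis using Suc.IH[of x] Suc.prems(2) less_Suc_eq by metis
  next
    case False
    let ?z = "b N * g ^ N"
    have z: "degree ?z = degree (b N) + N * degree g" "lead_coeff ?z = lead_coeff (b N)"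
      using degree_mult_monic_power[OF g(1) False] by auto
    have x: "x = ?y + ?z" using Suc.prems by simp
    have cy: "coeff ?y i = 0" if "i \<ge> degree ?z" for i
      using coeff_adic_eq_0[OF g b, of N i] that z(1) by simp
    have c1: "coeff x (degree ?z) = lead_coeff (b N)" using cy[of "degree ?z"] z(2) x by simp
    have "degree x \<le> degree ?z"
      by (rule degree_le) (use cy x in \<open>auto simp: coeff_eq_0\<close>)
    moreover have "degree x \<ge> degree ?z" using c1 False by (intro le_degree) simp
    ultimately have "degree x = degree ?z" by simp
    with c1 z Suc.prems(1) False show ?thesis by (intro exI[of _ N]) auto
  qed
qed simp

text \<open>Division by a monic polynomial without negative powers of \<open>u\<close> creates none.
  The top digit is treated first: its negative part would show up in the leading coefficient. The
  top term is then subtracted and the induction goes on.\<close>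

lemma adic_is_polynomial:
  assumes g: "lead_coeff g = 1" "degree g > 0" "is_polynomial g"
    and b: "\<And>n. b n = 0 \<or> degree (b n) < degree g"
    and "is_polynomial (\<Sum>n<N. b n * g ^ n)" "n < N"
  shows "is_polynomial (b n)"
  using assms(5,6)
proof (induction N)
  case (Suc N)
  let ?x = "\<Sum>n<Suc N. b n * g ^ n" and ?y = "\<Sum>n<N. b n * g ^ n"
  obtain h r where hr: "b N = h + r" "is_polynomial h" "\<And>i k. k \<in> Poly_Mapping.keys (coeff r i) \<Longrightarrow> k < 0"
    using negative_part by metis
  have "r = 0"
  proof (rule ccontr)
    assume "r \<noteq> 0"
    note d = degree_mult_monic_power[OF g(1) this, of N]
    \<comment> \<open>In this degree only \<open>h * g ^ N\<close> and \<open>r * g ^ N\<close> can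
      contribute to \<open>?x\<close>, and the former is polynomial.\<close>
    let ?i = "degree r + N * degree g"
    have "coeff ?y ?i = 0" by (rule coeff_adic_eq_0[OF g(1,2) b]) simp
    moreover have "?x = ?y + h * g ^ N + r * g ^ N" by (simp add: hr(1) algebra_simps)
    ultimately have "lead_coeff r = coeff (?x - h * g ^ N) ?i"
      using d by simp
    moreover have "is_polynomial (?x - h * g ^ N)"
      using Suc.prems hr(2) g(3) by (intro is_polynomial_diff is_polynomial_mult is_polynomial_power)
    ultimately have nn: "\<forall>k\<in>Poly_Mapping.keys (lead_coeff r). k \<ge> 0" by (simp add: is_polynomial_def)
    have "Poly_Mapping.keys (lead_coeff r) = {}"
      using nn hr(3)[of _ "degree r"] by (meson all_not_in_conv not_le)
    then show False using \<open>r \<noteq> 0\<close> by simp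
  qed
  then have bN: "is_polynomial (b N)" using hr by simp
  have "?y = ?x - b N * g ^ N" by simp
  moreover have "is_polynomial (?x - b N * g ^ N)"
    using Suc.prems bN g(3) by (intro is_polynomial_diff is_polynomial_mult is_polynomial_power)
  ultimately have "is_polynomial ?y" by simp
  with Suc bN show ?case using less_Suc_eq by metis
qed simp

subsection \<open>The normal form with respect to a sequence of key forms\<close>

lemma laurent_monom_one: "laurent_monom 1 0 = 1"
  by (simp add: laurent_monom_def)

lemma laurent_monom_mult: "laurent_monom c k * laurent_monom d m = laurent_monom (c * d) (k + m)"
  by (simp add: laurent_monom_def mult_single add.commute mult.commute)

lemma laurent_monom_power: "laurent_monom c k ^ n = laurent_monom (c ^ n) (of_nat n * k)"
  by (induction n) (simp_all add: laurent_monom_mult laurent_monom_one ring_distribs)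

lemma laurent_monom_0 [simp]: "laurent_monom 0 k = 0"
  by (simp add: laurent_monom_def)

lemma of_nat_laurent_monom: "of_nat n = laurent_monom (of_nat n) 0"
  by (simp add: laurent_monom_def of_nat_poly)

lemma laurent_monom_uminus: "laurent_monom (- c) k = - laurent_monom c k"
  by (simp add: laurent_monom_def single_uminus)

lemma poly_mapping_expand:
  "g = (\<Sum>k\<in>Poly_Mapping.keys g. Poly_Mapping.single k (Poly_Mapping.lookup g k))"
  by (rule poly_mapping_eqI) (auto simp: lookup_sum lookup_single when_def in_keys_iff)

lemma laurent_expand:
  "[:a:] = (\<Sum>k\<in>Poly_Mapping.keys a. laurent_monom (Poly_Mapping.lookup a k) k)"
  by (subst poly_mapping_expand) (auto simp: laurent_monom_def coeff_sum coeff_pCons intro!: poly_eqI split: nat.splits)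

text \<open>The data of \<open>key_step\<close> with the existential quantifiers resolved. The
  exponent \<open>\<kappa> j\<close> of \<open>u\<close> is kept apart from the exponents
  \<open>\<beta> j i\<close> because it may be negative; the weight of \<open>u\<close> is
  normalized to 1.\<close>

locale key_sequence =
  fixes f :: "nat \<Rightarrow> laurent poly" and w :: "nat \<Rightarrow> rat" and \<alpha> :: "nat \<Rightarrow> nat"
    and \<kappa> :: "nat \<Rightarrow> int" and \<beta> :: "nat \<Rightarrow> nat \<Rightarrow> nat" and \<theta> :: "nat \<Rightarrow> complex" and l :: nat
  assumes l: "1 \<le> l"
    and f1: "f 1 = [:0, 1:]"
    and \<alpha>_pos: "\<And>j. 1 \<le> j \<Longrightarrow> j < l \<Longrightarrow> \<alpha> j > 0"
    and \<theta>: "\<And>j. 1 \<le> j \<Longrightarrow> j < l \<Longrightarrow> \<theta> j \<noteq> 0"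
    and weight: "\<And>j. 1 \<le> j \<Longrightarrow> j < l \<Longrightarrow>
      of_nat (\<alpha> j) * w j = of_int (\<kappa> j) + (\<Sum>i=1..<j. of_nat (\<beta> j i) * w i)"
    and \<beta>_less: "\<And>i j. 1 \<le> i \<Longrightarrow> i < j \<Longrightarrow> j < l \<Longrightarrow> \<beta> j i < \<alpha> i"
    and step: "\<And>j. 1 \<le> j \<Longrightarrow> j < l \<Longrightarrow>
      f (Suc j) = f j ^ \<alpha> j - laurent_monom (\<theta> j) (\<kappa> j) * (\<Prod>i=1..<j. f i ^ \<beta> j i)"
    and w_less: "\<And>j. 1 \<le> j \<Longrightarrow> j < l \<Longrightarrow> w (Suc j) < of_nat (\<alpha> j) * w j"
begin

section \<open>Monomials in the key forms, their weights and degrees\<close>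

definition mon :: "nat \<Rightarrow> (nat \<Rightarrow> nat) \<Rightarrow> laurent poly" where
  "mon j a = (\<Prod>i=1..j. f i ^ a i)"

definition wt :: "nat \<Rightarrow> (nat \<Rightarrow> nat) \<Rightarrow> rat" where
  "wt j a = (\<Sum>i=1..j. of_nat (a i) * w i)"

text \<open>For j from 1 to \<open>l\<close> this is the degree of \<open>f j\<close> in
  \<open>v\<close>, by \<open>key_monic\<close>.\<close>

definition D :: "nat \<Rightarrow> nat" where
  "D j = (\<Prod>i=1..<j. \<alpha> i)"

text \<open>
  \<open>basic j e\<close> consists of the combinations of monomials \<open>u\<^sup>k f\<^sub>1\<^bsup>a\<^sub>1\<^esup> \<dots> f\<^sub>j\<^bsup>a\<^sub>j\<^esup>\<close> of weight at most
  \<open>e\<close> with all \<open>a\<^sub>i < \<alpha>\<^sub>i\<close>; in \<open>normal j e\<close> the last exponent is unrestricted.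
\<close>

primrec basic :: "nat \<Rightarrow> rat \<Rightarrow> laurent poly set" where
  "basic 0 e = {[:a:] |a. \<forall>k\<in>Poly_Mapping.keys a. of_int k \<le> e}"
| "basic (Suc j) e = {\<Sum>n<\<alpha> (Suc j). b n * f (Suc j) ^ n |b. \<forall>n. b n \<in> basic j (e - of_nat n * w (Suc j))}"

definition normal :: "nat \<Rightarrow> rat \<Rightarrow> laurent poly set" where
  "normal j e = {\<Sum>n<N. b n * f j ^ n |N b. \<forall>n. b n \<in> basic (j - 1) (e - of_nat n * w j)}"

text \<open>All exponents are allowed here, which makes the filtration multiplicative
  (\<open>fil_mult\<close>); \<open>fil_normal\<close> leads back to reduced exponents. Generators
  enter one at a time, so that the induction rule deals with single monomials.\<close>

inductive_set fil :: "nat \<Rightarrow> rat \<Rightarrow> laurent poly set" for j e where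
  zero: "0 \<in> fil j e"
| add: "x \<in> fil j e \<Longrightarrow> of_int k + wt j a \<le> e \<Longrightarrow> x + laurent_monom c k * mon j a \<in> fil j e"

lemma mon_0 [simp]: "mon 0 a = 1" and wt_0 [simp]: "wt 0 a = 0"
  by (simp_all add: mon_def wt_def)

lemma mon_Suc: "mon (Suc j) a = mon j a * f (Suc j) ^ a (Suc j)"
  and wt_Suc: "wt (Suc j) a = wt j a + of_nat (a (Suc j)) * w (Suc j)"
  by (simp_all add: mon_def wt_def)

lemma mon_add: "mon j (\<lambda>i. a i + b i) = mon j a * mon j b"
  by (simp add: mon_def power_add prod.distrib)

lemma wt_add: "wt j (\<lambda>i. a i + b i) = wt j a + wt j b"
  by (simp add: wt_def ring_distribs sum.distrib)

lemma mon_cong: "(\<And>i. 1 \<le> i \<Longrightarrow> i \<le> j \<Longrightarrow> a i = b i) \<Longrightarrow> mon j a = mon j b"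
  and wt_cong: "(\<And>i. 1 \<le> i \<Longrightarrow> i \<le> j \<Longrightarrow> a i = b i) \<Longrightarrow> wt j a = wt j b"
  unfolding mon_def wt_def by (auto intro!: prod.cong sum.cong)

lemma mon_delta:
  "1 \<le> i \<Longrightarrow> i \<le> j \<Longrightarrow> mon j (\<lambda>r. if r = i then n else 0) = f i ^ n"
proof -
  assume i: "1 \<le> i" "i \<le> j"
  have "mon j (\<lambda>r. if r = i then n else 0) = (\<Prod>r=1..j. if r = i then f r ^ n else 1)"
    unfolding mon_def by (intro prod.cong) auto
  also have "\<dots> = f i ^ n" using i by (simp add: prod.delta)
  finally show ?thesis .
qed

lemma wt_delta: "1 \<le> i \<Longrightarrow> i \<le> j \<Longrightarrow> wt j (\<lambda>r. if r = i then n else 0) = of_nat n * w i"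
proof -
  assume i: "1 \<le> i" "i \<le> j"
  have "wt j (\<lambda>r. if r = i then n else 0) = (\<Sum>r=1..j. if r = i then of_nat n * w r else 0)"
    unfolding wt_def by (intro sum.cong) auto
  also have "\<dots> = of_nat n * w i" using i by (simp add: sum.delta)
  finally show ?thesis .
qed

lemma mon_restrict: "i \<le> Suc j \<Longrightarrow> mon j (\<lambda>r. if r < i then a r else 0) = (\<Prod>r=1..<i. f r ^ a r)"
  unfolding mon_def by (rule prod.mono_neutral_cong_right) auto

lemma wt_restrict: "i \<le> Suc j \<Longrightarrow> wt j (\<lambda>r. if r < i then a r else 0) = (\<Sum>r=1..<i. of_nat (a r) * w r)"
  unfolding wt_def by (rule sum.mono_neutral_cong_right) auto

lemma D_1 [simp]: "D (Suc 0) = 1" by (simp add: D_def)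

lemma D_Suc: "1 \<le> j \<Longrightarrow> D (Suc j) = D j * \<alpha> j"
  by (simp add: D_def)

lemma D_pos: "j \<le> l \<Longrightarrow> D j > 0"
  unfolding D_def by (rule prod_pos) (use \<alpha>_pos in auto)

lemma zero_in_basic: "0 \<in> basic j e"
proof (induction j arbitrary: e)
  case (Suc j)
  show ?case by (auto intro!: exI[of _ "\<lambda>_. 0"] simp: Suc)
qed (auto intro!: exI[of _ 0])

lemma basic_add: "x \<in> basic j e \<Longrightarrow> y \<in> basic j e \<Longrightarrow> x + y \<in> basic j e"
proof (induction j arbitrary: e x y)
  case 0
  then obtain a b where "x = [:a:]" "y = [:b:]"
    "\<forall>k\<in>Poly_Mapping.keys a. of_int k \<le> e" "\<forall>k\<in>Poly_Mapping.keys b. of_int k \<le> e" by auto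
  then show ?case using Poly_Mapping.keys_add[of a b] by (auto intro!: exI[of _ "a + b"])
next
  case (Suc j)
  from Suc.prems obtain b b' where
    "x = (\<Sum>n<\<alpha> (Suc j). b n * f (Suc j) ^ n)" "\<forall>n. b n \<in> basic j (e - of_nat n * w (Suc j))"
    "y = (\<Sum>n<\<alpha> (Suc j). b' n * f (Suc j) ^ n)" "\<forall>n. b' n \<in> basic j (e - of_nat n * w (Suc j))"
    by auto
  then show ?case
    using Suc.IH by (auto intro!: exI[of _ "\<lambda>n. b n + b' n"] simp: ring_distribs sum.distrib)
qed

lemma basic_mono: "x \<in> basic j e \<Longrightarrow> e \<le> e' \<Longrightarrow> x \<in> basic j e'"
proof (induction j arbitrary: e e' x)
  case (Suc j)
  then obtain b where b: "x = (\<Sum>n<\<alpha> (Suc j). b n * f (Suc j) ^ n)"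
    "\<forall>n. b n \<in> basic j (e - of_nat n * w (Suc j))"
    by auto
  have "b n \<in> basic j (e' - of_nat n * w (Suc j))" for n
    using Suc.IH[OF b(2)[rule_format]] Suc.prems by simp
  then show ?case using b(1) by (auto intro!: exI[of _ b])
qed force

lemma basic_sum: "(\<And>i. i \<in> I \<Longrightarrow> x i \<in> basic j e) \<Longrightarrow> sum x I \<in> basic j e"
  by (induction I rule: infinite_finite_induct) (auto simp: zero_in_basic basic_add)

lemma mon_in_basic:
  assumes "\<And>i. 1 \<le> i \<Longrightarrow> i \<le> j \<Longrightarrow> a i < \<alpha> i" "of_int k + wt j a \<le> e"
  shows "laurent_monom c k * mon j a \<in> basic j e"
  using assms
proof (induction j arbitrary: e)
  case 0
  then show ?case by (auto simp: laurent_monom_def split: if_splits)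
next
  case (Suc j)
  let ?m = "laurent_monom c k * mon j a"
  have m: "?m \<in> basic j (e - of_nat (a (Suc j)) * w (Suc j))"
    by (rule Suc.IH) (use Suc.prems in \<open>auto simp: wt_Suc\<close>)
  have "a (Suc j) < \<alpha> (Suc j)" using Suc.prems by simp
  then have "?m * f (Suc j) ^ a (Suc j) =
      (\<Sum>n<\<alpha> (Suc j). (if n = a (Suc j) then ?m else 0) * f (Suc j) ^ n)"
    by (subst sum.mono_neutral_right[of _ "{a (Suc j)}"]) auto
  then show ?case using m zero_in_basic
    by (auto simp: mon_Suc mult.assoc intro!: exI[of _ "\<lambda>n. if n = a (Suc j) then ?m else 0"])
qed

text \<open>Monicity of the earlier key forms is a hypothesis because \<open>key_monic\<close> calls
  this lemma inside its own induction. The bound is that of an \<open>f (Suc j)\<close>-adic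
  expansion with \<open>\<alpha> (Suc j)\<close> digits.\<close>

lemma basic_degree_aux:
  assumes "j < l" "\<And>i. 1 \<le> i \<Longrightarrow> i \<le> j \<Longrightarrow> lead_coeff (f i) = 1 \<and> degree (f i) = D i" "x \<in> basic j e"
  shows "x = 0 \<or> degree x < D (Suc j)"
  using assms
proof (induction j arbitrary: e x)
  case (Suc j)
  then obtain b where b: "x = (\<Sum>n<\<alpha> (Suc j). b n * f (Suc j) ^ n)"
    "\<forall>n. b n \<in> basic j (e - of_nat n * w (Suc j))" by auto
  have "lead_coeff (f (Suc j)) = 1 \<and> degree (f (Suc j)) = D (Suc j)" by (rule Suc.prems(2)) auto
  then have fj: "lead_coeff (f (Suc j)) = 1" "degree (f (Suc j)) = D (Suc j)" by blast+
  have IH: "b n = 0 \<or> degree (b n) < degree (f (Suc j))" for n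
    using Suc.IH[of "b n"] Suc.prems b(2) fj by fastforce
  have "D (Suc j) > 0" using D_pos Suc.prems by simp
  then have "coeff x i = 0" if "i \<ge> D (Suc (Suc j))" for i
    unfolding b(1) using that
    by (intro coeff_adic_eq_0 fj IH) (auto simp: fj D_Suc algebra_simps)
  then show ?case using leading_coeff_0_iff not_le by metis
qed auto

text \<open>The term subtracted from \<open>f i ^ \<alpha> i\<close> lies in
  \<open>basic (i - 1)\<close>, since its exponents are below the \<open>\<alpha>\<close>. So its
  degree is below \<open>D i\<close>, and the leading term of \<open>f i ^ \<alpha> i\<close>
  survives.\<close>

lemma key_monic: "1 \<le> j \<Longrightarrow> j \<le> l \<Longrightarrow> lead_coeff (f j) = 1 \<and> degree (f j) = D j"
proof (induction j rule: less_induct)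
  case (less j)
  show ?case
  proof (cases "j = 1")
    case True
    then show ?thesis using f1 by simp
  next
    case False
    then obtain i where j: "j = Suc i" "1 \<le> i" "i < l" using less.prems by (cases j) auto
    let ?m = "laurent_monom (\<theta> i) (\<kappa> i) * (\<Prod>r=1..<i. f r ^ \<beta> i r)"
    have "{1..<i} = {1..i - 1}" by auto
    then have "?m = laurent_monom (\<theta> i) (\<kappa> i) * mon (i - 1) (\<beta> i)"
      by (simp add: mon_def)
    moreover have "\<dots> \<in> basic (i - 1) (of_int (\<kappa> i) + wt (i - 1) (\<beta> i))"
      using j \<beta>_less by (intro mon_in_basic) auto
    ultimately have mem: "?m \<in> basic (i - 1) (of_int (\<kappa> i) + wt (i - 1) (\<beta> i))" by (simp only:)
    have "lead_coeff (f r) = 1 \<and> degree (f r) = D r" if "1 \<le> r" "r \<le> i - 1" for r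
      by (rule less.IH) (use that j less.prems in auto)
    with mem have "?m = 0 \<or> degree ?m < D (Suc (i - 1))"
      using j by (intro basic_degree_aux[of "i - 1"]) (linarith | assumption | blast)+
    then have m: "?m = 0 \<or> degree ?m < D i" using j by simp
    have fi: "lead_coeff (f i) = 1" "degree (f i) = D i" using less.IH[of i] j by (metis lessI less_imp_le)+
    have pos: "D i > 0" "\<alpha> i > 0" using D_pos[of i] \<alpha>_pos j by auto
    have "f i \<noteq> 0" using fi pos by auto
    then have d: "degree (f i ^ \<alpha> i) = D j" using fi j by (simp add: degree_power_eq D_Suc mult.commute)
    have "D i \<le> D j" using pos j by (simp add: D_Suc)
    with m d have md: "degree (- ?m) < degree (f i ^ \<alpha> i) \<or> ?m = 0" by auto
    have fj: "f j = - ?m + f i ^ \<alpha> i" using step[of i] j by simp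
    have lc: "lead_coeff (f i ^ \<alpha> i) = 1" by (rule lead_coeff_monic_power[OF fi(1)])
    show ?thesis
    proof (cases "?m = 0")
      case True
      then have "f j = f i ^ \<alpha> i" using fj by simp
      then show ?thesis using lc d by metis
    next
      case False
      with md have "degree (- ?m) < degree (f i ^ \<alpha> i)" by blast
      then have "degree (f j) = degree (f i ^ \<alpha> i)" "lead_coeff (f j) = lead_coeff (f i ^ \<alpha> i)"
        unfolding fj using degree_add_eq_right lead_coeff_add_le by blast+
      then show ?thesis using lc d by metis
    qed
  qed
qed

lemma basic_degree: "j < l \<Longrightarrow> x \<in> basic j e \<Longrightarrow> x = 0 \<or> degree x < D (Suc j)"
  using basic_degree_aux key_monic by (meson le_trans less_imp_le_nat)

lemma basic_degree': "1 \<le> j \<Longrightarrow> j \<le> l \<Longrightarrow> x \<in> basic (j - 1) e \<Longrightarrow> x = 0 \<or> degree x < degree (f j)"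
  using basic_degree[of "j - 1" x e] key_monic[of j] by simp

text \<open>The slopes \<open>w\<^sub>j / D\<^sub>j\<close> decrease strictly, which is what makes the last one control the leading term.\<close>

lemma basic_lead:
  assumes "j < l" "x \<in> basic j e" "x \<noteq> 0" "k \<in> Poly_Mapping.keys (lead_coeff x)"
  shows "of_int k * of_nat (D (Suc j)) + of_nat (degree x) * w (Suc j) \<le> e * of_nat (D (Suc j)) \<and>
    (degree x > 0 \<longrightarrow> of_int k * of_nat (D (Suc j)) + of_nat (degree x) * w (Suc j) < e * of_nat (D (Suc j)))"
  using assms
proof (induction j arbitrary: e x)
  case 0
  then show ?case by auto
next
  case (Suc j)
  let ?g = "f (Suc j)" and ?D = "of_nat (D (Suc j)) :: rat" and ?\<alpha> = "of_nat (\<alpha> (Suc j)) :: rat"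
  from Suc.prems obtain b where b: "x = (\<Sum>n<\<alpha> (Suc j). b n * ?g ^ n)"
    "\<forall>n. b n \<in> basic j (e - of_nat n * w (Suc j))" by auto
  have "lead_coeff ?g = 1 \<and> degree ?g = D (Suc j)" using Suc.prems by (intro key_monic) auto
  then have g: "lead_coeff ?g = 1" "degree ?g = D (Suc j)" by blast+
  have pos: "D (Suc j) > 0" "\<alpha> (Suc j) > 0" using D_pos \<alpha>_pos Suc.prems by auto
  have "b n = 0 \<or> degree (b n) < degree ?g" for n
    using basic_degree[of j "b n"] b(2) g Suc.prems by auto
  from adic_top[OF g(1) _ this b(1) Suc.prems(3)] pos g obtain n where n: "b n \<noteq> 0"
    "degree x = degree (b n) + n * D (Suc j)" "lead_coeff x = lead_coeff (b n)" by auto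
  have "of_int k * ?D + of_nat (degree (b n)) * w (Suc j) \<le> (e - of_nat n * w (Suc j)) * ?D"
    using Suc.IH[of "b n" "e - of_nat n * w (Suc j)"] b(2) n Suc.prems by auto
  then have "of_int k * ?D + of_nat (degree x) * w (Suc j) \<le> e * ?D"
    by (simp add: n(2) algebra_simps)
  \<comment> \<open>Scaling by \<open>\<alpha> (Suc j)\<close> turns \<open>D (Suc j)\<close> into
    \<open>D (Suc (Suc j))\<close>. Replacing \<open>\<alpha> (Suc j) * w (Suc j)\<close> by the
    smaller \<open>w (Suc (Suc j))\<close> then gains strictly as soon as \<open>x\<close> has
    positive degree.\<close>
  then have "?\<alpha> * (of_int k * ?D + of_nat (degree x) * w (Suc j)) \<le> ?\<alpha> * (e * ?D)"
    by (intro mult_left_mono) auto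
  then have *: "of_int k * (?D * ?\<alpha>) + of_nat (degree x) * (?\<alpha> * w (Suc j)) \<le> e * (?D * ?\<alpha>)"
    by (simp only: algebra_simps)
  have w: "w (Suc (Suc j)) < ?\<alpha> * w (Suc j)" using w_less Suc.prems by simp
  have le: "of_nat (degree x) * w (Suc (Suc j)) \<le> of_nat (degree x) * (?\<alpha> * w (Suc j))"
    by (rule mult_left_mono) (use w in auto)
  have less: "of_nat (degree x) * w (Suc (Suc j)) < of_nat (degree x) * (?\<alpha> * w (Suc j))" if "degree x > 0"
    by (rule mult_strict_left_mono[OF w]) (use that in simp)
  have D: "of_nat (D (Suc (Suc j))) = ?D * ?\<alpha>" by (simp add: D_Suc)
  show ?case unfolding D
  proof (intro conjI impI)
    show "of_int k * (?D * ?\<alpha>) + of_nat (degree x) * w (Suc (Suc j)) \<le> e * (?D * ?\<alpha>)"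
      using * le by linarith
    show "of_int k * (?D * ?\<alpha>) + of_nat (degree x) * w (Suc (Suc j)) < e * (?D * ?\<alpha>)" if "degree x > 0"
      using * less[OF that] by linarith
  qed
qed

section \<open>Reduction to normal form\<close>

lemma normal_add: "x \<in> normal j e \<Longrightarrow> y \<in> normal j e \<Longrightarrow> x + y \<in> normal j e"
proof -
  assume "x \<in> normal j e" "y \<in> normal j e"
  then obtain N b M c where x: "x = (\<Sum>n<N. b n * f j ^ n)" "\<forall>n. b n \<in> basic (j - 1) (e - of_nat n * w j)"
    and y: "y = (\<Sum>n<M. c n * f j ^ n)" "\<forall>n. c n \<in> basic (j - 1) (e - of_nat n * w j)"
    unfolding normal_def by auto
  let ?b = "\<lambda>n. (if n < N then b n else 0) + (if n < M then c n else 0)"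
  have "x = (\<Sum>n<max N M. (if n < N then b n else 0) * f j ^ n)"
    unfolding x by (rule sum.mono_neutral_cong_left) auto
  moreover have "y = (\<Sum>n<max N M. (if n < M then c n else 0) * f j ^ n)"
    unfolding y by (rule sum.mono_neutral_cong_left) auto
  ultimately have "x + y = (\<Sum>n<max N M. ?b n * f j ^ n)"
    by (simp add: ring_distribs sum.distrib)
  moreover have "\<forall>n. ?b n \<in> basic (j - 1) (e - of_nat n * w j)"
    using x y zero_in_basic basic_add by auto
  ultimately show ?thesis unfolding normal_def
    by (intro CollectI exI[of _ "max N M"] exI[of _ ?b] conjI)
qed

lemma zero_in_normal: "0 \<in> normal j e"
  unfolding normal_def by (auto intro!: exI[of _ 0] exI[of _ "\<lambda>_. 0"] simp: zero_in_basic)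

lemma basic_in_normal: "x \<in> basic (j - 1) e \<Longrightarrow> x * f j ^ n \<in> normal j (e + of_nat n * w j)"
proof -
  assume x: "x \<in> basic (j - 1) e"
  have "x * f j ^ n = (\<Sum>i<Suc n. (if i = n then x else 0) * f j ^ i)"
    by (subst sum.mono_neutral_right[of _ "{n}"]) auto
  then show ?thesis unfolding normal_def
    using x zero_in_basic by (auto intro!: exI[of _ "Suc n"] exI[of _ "\<lambda>i. if i = n then x else 0"])
qed

text \<open>Mixed radix notation: digits \<open>a r < \<alpha> r\<close> at the places
  \<open>D r\<close> give a number below the next place value.\<close>

lemma sum_digits_less:
  assumes "i \<le> l" "\<And>r. 1 \<le> r \<Longrightarrow> r < i \<Longrightarrow> a r < \<alpha> r"
  shows "(\<Sum>r=1..<i. a r * D r) < D i \<or> i = 0"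
  using assms
proof (induction i)
  case (Suc i)
  show ?case
  proof (cases "i = 0")
    case False
    have "(\<Sum>r=1..<i. a r * D r) + a i * D i < D i + a i * D i" using Suc False by simp
    also have "\<dots> = Suc (a i) * D i" by simp
    also have "\<dots> \<le> \<alpha> i * D i" using Suc.prems False by (intro mult_right_mono) (auto simp: Suc_le_eq)
    finally show ?thesis using False by (simp add: D_Suc mult.commute)
  qed auto
qed auto

text \<open>
  One rewriting step \<open>f\<^sub>i\<^bsup>\<alpha>\<^sub>i\<^esup> = f\<^sub>i\<^sub>+\<^sub>1 + \<theta> u\<^sup>\<kappa> \<Prod> f\<^sub>r\<^bsup>\<beta>\<^sub>r\<^esup>\<close>. The first summand has smaller weight and the
  second has the same weight; the pair of measures decreases lexicographically in both.
\<close>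

definition dg :: "nat \<Rightarrow> (nat \<Rightarrow> nat) \<Rightarrow> nat" where
  "dg j a = (\<Sum>i=1..j. a i * D i)"

text \<open>Replacing \<open>f i ^ \<alpha> i\<close> by \<open>f (Suc i)\<close> keeps
  \<open>dg\<close>. The factors \<open>Suc j - i\<close> fall with \<open>i\<close>, so this
  replacement lowers \<open>ms\<close> even if \<open>\<alpha> i = 1\<close>.\<close>

definition ms :: "nat \<Rightarrow> (nat \<Rightarrow> nat) \<Rightarrow> nat" where
  "ms j a = (\<Sum>i=1..j. a i * (Suc j - i))"

lemma reduction_step:
  assumes j: "j \<le> l" and i: "1 \<le> i" "i < j" "\<alpha> i \<le> a i"
  obtains a1 a2 where
    "laurent_monom c k * mon j a =
      laurent_monom c k * mon j a1 + laurent_monom (c * \<theta> i) (k + \<kappa> i) * mon j a2"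
    "wt j a1 < wt j a" "of_int (\<kappa> i) + wt j a2 = wt j a"
    "(a1, a) \<in> measures [dg j, ms j]" "(a2, a) \<in> measures [dg j, ms j]"
    "\<And>r. r > i \<Longrightarrow> a2 r = a r"
proof -
  \<comment> \<open>\<open>d0\<close> is the factor \<open>f i ^ \<alpha> i\<close> split off from
    \<open>a\<close>; the vectors \<open>d1\<close> and \<open>d2\<close> stand for the two
    monomials that replace it.\<close>
  define a' where "a' r = (if r = i then a i - \<alpha> i else a r)" for r
  define d1 where "d1 r = (if r = Suc i then 1 else 0 :: nat)" for r
  define d2 where "d2 r = (if r < i then \<beta> i r else 0)" for r
  define d0 where "d0 r = (if r = i then \<alpha> i else 0)" for r
  have a: "a = (\<lambda>r. a' r + d0 r)" using i by (auto simp: a'_def d0_def)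
  have il: "i < l" using i j by simp
  note st = step[OF i(1) il] and wi = weight[OF i(1) il] and wl = w_less[OF i(1) il]
  have m0: "mon j d0 = f i ^ \<alpha> i" "wt j d0 = of_nat (\<alpha> i) * w i"
    unfolding d0_def using i mon_delta wt_delta by auto
  have m1: "mon j d1 = f (Suc i)" "wt j d1 = w (Suc i)"
    unfolding d1_def using i mon_delta[of "Suc i" j 1] wt_delta[of "Suc i" j 1] by auto
  have m2: "mon j d2 = (\<Prod>r=1..<i. f r ^ \<beta> i r)" "wt j d2 = (\<Sum>r=1..<i. of_nat (\<beta> i r) * w r)"
    unfolding d2_def using i mon_restrict wt_restrict by auto
  have lin: "(\<Sum>r=1..j. (if r = s then n else 0) * c r) = n * c s" if "1 \<le> s" "s \<le> j"
    for n s and c :: "nat \<Rightarrow> nat"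
  proof -
    have "(\<Sum>r=1..j. (if r = s then n else 0) * c r) = (\<Sum>r=1..j. if r = s then n * c r else 0)"
      by (intro sum.cong) auto
    then show ?thesis using that by (simp add: sum.delta)
  qed
  have dg_add: "dg j (\<lambda>r. x r + y r) = dg j x + dg j y" for x y
    by (simp add: dg_def ring_distribs sum.distrib)
  have ms_add: "ms j (\<lambda>r. x r + y r) = ms j x + ms j y" for x y
    by (simp add: ms_def ring_distribs sum.distrib)
  have dga: "dg j a = dg j a' + dg j d0" and msa: "ms j a = ms j a' + ms j d0"
    by (subst a, rule dg_add) (subst a, rule ms_add)
  have dgd: "dg j d0 = D (Suc i)" "dg j d1 = D (Suc i)"
    unfolding dg_def d0_def d1_def using i lin by (auto simp: D_Suc mult.commute)
  \<comment> \<open>The second monomial consists of reduced digits below place \<open>i\<close>, so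
    already \<open>dg\<close> drops.\<close>
  have "dg j d2 = (\<Sum>r=1..<i. \<beta> i r * D r)"
    unfolding dg_def d2_def by (rule sum.mono_neutral_cong_right) (use i in auto)
  also have "\<dots> < D i" using sum_digits_less[of i "\<beta> i"] \<beta>_less il i by auto
  also have "D i \<le> D (Suc i)" using \<alpha>_pos[OF i(1) il] i by (simp add: D_Suc)
  finally have dg2: "dg j d2 < dg j d0" by (simp add: dgd)
  \<comment> \<open>The first monomial leaves \<open>dg\<close> unchanged; here the second measure
    decides.\<close>
  have ms0: "ms j d0 = \<alpha> i * (Suc j - i)" and "ms j d1 = Suc j - Suc i"
    unfolding ms_def d0_def d1_def using i lin by auto
  then have "ms j d1 < 1 * (Suc j - i)" using i by simp
  also have "\<dots> \<le> \<alpha> i * (Suc j - i)"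
    using \<alpha>_pos[OF i(1) il] by (intro mult_right_mono) auto
  finally have ms1: "ms j d1 < ms j d0" by (simp only: ms0)
  show ?thesis
  proof (rule that)
    have "mon j d0 = mon j d1 + laurent_monom (\<theta> i) (\<kappa> i) * mon j d2"
      by (simp add: m0 m1 m2 st)
    then show "laurent_monom c k * mon j a = laurent_monom c k * mon j (\<lambda>r. a' r + d1 r)
        + laurent_monom (c * \<theta> i) (k + \<kappa> i) * mon j (\<lambda>r. a' r + d2 r)"
      by (subst a) (simp add: mon_add algebra_simps flip: laurent_monom_mult)
    show "wt j (\<lambda>r. a' r + d1 r) < wt j a"
      by (subst a) (simp add: wt_add m0 m1 wl)
    show "of_int (\<kappa> i) + wt j (\<lambda>r. a' r + d2 r) = wt j a"
      by (subst a) (simp add: wt_add m0 m2 wi)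
    show "((\<lambda>r. a' r + d1 r), a) \<in> measures [dg j, ms j]"
      using ms1 by (simp add: dga msa dg_add ms_add dgd)
    show "((\<lambda>r. a' r + d2 r), a) \<in> measures [dg j, ms j]"
      using dg2 by (simp add: dga msa dg_add ms_add)
    show "a' r + d2 r = a r" if "r > i" for r using that by (simp add: a'_def d2_def)
  qed
qed

text \<open>Rewriting terminates by the lexicographic measure and never raises the weight. A
  monomial whose exponents below index \<open>j\<close> are all reduced is already in normal
  form.\<close>

lemma mon_in_normal:
  assumes j: "1 \<le> j" "j \<le> l"
  shows "of_int k + wt j a \<le> e \<Longrightarrow> laurent_monom c k * mon j a \<in> normal j e"
proof (induction a arbitrary: c k e rule: wf_induct[OF wf_measures[of "[dg j, ms j]"]])
  case (1 a)
  obtain j' where j': "j = Suc j'" using j by (cases j) auto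
  show ?case
  proof (cases "\<exists>i. 1 \<le> i \<and> i < j \<and> \<alpha> i \<le> a i")
    case True
    then obtain i where i: "1 \<le> i" "i < j" "\<alpha> i \<le> a i" by blast
    obtain a1 a2 where s: "laurent_monom c k * mon j a =
      laurent_monom c k * mon j a1 + laurent_monom (c * \<theta> i) (k + \<kappa> i) * mon j a2"
      "wt j a1 < wt j a" "of_int (\<kappa> i) + wt j a2 = wt j a"
      "(a1, a) \<in> measures [dg j, ms j]" "(a2, a) \<in> measures [dg j, ms j]"
      using reduction_step[where a = a and i = i and j = j] j(2) i by metis
    have "of_int k + wt j a1 \<le> e" "of_int (k + \<kappa> i) + wt j a2 \<le> e" using s(2,3) 1(2) by auto
    with 1(1) s(4,5) show ?thesis unfolding s(1) by (intro normal_add) blast+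
  next
    case False
    then have "a i < \<alpha> i" if "1 \<le> i" "i \<le> j'" for i using that j' by (meson not_le le_imp_less_Suc)
    then have "laurent_monom c k * mon j' a \<in> basic j' (e - of_nat (a j) * w j)"
      using 1(2) j' by (intro mon_in_basic) (auto simp: wt_Suc)
    then have "laurent_monom c k * mon j' a * f j ^ a j \<in> normal j (e - of_nat (a j) * w j + of_nat (a j) * w j)"
      using j' by (intro basic_in_normal) simp
    then show ?thesis by (simp add: j' mon_Suc mult.assoc)
  qed
qed

lemma fil_normal: "x \<in> fil j e \<Longrightarrow> 1 \<le> j \<Longrightarrow> j \<le> l \<Longrightarrow> x \<in> normal j e"
  by (induction rule: fil.induct) (auto simp: zero_in_normal intro!: normal_add mon_in_normal)

section \<open>The multiplicative filtration by weight\<close>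

lemma fil_add: "y \<in> fil j e \<Longrightarrow> x \<in> fil j e \<Longrightarrow> x + y \<in> fil j e"
  by (induction rule: fil.induct) (auto simp: add.assoc[symmetric] intro: fil.add)

lemma fil_mon: "of_int k + wt j a \<le> e \<Longrightarrow> laurent_monom c k * mon j a \<in> fil j e"
  using fil.add[OF fil.zero] by simp

lemma fil_mono: "x \<in> fil j e \<Longrightarrow> e \<le> e' \<Longrightarrow> x \<in> fil j e'"
  by (induction rule: fil.induct) (auto intro: fil.intros)

lemma fil_sum: "(\<And>i. i \<in> I \<Longrightarrow> x i \<in> fil j e) \<Longrightarrow> sum x I \<in> fil j e"
  by (induction I rule: infinite_finite_induct) (auto simp: fil.zero fil_add)

lemma fil_mult_mon:
  "x \<in> fil j e \<Longrightarrow> of_int k + wt j a \<le> e' \<Longrightarrow> x * (laurent_monom c k * mon j a) \<in> fil j (e + e')"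
proof (induction rule: fil.induct)
  case (add x m b d)
  have "laurent_monom d m * mon j b * (laurent_monom c k * mon j a)
      = laurent_monom (d * c) (m + k) * mon j (\<lambda>i. b i + a i)"
    by (simp add: mon_add algebra_simps flip: laurent_monom_mult)
  moreover have "of_int (m + k) + wt j (\<lambda>i. b i + a i) \<le> e + e'" using add by (simp add: wt_add)
  ultimately show ?case using fil.add[of "x * (laurent_monom c k * mon j a)" j "e + e'"] add
    by (simp add: ring_distribs)
qed (simp add: fil.zero)

lemma fil_mult: "y \<in> fil j e' \<Longrightarrow> x \<in> fil j e \<Longrightarrow> x * y \<in> fil j (e + e')"
  by (induction rule: fil.induct) (auto simp: ring_distribs fil.zero intro!: fil_add fil_mult_mon)

lemma fil_one: "1 \<in> fil j 0"
  using fil_mon[of 0 j "\<lambda>_. 0" 0 1] by (simp add: mon_def wt_def laurent_monom_one)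

lemma fil_power: "x \<in> fil j e \<Longrightarrow> x ^ n \<in> fil j (of_nat n * e)"
proof (induction n)
  case (Suc n)
  then show ?case using fil_mult[of "x ^ n" j "of_nat n * e" x e] by (simp add: algebra_simps)
qed (simp add: fil_one)

lemma fil_f: "1 \<le> i \<Longrightarrow> i \<le> j \<Longrightarrow> f i \<in> fil j (w i)"
  using fil_mon[of 0 j "\<lambda>r. if r = i then 1 else 0" "w i" 1] mon_delta[of i j 1] wt_delta[of i j 1]
  by (simp add: laurent_monom_one)

lemma fil_Suc: "x \<in> fil j e \<Longrightarrow> x \<in> fil (Suc j) e"
proof (induction rule: fil.induct)
  case (add x k a c)
  let ?a = "\<lambda>i. if i < Suc j then a i else 0"
  have "mon (Suc j) ?a = mon j a" "wt (Suc j) ?a = wt j a"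
    by (auto simp: mon_Suc wt_Suc intro!: mon_cong wt_cong)
  then show ?case using add fil.add[of x "Suc j" e k ?a c] by simp
qed (simp add: fil.zero)

lemma fil_laurent: "\<forall>k\<in>Poly_Mapping.keys a. of_int k \<le> e \<Longrightarrow> [:a:] \<in> fil j e"
proof -
  assume "\<forall>k\<in>Poly_Mapping.keys a. of_int k \<le> e"
  then have "laurent_monom c k * mon j (\<lambda>_. 0) \<in> fil j e" if "k \<in> Poly_Mapping.keys a" for k c
    using that by (intro fil_mon) (simp add: wt_def)
  then show ?thesis unfolding laurent_expand[of a] by (intro fil_sum) (simp add: mon_def)
qed

lemma basic_fil: "x \<in> basic j e \<Longrightarrow> x \<in> fil j e"
proof (induction j arbitrary: x e)
  case 0
  then show ?case using fil_laurent by auto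
next
  case (Suc j)
  then obtain b where b: "x = (\<Sum>n<\<alpha> (Suc j). b n * f (Suc j) ^ n)"
    "\<forall>n. b n \<in> basic j (e - of_nat n * w (Suc j))" by auto
  have "b n * f (Suc j) ^ n \<in> fil (Suc j) (e - of_nat n * w (Suc j) + of_nat n * w (Suc j))" for n
    using Suc.IH b(2) by (intro fil_mult fil_power fil_f fil_Suc) auto
  then show ?case unfolding b(1) by (intro fil_sum) auto
qed

text \<open>In a reduction step the summand with \<open>f (Suc i)\<close> has strictly lower weight
  and goes into \<open>y\<close>. Only the other summand is reduced further; it keeps all exponents
  above \<open>i\<close>, so \<open>f j\<close> never enters.\<close>

lemma mon_basic_modulo_lower:
  assumes j: "1 \<le> j" "j \<le> l"
  shows "a j = 0 \<Longrightarrow> \<exists>x y e'. laurent_monom c k * mon j a = x + y \<and>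
    x \<in> basic (j - 1) (of_int k + wt j a) \<and> y \<in> fil j e' \<and> e' < of_int k + wt j a"
proof (induction a arbitrary: c k rule: wf_induct[OF wf_measures[of "[dg j, ms j]"]])
  case (1 a)
  obtain j' where j': "j = Suc j'" using j by (cases j) auto
  show ?case
  proof (cases "\<exists>i. 1 \<le> i \<and> i < j \<and> \<alpha> i \<le> a i")
    case True
    then obtain i where i: "1 \<le> i" "i < j" "\<alpha> i \<le> a i" by blast
    obtain a1 a2 where s: "laurent_monom c k * mon j a =
      laurent_monom c k * mon j a1 + laurent_monom (c * \<theta> i) (k + \<kappa> i) * mon j a2"
      "wt j a1 < wt j a" "of_int (\<kappa> i) + wt j a2 = wt j a"
      "(a2, a) \<in> measures [dg j, ms j]" "\<And>r. r > i \<Longrightarrow> a2 r = a r"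
      using reduction_step[where a = a and i = i and j = j] j(2) i by metis
    have "a2 j = 0" using s(5) i(2) 1(2) by simp
    with 1(1) s(4) obtain x y e' where xy:
      "laurent_monom (c * \<theta> i) (k + \<kappa> i) * mon j a2 = x + y"
      "x \<in> basic (j - 1) (of_int (k + \<kappa> i) + wt j a2)" "y \<in> fil j e'" "e' < of_int (k + \<kappa> i) + wt j a2"
      by blast
    let ?e = "max e' (of_int k + wt j a1)"
    have "laurent_monom c k * mon j a1 + y \<in> fil j ?e"
      by (intro fil_add fil_mon fil_mono[OF xy(3)]) auto
    moreover have "?e < of_int k + wt j a" using xy(4) s(2,3) by auto
    moreover have "of_int (k + \<kappa> i) + wt j a2 = of_int k + wt j a" using s(3) by simp
    ultimately show ?thesis using xy(1,2) s(1)
      by (intro exI[of _ x] exI[of _ "laurent_monom c k * mon j a1 + y"] exI[of _ ?e])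
        (simp add: algebra_simps)
  next
    case False
    then have "a i < \<alpha> i" if "1 \<le> i" "i \<le> j'" for i using that j' by (meson not_le le_imp_less_Suc)
    then have "laurent_monom c k * mon j' a \<in> basic j' (of_int k + wt j' a)"
      by (intro mon_in_basic) auto
    \<comment> \<open>The monomial is its own reduced form. The lower part is 0, so any bound below
      the weight will do.\<close>
    then show ?thesis using 1(2) j'
      by (intro exI[of _ "laurent_monom c k * mon j' a"] exI[of _ 0] exI[of _ "of_int k + wt j a - 1"])
        (auto simp: mon_Suc wt_Suc fil.zero)
  qed
qed

text \<open>The monomial has larger weight than everything in \<open>x\<close>, so \<open>x\<close>
  cannot cancel it. Passing to the digit of index \<open>a (Suc j)\<close> keeps both the
  polynomiality and the gap in weight; at level 0 the term \<open>c u^k\<close> itself remains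
  visible.\<close>

lemma exponent_nonneg:
  assumes "j < l" "\<And>i. 1 \<le> i \<Longrightarrow> i \<le> j \<Longrightarrow> is_polynomial (f i)"
    and "x \<in> basic j e" "\<And>i. 1 \<le> i \<Longrightarrow> i \<le> j \<Longrightarrow> a i < \<alpha> i"
    and "e < of_int k + wt j a" "c \<noteq> 0" "is_polynomial (x + laurent_monom c k * mon j a)"
  shows "k \<ge> 0"
  using assms
proof (induction j arbitrary: e x)
  case 0
  then obtain b where b: "x = [:b:]" "\<forall>m\<in>Poly_Mapping.keys b. of_int m \<le> e" by auto
  then have "k \<notin> Poly_Mapping.keys b" using 0(5) by force
  then have "Poly_Mapping.lookup (coeff (x + laurent_monom c k * mon 0 a) 0) k = c"
    by (simp add: b(1) laurent_monom_def lookup_add in_keys_iff)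
  then have "k \<in> Poly_Mapping.keys (coeff (x + laurent_monom c k * mon 0 a) 0)"
    using 0(6) by (simp add: in_keys_iff)
  then show ?case using 0(7) unfolding is_polynomial_def by blast
next
  case (Suc j)
  let ?g = "f (Suc j)" and ?m = "laurent_monom c k * mon j a" and ?n = "a (Suc j)"
  from Suc.prems obtain b where b: "x = (\<Sum>n<\<alpha> (Suc j). b n * ?g ^ n)"
    "\<forall>n. b n \<in> basic j (e - of_nat n * w (Suc j))" by auto
  \<comment> \<open>The monomial is absorbed into the digit at its own exponent of
    \<open>f (Suc j)\<close>.\<close>
  let ?b = "\<lambda>n. b n + (if n = ?n then ?m else 0)"
  have n: "?n < \<alpha> (Suc j)" using Suc.prems by simp
  have "(\<Sum>n<\<alpha> (Suc j). (if n = ?n then ?m else 0) * ?g ^ n) = ?m * ?g ^ ?n"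
    by (subst sum.mono_neutral_right[of _ "{?n}"]) (use n in auto)
  then have sum: "x + laurent_monom c k * mon (Suc j) a = (\<Sum>n<\<alpha> (Suc j). ?b n * ?g ^ n)"
    by (simp add: b(1) mon_Suc ring_distribs sum.distrib mult.assoc)
  have g: "lead_coeff ?g = 1" "degree ?g > 0"
    using key_monic[of "Suc j"] D_pos[of "Suc j"] Suc.prems(1) by (metis le_add1 less_imp_le plus_1_eq_Suc)+
  have m: "?m \<in> basic j (of_int k + wt j a)" using Suc.prems by (intro mon_in_basic) auto
  have "?b n = 0 \<or> degree (?b n) < degree ?g" for n
  proof -
    \<comment> \<open>Any common bound serves here: membership in \<open>basic\<close> is used only
      for the degree.\<close>
    let ?E = "max (e - of_nat n * w (Suc j)) (of_int k + wt j a)"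
    have "(if n = ?n then ?m else 0) \<in> basic j ?E"
      using basic_mono[OF m] zero_in_basic by auto
    moreover have "b n \<in> basic j ?E" by (rule basic_mono[OF b(2)[rule_format, of n]]) simp
    ultimately have "?b n \<in> basic j ?E" by (rule basic_add[rotated])
    then show ?thesis using basic_degree'[of "Suc j" "?b n" ?E] Suc.prems(1) by simp
  qed
  note small = this
  have "is_polynomial ?g" using Suc.prems(2)[of "Suc j"] by simp
  from adic_is_polynomial[where b = ?b, OF g this small _ n] sum Suc.prems(7)
  have "is_polynomial (?b ?n)" by simp
  then have "is_polynomial (b ?n + ?m)" by simp
  moreover have "e - of_nat ?n * w (Suc j) < of_int k + wt j a" using Suc.prems by (simp add: wt_Suc)
  ultimately show ?case using Suc.IH[of "b ?n"] b(2) Suc.prems by fastforce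
qed

text \<open>\<open>\<beta> j\<close> is constrained only below \<open>j\<close>. Cutting it off
  there gives an exponent vector for \<open>mon j\<close> that does not involve
  \<open>f j\<close>.\<close>

abbreviation \<beta>' :: "nat \<Rightarrow> nat \<Rightarrow> nat" where
  "\<beta>' j \<equiv> \<lambda>r. if r < j then \<beta> j r else 0"

lemma step':
  assumes "1 \<le> j" "j < l"
  shows "f (Suc j) = laurent_monom (- \<theta> j) (\<kappa> j) * mon j (\<beta>' j) + f j ^ \<alpha> j"
    and "of_int (\<kappa> j) + wt j (\<beta>' j) = of_nat (\<alpha> j) * w j"
  using step[OF assms] weight[OF assms] mon_restrict[of j j "\<beta> j"] wt_restrict[of j j "\<beta> j"]
  by (auto simp: laurent_monom_uminus)

lemma key_fil: "1 \<le> j \<Longrightarrow> j < l \<Longrightarrow> f (Suc j) \<in> fil j (of_nat (\<alpha> j) * w j)"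
  using step'[of j] by (auto intro!: fil_add fil_power fil_f fil_mon)

text \<open>The degree forces the top digit to have index \<open>N\<close> and to be free of
  \<open>v\<close>. In terms of level \<open>j\<close>, each \<open>f (Suc j)\<close> has weight at
  most \<open>\<alpha> j * w j\<close>, and the weight left for the digits only grows when
  \<open>w (Suc j)\<close> is replaced by this number.\<close>

lemma fil_descend:
  assumes j: "1 \<le> j" "j < l" and p: "p \<in> fil (Suc j) (of_nat N * w (Suc j))" "degree p = N * D (Suc j)" "p \<noteq> 0"
  shows "p \<in> fil j (of_nat (N * \<alpha> j) * w j)"
    and "lead_coeff p = 1 \<Longrightarrow> \<exists>b. p = (\<Sum>n<N. b n * f (Suc j) ^ n) + f (Suc j) ^ N \<and>
      (\<forall>n. b n \<in> basic j ((of_nat N - of_nat n) * w (Suc j)))"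
proof -
  let ?g = "f (Suc j)"
  have g: "lead_coeff ?g = 1 \<and> degree ?g = D (Suc j)" using j by (intro key_monic) auto
  have D: "D (Suc j) > 0" using j by (intro D_pos) auto
  have "p \<in> normal (Suc j) (of_nat N * w (Suc j))" using j p by (intro fil_normal) auto
  then obtain M b where b: "p = (\<Sum>n<M. b n * ?g ^ n)"
    "\<forall>n. b n \<in> basic j (of_nat N * w (Suc j) - of_nat n * w (Suc j))"
    unfolding normal_def by auto
  have b': "b n \<in> basic j ((of_nat N - of_nat n) * w (Suc j))" for n
    using b(2) by (simp add: algebra_simps)
  have small: "b n = 0 \<or> degree (b n) < degree ?g" for n
    using basic_degree[of j "b n"] b' g j by auto
  obtain n where n: "b n \<noteq> 0" "degree p = degree (b n) + n * D (Suc j)" "lead_coeff p = lead_coeff (b n)"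
    "p = (\<Sum>n<Suc n. b n * ?g ^ n)"
    using adic_top[OF _ _ small b(1) p(3)] g D by auto
  have "degree (b n) < D (Suc j)" using small[of n] n(1) g by auto
  \<comment> \<open>Uniqueness of division with remainder by \<open>D (Suc j)\<close>.\<close>
  with n(2) p(2) have "degree (b n) = 0 \<and> n = N"
    using D by (metis add.commute add_cancel_right_left div_mult_self1_is_m div_mult_self3 div_less mult.commute not_gr_zero)
  then have nN: "n = N" "degree (b N) = 0" by auto
  have w: "w (Suc j) < of_nat (\<alpha> j) * w j" using w_less j by simp
  note gf = key_fil[OF j]
  have "b i * ?g ^ i \<in> fil j (of_nat (N * \<alpha> j) * w j)" if "i \<le> N" for i
  proof -
    have "(of_nat N - of_nat i) * w (Suc j) \<le> (of_nat N - of_nat i) * (of_nat (\<alpha> j) * w j)"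
      using that w by (intro mult_left_mono) auto
    then have "b i * ?g ^ i \<in> fil j ((of_nat N - of_nat i) * (of_nat (\<alpha> j) * w j) + of_nat i * (of_nat (\<alpha> j) * w j))"
      by (intro fil_mult fil_power gf fil_mono[OF basic_fil[OF b']])
    then show ?thesis by (simp add: algebra_simps)
  qed
  then show "p \<in> fil j (of_nat (N * \<alpha> j) * w j)"
    unfolding n(4) nN by (intro fil_sum) auto
  assume "lead_coeff p = 1"
  then have "lead_coeff (b N) = 1" using n(3) nN by simp
  then have "b N = 1" using nN(2) by (metis degree_eq_zeroE lead_coeff_pCons(2) one_pCons pCons_0_0)
  then have "p = (\<Sum>n<N. b n * ?g ^ n) + ?g ^ N" using n(4) nN by simp
  with b' show "\<exists>b. p = (\<Sum>n<N. b n * f (Suc j) ^ n) + f (Suc j) ^ N \<and>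
      (\<forall>n. b n \<in> basic j ((of_nat N - of_nat n) * w (Suc j)))" by blast
qed

lemma mon_power: "mon j (\<lambda>i. n * a i) = mon j a ^ n"
  by (simp add: mon_def power_mult[symmetric] prod_power_distrib mult.commute)

lemma wt_mult: "wt j (\<lambda>i. n * a i) = of_nat n * wt j a"
  by (simp add: wt_def sum_distrib_left mult.assoc)

text \<open>
  Modulo terms of lower weight \<open>p\<close> is \<open>f\<^sub>j\<^sub>+\<^sub>1\<^sup>N = (m + f\<^sub>j\<^bsup>\<alpha>\<^esup>)\<^sup>N\<close>, and modulo lower weight the powers of
  \<open>m\<close> reduce to forms without \<open>f\<^sub>j\<close>. Hence \<open>N m\<close> survives in the coefficient of \<open>f\<^sub>j\<^bsup>\<alpha>(N-1)\<^esup>\<close>.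
\<close>

lemma key_step_is_polynomial:
  assumes j: "1 \<le> j" "j < l"
    and polys: "\<And>i. 1 \<le> i \<Longrightarrow> i \<le> j \<Longrightarrow> is_polynomial (f i)"
    and p: "p \<in> fil (Suc j) (of_nat N * w (Suc j))" "degree p = N * D (Suc j)" "lead_coeff p = 1"
      "is_polynomial p"
    and N: "N \<ge> 1"
  shows "is_polynomial (f (Suc j))"
proof -
  let ?g = "f (Suc j)" and ?F = "f j" and ?A = "\<alpha> j"
  \<comment> \<open>The common weight of the two summands of \<open>f (Suc j)\<close>; it exceeds
    \<open>w (Suc j)\<close>.\<close>
  define W where "W = of_nat (\<alpha> j) * w j"
  let ?m = "\<lambda>c. laurent_monom c (\<kappa> j) * mon j (\<beta>' j)"
  have wless: "w (Suc j) < W" using w_less[OF j] by (simp add: W_def)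
  have wtW: "of_int (\<kappa> j) + wt j (\<beta>' j) = W" using step'(2)[OF j] by (simp add: W_def)
  have wtW': "of_int (\<kappa> j) + wt (j - 1) (\<beta>' j) = W" and mon': "mon (j - 1) (\<beta>' j) = mon j (\<beta>' j)"
    using wtW j wt_Suc[of "j - 1" "\<beta>' j"] mon_Suc[of "j - 1" "\<beta>' j"] by auto
  have \<beta>': "\<beta>' j i < \<alpha> i" if "1 \<le> i" "i \<le> j - 1" for i using that \<beta>_less[of i j] j by auto
  have mbasic: "?m c \<in> basic (j - 1) W" for c
    using mon_in_basic[where j = "j - 1" and a = "\<beta>' j" and c = c and k = "\<kappa> j", OF \<beta>'] wtW' mon' by simp
  have p0: "p \<noteq> 0" using p(3) by auto
  obtain b where b: "p = (\<Sum>n<N. b n * ?g ^ n) + ?g ^ N"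
    "\<And>n. b n \<in> basic j ((of_nat N - of_nat n) * w (Suc j))"
    using fil_descend(2)[OF j p(1,2) p0 p(3)] by blast
  \<comment> \<open>The term with index \<open>n < N\<close> falls short of the weight
    \<open>N W\<close> by \<open>N - n\<close> times the gap \<open>W - w (Suc j)\<close>, hence by
    at least one such gap.\<close>
  define E0 where "E0 = of_nat N * W - (W - w (Suc j))"
  have y1: "(\<Sum>n<N. b n * ?g ^ n) \<in> fil j E0"
  proof (rule fil_sum)
    fix n assume "n \<in> {..<N}"
    then have "Suc n \<le> N" by simp
    then have "1 \<le> (of_nat N - of_nat n :: rat)" by (metis le_diff_eq of_nat_Suc of_nat_mono add.commute add.left_commute)
    then have "1 * (W - w (Suc j)) \<le> (of_nat N - of_nat n) * (W - w (Suc j))"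
      using wless by (intro mult_right_mono) auto
    then have "(of_nat N - of_nat n) * w (Suc j) + of_nat n * W \<le> E0"
      by (simp add: E0_def algebra_simps)
    then show "b n * ?g ^ n \<in> fil j E0"
      using fil_mono[OF fil_mult[OF fil_power[OF key_fil[OF j]] basic_fil[OF b(2)], of n n]]
      by (simp add: W_def)
  qed
  \<comment> \<open>The binomial terms of \<open>f (Suc j) ^ N\<close> without their powers of
    \<open>f j\<close>. For \<open>r = 1\<close> the monomial is already reduced and is kept
    exactly; the others are known only up to lower weight.\<close>
  have "\<exists>x y e. of_nat (N choose r) * ?m (- \<theta> j) ^ r = x + y \<and> x \<in> basic (j - 1) (of_nat r * W)
      \<and> y \<in> fil j e \<and> e < of_nat r * W \<and> (r = 1 \<longrightarrow> x = ?m (- of_nat N * \<theta> j))" for r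
  proof (cases "r = 1")
    case True
    have "of_nat (N choose r) * ?m (- \<theta> j) ^ r = ?m (- of_nat N * \<theta> j)"
      by (simp add: True of_nat_laurent_monom laurent_monom_mult flip: mult.assoc)
    then show ?thesis using mbasic True
      by (intro exI[of _ "?m (- of_nat N * \<theta> j)"] exI[of _ 0] exI[of _ "W - 1"]) (auto simp: fil.zero)
  next
    case False
    let ?c = "of_nat (N choose r) * (- \<theta> j) ^ r" and ?k = "of_nat r * \<kappa> j" and ?a = "\<lambda>i. r * \<beta>' j i"
    have eq: "of_nat (N choose r) * ?m (- \<theta> j) ^ r = laurent_monom ?c ?k * mon j ?a"
      unfolding mon_power power_mult_distrib laurent_monom_power
      by (simp add: of_nat_laurent_monom laurent_monom_mult flip: mult.assoc)
    have wt: "of_int ?k + wt j ?a = of_nat r * W"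
      unfolding wt_mult wtW[symmetric] by (simp add: algebra_simps)
    have "\<exists>x y e'. laurent_monom ?c ?k * mon j ?a = x + y \<and>
        x \<in> basic (j - 1) (of_int ?k + wt j ?a) \<and> y \<in> fil j e' \<and> e' < of_int ?k + wt j ?a"
      by (rule mon_basic_modulo_lower) (use j in auto)
    then show ?thesis unfolding eq wt using False by blast
  qed
  then obtain x y e where xy: "\<And>r. of_nat (N choose r) * ?m (- \<theta> j) ^ r = x r + y r"
    "\<And>r. x r \<in> basic (j - 1) (of_nat r * W)" "\<And>r. y r \<in> fil j (e r)" "\<And>r. e r < of_nat r * W"
    "x 1 = ?m (- of_nat N * \<theta> j)"
    by metis
  have gN: "?g ^ N = (\<Sum>r\<le>N. x r * ?F ^ (?A * (N - r))) + (\<Sum>r\<le>N. y r * ?F ^ (?A * (N - r)))"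
    unfolding step'(1)[OF j] binomial_ring xy(1) by (simp add: ring_distribs sum.distrib power_mult)
  define e' where "e' r = e r + of_nat (N - r) * W" for r
  \<comment> \<open>One bound below \<open>N W\<close> for all the terms of lower weight.\<close>
  define E where "E = Max (insert E0 (e' ` {..N}))"
  have "e' r < of_nat N * W" if "r \<le> N" for r
    using xy(4)[of r] that by (simp add: e'_def of_nat_diff algebra_simps)
  then have E: "E < of_nat N * W" using wless by (auto simp: E_def E0_def)
  define Y where "Y = (\<Sum>n<N. b n * ?g ^ n) + (\<Sum>r\<le>N. y r * ?F ^ (?A * (N - r)))"
  have "Y \<in> fil j E"
    unfolding Y_def
  proof (rule fil_add[rotated], goal_cases)
    case 1
    show ?case using fil_mono[OF y1] by (simp add: E_def)
  next
    case 2
    show ?case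
    proof (rule fil_sum)
    fix r assume r: "r \<in> {..N}"
    have "?F ^ (?A * (N - r)) \<in> fil j (of_nat (?A * (N - r)) * w j)"
      using j by (intro fil_power fil_f) auto
    moreover have "e r + of_nat (?A * (N - r)) * w j = e' r"
      by (simp add: e'_def W_def mult.commute mult.left_commute)
    ultimately have "y r * ?F ^ (?A * (N - r)) \<in> fil j (e' r)"
      using fil_mult[OF _ xy(3)[of r]] by metis
    then show "y r * ?F ^ (?A * (N - r)) \<in> fil j E" by (rule fil_mono) (unfold E_def, rule Max_ge, use r in auto)
    qed
  qed
  then have "Y \<in> normal j E" using j by (intro fil_normal) auto
  then obtain M z where z: "Y = (\<Sum>n<M. z n * ?F ^ n)" "\<And>n. z n \<in> basic (j - 1) (E - of_nat n * w j)"
    unfolding normal_def by auto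
  \<comment> \<open>Large enough for the expansion of \<open>Y\<close> and for every exponent
    \<open>\<alpha> j * (N - r)\<close> of \<open>f j\<close>.\<close>
  define K where "K = max M (Suc (?A * N))"
  define z' where "z' n = (if n < M then z n else 0)" for n
  \<comment> \<open>The digits of \<open>p\<close> with respect to \<open>f j\<close>: lower terms
    plus the reduced binomial terms.\<close>
  define B where "B n = z' n + (\<Sum>r\<le>N. if n = ?A * (N - r) then x r else 0)" for n
  have z': "z' n \<in> basic (j - 1) (E - of_nat n * w j)" for n
    using z(2) zero_in_basic by (simp add: z'_def)
  have Y: "Y = (\<Sum>n<K. z' n * ?F ^ n)"
    unfolding z(1) by (rule sum.mono_neutral_cong_left) (auto simp: K_def z'_def)
  have "x r * ?F ^ (?A * (N - r)) = (\<Sum>n<K. (if n = ?A * (N - r) then x r else 0) * ?F ^ n)" for r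
  proof -
    have "?A * (N - r) \<le> ?A * N" by simp
    then have "?A * (N - r) < K" unfolding K_def by linarith
    then show ?thesis by (subst sum.mono_neutral_right[of _ "{?A * (N - r)}"]) auto
  qed
  then have "(\<Sum>r\<le>N. x r * ?F ^ (?A * (N - r))) =
      (\<Sum>r\<le>N. \<Sum>n<K. (if n = ?A * (N - r) then x r else 0) * ?F ^ n)" by simp
  also have "\<dots> = (\<Sum>n<K. (\<Sum>r\<le>N. if n = ?A * (N - r) then x r else 0) * ?F ^ n)"
    by (subst sum.swap) (simp add: sum_distrib_right)
  finally have pB: "p = (\<Sum>n<K. B n * ?F ^ n)"
    using b(1) gN Y by (simp add: Y_def B_def ring_distribs sum.distrib)
  have F: "lead_coeff ?F = 1" "degree ?F > 0"
    using key_monic[of j] D_pos[of j] j by (metis less_imp_le)+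
  have small: "B n = 0 \<or> degree (B n) < degree ?F" for n
  proof -
    \<comment> \<open>Again just a common bound, so that the degree estimate for
      \<open>basic\<close> applies to the digit.\<close>
    define G where "G = Max (insert (E - of_nat n * w j) ((\<lambda>r. of_nat r * W) ` {..N}))"
    have "B n \<in> basic (j - 1) G" unfolding B_def
    proof (rule basic_add)
      show "z' n \<in> basic (j - 1) G" by (rule basic_mono[OF z']) (simp add: G_def)
      show "(\<Sum>r\<le>N. if n = ?A * (N - r) then x r else 0) \<in> basic (j - 1) G"
      proof (rule basic_sum)
        fix r assume "r \<in> {..N}"
        then have "x r \<in> basic (j - 1) G" by (intro basic_mono[OF xy(2)], unfold G_def, intro Max_ge) auto
        then show "(if n = ?A * (N - r) then x r else 0) \<in> basic (j - 1) G" by (simp add: zero_in_basic)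
      qed
    qed
    then show ?thesis using basic_degree' j by simp
  qed
  \<comment> \<open>At this exponent only \<open>r = 1\<close> contributes, that is,
    \<open>N\<close> times the monomial in question.\<close>
  let ?n = "?A * (N - 1)"
  have "?n \<le> ?A * N" by simp
  then have "?n < K" unfolding K_def by linarith
  with adic_is_polynomial[where b = B, OF F polys[of j] small] pB p(4) j
  have poly: "is_polynomial (B ?n)" by auto
  have "?n = ?A * (N - r) \<longleftrightarrow> r = 1" if "r \<in> {..N}" for r using that \<alpha>_pos[OF j] N by auto
  then have "(\<Sum>r\<le>N. if ?n = ?A * (N - r) then x r else 0) = (\<Sum>r\<le>N. if r = 1 then x r else 0)"
    by (intro sum.cong) auto
  also have "\<dots> = x 1" using N by (simp add: sum.delta)
  finally have "(\<Sum>r\<le>N. if ?n = ?A * (N - r) then x r else 0) = x 1" .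
  then have Bn: "B ?n = z' ?n + laurent_monom (- of_nat N * \<theta> j) (\<kappa> j) * mon (j - 1) (\<beta>' j)"
    unfolding B_def xy(5) mon' by (rule arg_cong)
  \<comment> \<open>Since \<open>E < N W\<close> and \<open>N - 1\<close> of these weights belong to
    the power of \<open>f j\<close>, the lower terms in this digit have weight below
    \<open>W\<close>. So \<open>exponent_nonneg\<close> applies.\<close>
  have lt: "E - of_nat ?n * w j < of_int (\<kappa> j) + wt (j - 1) (\<beta>' j)"
    using E N unfolding wtW' by (simp add: W_def of_nat_diff algebra_simps)
  have nz: "- of_nat N * \<theta> j \<noteq> 0" using N \<theta>[OF j] by simp
  have "\<kappa> j \<ge> 0"
    by (rule exponent_nonneg[OF _ _ z' \<beta>' lt nz poly[unfolded Bn]]) (use polys j in auto)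
  then show ?thesis
    unfolding step'(1)[OF j] mon_def using polys j
    by (intro is_polynomial_add is_polynomial_mult is_polynomial_power is_polynomial_prod is_polynomial_laurent_monom) auto
qed

theorem polynomials_constant:
  assumes "p \<in> fil l 0" "is_polynomial p" "w l > 0 \<or> w l = 0 \<and> \<not> is_polynomial (f l)"
  shows "\<exists>c. p = laurent_monom c 0"
proof (cases "p = 0")
  case True
  then show ?thesis by (metis laurent_monom_0)
next
  case p0: False
  have f: "lead_coeff (f l) = 1" "degree (f l) = D l" "D l > 0"
    using key_monic[of l] D_pos[of l] l by (metis order_refl)+
  have "p \<in> normal l 0" using assms(1) l by (intro fil_normal) auto
  then obtain M b where b: "p = (\<Sum>n<M. b n * f l ^ n)" "\<And>n. b n \<in> basic (l - 1) (0 - of_nat n * w l)"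
    unfolding normal_def by auto
  have small: "b n = 0 \<or> degree (b n) < degree (f l)" for n
    using basic_degree'[OF l order_refl b(2)] .
  obtain n where n: "b n \<noteq> 0" "degree p = degree (b n) + n * D l" "lead_coeff p = lead_coeff (b n)"
    "p = (\<Sum>n<Suc n. b n * f l ^ n)"
    using adic_top[where b = b, OF f(1) _ small b(1) p0] f by auto
  \<comment> \<open>Polynomiality gives \<open>k \<ge> 0\<close>. The inequality of
    \<open>basic_lead\<close> then bounds a sum of nonnegative numbers by a nonpositive one, so
    every term vanishes.\<close>
  have *: "k = 0 \<and> degree (b n) = 0 \<and> (w l > 0 \<longrightarrow> n = 0)" if k: "k \<in> Poly_Mapping.keys (lead_coeff (b n))" for k
  proof -
    have k0: "k \<ge> 0" using assms(2) k n(3) unfolding is_polynomial_def by metis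
    have lead: "of_int k * of_nat (D l) + of_nat (degree (b n)) * w l \<le> - (of_nat n * w l * of_nat (D l))"
      "degree (b n) > 0 \<longrightarrow>
        of_int k * of_nat (D l) + of_nat (degree (b n)) * w l < - (of_nat n * w l * of_nat (D l))"
      using basic_lead[OF _ b(2) n(1) k] l by auto
    have nn: "of_int k * of_nat (D l) \<ge> (0::rat)" "of_nat (degree (b n)) * w l \<ge> 0" "of_nat n * w l * of_nat (D l) \<ge> 0"
      using k0 assms(3) by auto
    have "\<not> degree (b n) > 0" using lead(2) nn by linarith
    then have "degree (b n) = 0" by simp
    moreover have "of_int k * of_nat (D l) = (0::rat)" "of_nat n * w l * of_nat (D l) = 0"
      using lead(1) nn by linarith+
    ultimately show ?thesis using f(3) by auto
  qed
  have "lead_coeff (b n) \<noteq> 0" using n(1) by simp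
  then have ne: "Poly_Mapping.keys (lead_coeff (b n)) \<noteq> {}" by simp
  with * have deg: "degree (b n) = 0" by blast
  define c where "c = Poly_Mapping.lookup (lead_coeff (b n)) 0"
  have "lead_coeff (b n) = Poly_Mapping.single 0 c"
    by (rule poly_mapping_eqI) (use * in \<open>auto simp: c_def lookup_single when_def in_keys_iff\<close>)
  then have bn: "b n = laurent_monom c 0"
    unfolding laurent_monom_def using deg by (metis degree_eq_zeroE lead_coeff_pCons(2) pCons_0_0)
  show ?thesis
  proof (cases "n = 0")
    case True
    then show ?thesis using n(4) bn by auto
  next
    case False
    with * ne assms(3) have nonpoly: "\<not> is_polynomial (f l)" and w0: "w l = 0" by fastforce+
    have c0: "c \<noteq> 0" using bn n(1) by auto
    \<comment> \<open>Normalized to be monic, of the same degree as \<open>f l ^ n\<close>.\<close>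
    define q where "q = laurent_monom (1 / c) 0 * p"
    have qb: "laurent_monom (1 / c) 0 * b n = 1"
      using c0 by (simp add: bn laurent_monom_mult laurent_monom_one)
    have d1: "degree (laurent_monom (1 / c) 0) = 0" "laurent_monom (1 / c) 0 \<noteq> 0"
      using qb by (auto simp: laurent_monom_def)
    have q: "q \<noteq> 0" "degree q = n * D l" "lead_coeff q = 1" "is_polynomial q"
    proof -
      show "q \<noteq> 0" using d1 p0 by (simp add: q_def)
      show "degree q = n * D l" using d1 p0 n(2) deg by (simp add: q_def degree_mult_eq)
      have "lead_coeff q = lead_coeff (laurent_monom (1 / c) 0 * b n)"
        unfolding q_def lead_coeff_mult n(3) ..
      then show "lead_coeff q = 1" by (simp add: qb)
      show "is_polynomial q" unfolding q_def by (intro is_polynomial_mult is_polynomial_laurent_monom assms) auto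
    qed
    have "laurent_monom (1 / c) 0 * mon l (\<lambda>_. 0) \<in> fil l 0"
      by (rule fil_mon) (simp add: wt_def)
    then have "q \<in> fil l 0"
      using fil_mult[OF assms(1)] by (fastforce simp: q_def mon_def)
    \<comment> \<open>As \<open>w l = 0\<close>, the weight bound 0 can be read as
      \<open>n * w l\<close>.\<close>
    then have base: "\<exists>N\<ge>1. q \<in> fil l (of_nat N * w l) \<and> degree q = N * D l"
      using q False w0 by (intro exI[of _ n]) auto
    \<comment> \<open>From the last key form down to \<open>f j\<close>: at every step
      \<open>N\<close> is multiplied by \<open>\<alpha> i\<close>, so \<open>q\<close> looks like a
      power of each key form.\<close>
    have desc: "\<exists>N\<ge>1. q \<in> fil j (of_nat N * w j) \<and> degree q = N * D j" if "1 \<le> j" "j \<le> l" for j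
      using that(2)
    proof (induction j rule: inc_induct)
      case base
      show ?case by fact
    next
      case (step i)
      then have i: "1 \<le> i" "i < l" using that by auto
      obtain N where N: "N \<ge> 1" "q \<in> fil (Suc i) (of_nat N * w (Suc i))" "degree q = N * D (Suc i)"
        using step by blast
      show ?case
      proof (intro exI conjI)
        show "1 \<le> N * \<alpha> i" using N(1) \<alpha>_pos[OF i] by (simp add: Suc_le_eq)
        show "q \<in> fil i (of_nat (N * \<alpha> i) * w i)" by (rule fil_descend(1)[OF i N(2,3) q(1)])
        show "degree q = N * \<alpha> i * D i" using N(3) i by (simp add: D_Suc mult.commute mult.left_commute)
      qed
    qed
    \<comment> \<open>Now upwards: if the earlier key forms are polynomials,
      \<open>key_step_is_polynomial\<close> applied to \<open>q\<close> gives the next one, up to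
      \<open>f l\<close>, a contradiction.\<close>
    have "is_polynomial (f j)" if "1 \<le> j" "j \<le> l" for j
      using that
    proof (induction j rule: less_induct)
      case (less j)
      show ?case
      proof (cases "j = 1")
        case True
        have "is_polynomial [:0, 1:]"
          by (auto simp: is_polynomial_def coeff_pCons split: nat.splits if_splits)
        with f1 True show ?thesis by simp
      next
        case False
        then obtain i where i: "j = Suc i" "1 \<le> i" "i < l" using less.prems by (cases j) auto
        obtain N where N: "N \<ge> 1" "q \<in> fil (Suc i) (of_nat N * w (Suc i))" "degree q = N * D (Suc i)"
          using desc[of "Suc i"] i by auto
        show ?thesis unfolding i(1)
          by (rule key_step_is_polynomial[OF i(2,3) _ N(2,3) q(3,4) N(1)]) (use less.IH i in auto)
      qed
    qed
    with nonpoly l show ?thesis by blast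
  qed
qed

section \<open>Obtaining this setting from \<open>key_forms\<close>\<close>

lemma mpoly_eval_fil:
  assumes "mpoly_in l G" "w 0 = 1"
  shows "mpoly_eval G f \<in> fil l (weighted_degree w G)"
  unfolding mpoly_eval_def
proof (rule fil_sum)
  fix m assume m: "m \<in> Poly_Mapping.keys G"
  then have sub: "Poly_Mapping.keys m \<subseteq> {1..l}" using assms(1) by (auto simp: mpoly_in_def)
  let ?a = "Poly_Mapping.lookup m"
  have mon: "(\<Prod>j\<in>Poly_Mapping.keys m. f j ^ ?a j) = mon l ?a"
    unfolding mon_def by (rule prod.mono_neutral_left) (use sub in \<open>auto simp: in_keys_iff\<close>)
  have wt: "(\<Sum>j\<in>Poly_Mapping.keys m. of_nat (?a j) * w j) = wt l ?a"
    unfolding wt_def by (rule sum.mono_neutral_left) (use sub in \<open>auto simp: in_keys_iff\<close>)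
  let ?S = "{of_int k * w 0 + (\<Sum>j\<in>Poly_Mapping.keys m. of_nat (Poly_Mapping.lookup m j) * w j) |m k.
     m \<in> Poly_Mapping.keys G \<and> k \<in> Poly_Mapping.keys (Poly_Mapping.lookup G m)}"
  have "?S = (\<lambda>(m, k). of_int k * w 0 + (\<Sum>j\<in>Poly_Mapping.keys m. of_nat (Poly_Mapping.lookup m j) * w j)) `
      (SIGMA m:Poly_Mapping.keys G. Poly_Mapping.keys (Poly_Mapping.lookup G m))" by auto
  then have fin: "finite ?S" by (simp only: finite_imageI finite_SigmaI finite_keys)
  have "laurent_monom c k * mon l ?a \<in> fil l (weighted_degree w G)"
    if k: "k \<in> Poly_Mapping.keys (Poly_Mapping.lookup G m)" for c k
  proof (rule fil_mon)
    have "of_int k * w 0 + (\<Sum>j\<in>Poly_Mapping.keys m. of_nat (?a j) * w j) \<in> ?S" using m k by blast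
    then have "of_int k * w 0 + (\<Sum>j\<in>Poly_Mapping.keys m. of_nat (?a j) * w j) \<le> weighted_degree w G"
      unfolding weighted_degree_def by (rule Max_ge[OF fin])
    then show "of_int k + wt l ?a \<le> weighted_degree w G" by (simp add: wt assms(2))
  qed
  then show "[:Poly_Mapping.lookup G m:] * (\<Prod>j\<in>Poly_Mapping.keys m. f j ^ ?a j) \<in> fil l (weighted_degree w G)"
    unfolding mon laurent_expand[of "Poly_Mapping.lookup G m"] sum_distrib_right by (intro fil_sum)
qed

end

text \<open>The denominator of \<open>w j\<close> is an admissible multiplier because
  \<open>w 0 = 1\<close>; so the \<open>LEAST\<close> in \<open>key_alpha\<close> is taken over a
  nonempty set.\<close>

lemma key_alpha_pos:
  assumes "w 0 = 1" "1 \<le> j"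
  shows "key_alpha w j > 0"
proof -
  obtain a b where ab: "quotient_of (w j) = (a, b)" by fastforce
  then have b: "b > 0" "w j = of_int a / of_int b" by (auto simp: quotient_of_denom_pos quotient_of_div)
  have "of_nat (nat b) * w j = (\<Sum>i<j. of_int (if i = 0 then a else 0) * w i)"
  proof -
    have "(\<Sum>i<j. of_int (if i = 0 then a else 0) * w i) = (\<Sum>i\<in>{0}. of_int a * w i)"
      by (rule sum.mono_neutral_cong_right) (use assms in auto)
    then show ?thesis using b assms by simp
  qed
  then have "\<exists>m::nat \<Rightarrow> int. of_nat (nat b) * w j = (\<Sum>i<j. of_int (m i) * w i)"
    by (rule exI[of _ "\<lambda>i. if i = 0 then a else 0"])
  with b(1) have "nat b > 0 \<and> (\<exists>m::nat \<Rightarrow> int. of_nat (nat b) * w j = (\<Sum>i<j. of_int (m i) * w i))" by auto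
  then show ?thesis unfolding key_alpha_def by (rule LeastI2) auto
qed

text \<open>Membership in \<open>fil\<close> comes from the minimum in the definition of key forms
  being attained by some \<open>G\<close>.\<close>

lemma key_forms_sequence:
  assumes kf: "key_forms \<delta> fs" and u: "\<delta> (laurent_monom 1 1) = 1"
  obtains \<alpha> \<kappa> \<beta> \<theta> l where "key_sequence ((!) fs) (\<lambda>i. \<delta> (fs ! i)) \<alpha> \<kappa> \<beta> \<theta> l" "length fs = Suc l"
    "\<And>g. g \<noteq> 0 \<Longrightarrow> g \<in> key_sequence.fil ((!) fs) (\<lambda>i. \<delta> (fs ! i)) l (\<delta> g)"
proof -
  let ?w = "\<lambda>i. \<delta> (fs ! i)" and ?\<alpha> = "key_alpha (\<lambda>i. \<delta> (fs ! i))"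
  obtain l where l: "l \<ge> 1" "length fs = Suc l" "fs ! 0 = laurent_monom 1 1" "fs ! 1 = [:0, 1:]"
    and ks: "\<And>j. 1 \<le> j \<Longrightarrow> j < l \<Longrightarrow> key_step ?w ((!) fs) j"
    and min: "\<And>g. g \<noteq> 0 \<Longrightarrow> \<exists>G. mpoly_in l G \<and> mpoly_eval G ((!) fs) = g \<and> \<delta> g = weighted_degree ?w G"
  proof -
    obtain l where l: "l \<ge> 1" "length fs = Suc l" "fs ! 0 = laurent_monom 1 1" "fs ! 1 = [:0, 1:]"
      "\<forall>j. 1 \<le> j \<and> j < l \<longrightarrow> key_step ?w ((!) fs) j"
      "\<forall>g. g \<noteq> 0 \<longrightarrow> \<delta> g \<in> {weighted_degree ?w G |G. mpoly_in l G \<and> mpoly_eval G ((!) fs) = g}"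
      using kf unfolding key_forms_def Let_def by (elim exE conjE) simp
    show ?thesis
      by (rule that[OF l(1-4)]) (use l(5,6) in \<open>auto simp del: One_nat_def\<close>)
  qed
  have w0: "?w 0 = 1" using l u by simp
  \<comment> \<open>The guards \<open>1 \<le> j\<close> and \<open>j < l\<close> are part of
    \<open>P\<close>, so that the data can be chosen for all \<open>j\<close>
    simultaneously.\<close>
  define P where "P j \<kappa> \<beta> \<theta> \<longleftrightarrow> (1 \<le> j \<longrightarrow> j < l \<longrightarrow> \<theta> \<noteq> 0 \<and>
      of_nat (?\<alpha> j) * ?w j = of_int \<kappa> + (\<Sum>i=1..<j. of_nat (\<beta> i) * ?w i) \<and>
      (\<forall>i. 1 \<le> i \<longrightarrow> i < j \<longrightarrow> \<beta> i < ?\<alpha> i) \<and>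
      fs ! (Suc j) = (fs ! j) ^ ?\<alpha> j - laurent_monom \<theta> \<kappa> * (\<Prod>i=1..<j. (fs ! i) ^ \<beta> i) \<and>
      ?w (Suc j) < of_nat (?\<alpha> j) * ?w j)"
    for j :: nat and \<kappa> :: int and \<beta> :: "nat \<Rightarrow> nat" and \<theta> :: complex
  have "\<exists>\<kappa> \<beta> \<theta>. P j \<kappa> \<beta> \<theta>" for j
  proof (cases "1 \<le> j \<and> j < l")
    case True
    then obtain \<beta> :: "nat \<Rightarrow> int" and \<theta> where s: "\<theta> \<noteq> 0"
      "of_nat (?\<alpha> j) * ?w j = (\<Sum>i<j. of_int (\<beta> i) * ?w i)"
      "\<And>i. 1 \<le> i \<Longrightarrow> i < j \<Longrightarrow> 0 \<le> \<beta> i \<and> \<beta> i < int (?\<alpha> i)"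
      "fs ! (Suc j) = (fs ! j) ^ ?\<alpha> j - laurent_monom \<theta> (\<beta> 0) * (\<Prod>i=1..<j. (fs ! i) ^ nat (\<beta> i))"
      "?w (Suc j) < of_nat (?\<alpha> j) * ?w j"
      using ks[of j] unfolding key_step_def by blast
    \<comment> \<open>The term with index 0 becomes \<open>\<kappa> j\<close>, as
      \<open>w 0 = 1\<close>.\<close>
    have "(\<Sum>i<j. of_int (\<beta> i) * ?w i) = of_int (\<beta> 0) * ?w 0 + (\<Sum>i=1..<j. of_int (\<beta> i) * ?w i)"
      using True by (simp add: lessThan_atLeast0 sum.atLeast_Suc_lessThan)
    also have "(\<Sum>i=1..<j. of_int (\<beta> i) * ?w i) = (\<Sum>i=1..<j. of_nat (nat (\<beta> i)) * ?w i)"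
      by (rule sum.cong) (use s(3) in \<open>auto simp: of_nat_nat\<close>)
    finally have "of_nat (?\<alpha> j) * ?w j = of_int (\<beta> 0) + (\<Sum>i=1..<j. of_nat (nat (\<beta> i)) * ?w i)"
      using s(2) w0 by simp
    then show ?thesis using s unfolding P_def
      by (intro exI[of _ "\<beta> 0"] exI[of _ "\<lambda>i. nat (\<beta> i)"] exI[of _ \<theta>]) (auto simp: nat_less_iff)
  qed (auto simp: P_def)
  then obtain \<kappa> \<beta> \<theta> where "\<And>j. P j (\<kappa> j) (\<beta> j) (\<theta> j)" by metis
  note * = this[unfolded P_def]
  interpret key_sequence "(!) fs" ?w ?\<alpha> \<kappa> \<beta> \<theta> l
  proof (unfold_locales, goal_cases)
    case (3 j)
    then show ?case using key_alpha_pos[of ?w, OF w0] by blast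
  next
    case (6 i j)
    then show ?case using *[of j] by (meson le_less_trans less_imp_le)
  qed (use l * in \<open>(meson | simp)+\<close>)
  have "g \<in> fil l (\<delta> g)" if g: "g \<noteq> 0" for g
  proof -
    obtain G where "mpoly_in l G" "mpoly_eval G ((!) fs) = g" "\<delta> g = weighted_degree ?w G"
      using min[OF g] by blast
    with mpoly_eval_fil[of G] w0 show ?thesis by simp
  qed
  then show ?thesis using that key_sequence_axioms \<open>length fs = Suc l\<close> by blast
qed

subsection \<open>Substitution and evaluation homomorphisms\<close>

text \<open>The map out of a monoid algebra induced by a map \<open>h\<close> on coefficients and a
  map \<open>\<mu>\<close> on exponents; \<open>pm_hom\<close> has the conditions for compatibility
  with sums and products. The embedding of Laurent polynomials and both evaluations are
  instances.\<close>

definition pm_eval :: "('c::zero \<Rightarrow> 'r::comm_semiring_1) \<Rightarrow> ('k \<Rightarrow> 'r) \<Rightarrow> ('k \<Rightarrow>\<^sub>0 'c) \<Rightarrow> 'r" where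
  "pm_eval h \<mu> g = (\<Sum>k\<in>Poly_Mapping.keys g. h (Poly_Mapping.lookup g k) * \<mu> k)"

lemma pm_eval_superset:
  assumes "h 0 = 0" "finite K" "Poly_Mapping.keys g \<subseteq> K"
  shows "pm_eval h \<mu> g = (\<Sum>k\<in>K. h (Poly_Mapping.lookup g k) * \<mu> k)"
  unfolding pm_eval_def by (rule sum.mono_neutral_left) (use assms in \<open>auto simp: in_keys_iff\<close>)

locale pm_hom =
  fixes h :: "'c::comm_semiring_1 \<Rightarrow> 'r::comm_semiring_1" and \<mu> :: "'k::comm_monoid_add \<Rightarrow> 'r"
  assumes h0: "h 0 = 0" and h_add: "h (a + b) = h a + h b" and h_mult: "h (a * b) = h a * h b"
    and \<mu>_add: "\<mu> (k + m) = \<mu> k * \<mu> m"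
begin

lemma pm_eval_0 [simp]: "pm_eval h \<mu> 0 = 0"
  by (simp add: pm_eval_def)

lemma pm_eval_add: "pm_eval h \<mu> (a + b) = pm_eval h \<mu> a + pm_eval h \<mu> b"
proof -
  let ?K = "Poly_Mapping.keys a \<union> Poly_Mapping.keys b"
  have "Poly_Mapping.keys (a + b) \<subseteq> ?K" by (rule Poly_Mapping.keys_add)
  then show ?thesis
    by (simp add: pm_eval_superset[of h ?K] h0 lookup_add h_add ring_distribs sum.distrib)
qed

lemma pm_eval_sum: "pm_eval h \<mu> (sum a I) = (\<Sum>i\<in>I. pm_eval h \<mu> (a i))"
  by (induction I rule: infinite_finite_induct) (auto simp: pm_eval_add)

lemma pm_eval_single [simp]: "pm_eval h \<mu> (Poly_Mapping.single k c) = h c * \<mu> k"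
  by (simp add: pm_eval_def h0)

lemma pm_eval_mult: "pm_eval h \<mu> (a * b) = pm_eval h \<mu> a * pm_eval h \<mu> b"
proof -
  have "a * b = (\<Sum>k\<in>Poly_Mapping.keys a. \<Sum>m\<in>Poly_Mapping.keys b.
      Poly_Mapping.single (k + m) (Poly_Mapping.lookup a k * Poly_Mapping.lookup b m))"
    by (subst (1) poly_mapping_expand[of a], subst (1) poly_mapping_expand[of b])
      (simp add: sum_product mult_single)
  then have "pm_eval h \<mu> (a * b) = (\<Sum>k\<in>Poly_Mapping.keys a. \<Sum>m\<in>Poly_Mapping.keys b.
      (h (Poly_Mapping.lookup a k) * \<mu> k) * (h (Poly_Mapping.lookup b m) * \<mu> m))"
    by (simp add: pm_eval_sum h_mult \<mu>_add mult_ac)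
  then show ?thesis by (simp add: pm_eval_def sum_product)
qed

end

locale poly_subst =
  fixes h :: "'c::comm_ring_1 \<Rightarrow> 'r::comm_ring_1" and g :: 'r
  assumes h0: "h 0 = 0" and h_add: "h (a + b) = h a + h b" and h_mult: "h (a * b) = h a * h b"
begin

abbreviation sub :: "'c poly \<Rightarrow> 'r" where "sub p \<equiv> poly (map_poly h p) g"

lemma sub_pCons: "sub (pCons a p) = h a + g * sub p"
  by (simp add: map_poly_pCons h0)

lemma sub_add: "sub (p + q) = sub p + sub q"
  by (induction p q rule: poly_induct2) (simp_all add: sub_pCons h_add algebra_simps)

lemma sub_smult: "sub (smult a p) = h a * sub p"
  by (induction p) (simp_all add: sub_pCons h_mult algebra_simps)

lemma sub_mult: "sub (p * q) = sub p * sub q"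
  by (induction p) (simp_all add: sub_pCons sub_add sub_smult h0 algebra_simps)

end

section \<open>The substitution of the generic branch and bounds for the semidegree\<close>

lemma laurent_embed_eq:
  "laurent_embed = pm_eval (\<lambda>c. Poly_Mapping.single 0 [:c:]) (\<lambda>k. Poly_Mapping.single (of_int k) 1)"
  by (rule ext) (simp add: laurent_embed_def pm_eval_def mult_single flip: one_pCons)

interpretation embed: pm_hom "\<lambda>c::complex. Poly_Mapping.single (0::rat) [:c:]"
    "\<lambda>k::int. Poly_Mapping.single (of_int k :: rat) (1 :: complex poly)"
  by unfold_locales (simp_all add: mult_single mult.commute flip: single_add)

interpretation subst: poly_subst laurent_embed "generic_branch \<phi> \<omega>" for \<phi> \<omega>
  by unfold_locales (simp_all add: laurent_embed_eq embed.pm_eval_add embed.pm_eval_mult)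

lemma subst_branch_add: "subst_branch \<phi> \<omega> (f + g) = subst_branch \<phi> \<omega> f + subst_branch \<phi> \<omega> g"
  and subst_branch_mult: "subst_branch \<phi> \<omega> (f * g) = subst_branch \<phi> \<omega> f * subst_branch \<phi> \<omega> g"
  by (simp_all add: subst_branch_def subst.sub_add subst.sub_mult)

lemma laurent_embed_single: "laurent_embed (Poly_Mapping.single k c) = Poly_Mapping.single (of_int k) [:c:]"
  by (simp add: laurent_embed_eq mult_single flip: one_pCons)

lemma subst_branch_laurent_monom:
  "subst_branch \<phi> \<omega> (laurent_monom c k) = Poly_Mapping.single (of_int k) [:c:]"
  unfolding subst_branch_def laurent_monom_def subst.sub_pCons by (simp add: laurent_embed_single)

text \<open>The bound for the semidegree as a condition on all exponents: it also makes sense if the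
  substitution gives 0, where \<open>semidegree\<close> would be the maximum of the empty
  set.\<close>

definition dle :: "(rat \<Rightarrow>\<^sub>0 real) \<Rightarrow> rat \<Rightarrow> laurent poly \<Rightarrow> rat \<Rightarrow> bool" where
  "dle \<phi> \<omega> f e \<longleftrightarrow> (\<forall>q\<in>Poly_Mapping.keys (subst_branch \<phi> \<omega> f). q \<le> e)"

lemma dle_mono: "dle \<phi> \<omega> f e \<Longrightarrow> e \<le> e' \<Longrightarrow> dle \<phi> \<omega> f e'"
  unfolding dle_def by force

lemma dle_add: "dle \<phi> \<omega> f e \<Longrightarrow> dle \<phi> \<omega> g e \<Longrightarrow> dle \<phi> \<omega> (f + g) e"
  using Poly_Mapping.keys_add[of "subst_branch \<phi> \<omega> f" "subst_branch \<phi> \<omega> g"]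
  unfolding dle_def subst_branch_add by fast

lemma dle_0: "dle \<phi> \<omega> 0 e"
  by (simp add: dle_def subst_branch_def)

lemma dle_sum: "(\<And>i. i \<in> I \<Longrightarrow> dle \<phi> \<omega> (f i) e) \<Longrightarrow> dle \<phi> \<omega> (sum f I) e"
  by (induction I rule: infinite_finite_induct) (auto simp: dle_0 dle_add)

lemma dle_mult:
  assumes "dle \<phi> \<omega> f e" "dle \<phi> \<omega> g e'"
  shows "dle \<phi> \<omega> (f * g) (e + e')"
  unfolding dle_def
proof
  fix q assume "q \<in> Poly_Mapping.keys (subst_branch \<phi> \<omega> (f * g))"
  then obtain a b where "q = a + b" "a \<in> Poly_Mapping.keys (subst_branch \<phi> \<omega> f)"
    "b \<in> Poly_Mapping.keys (subst_branch \<phi> \<omega> g)"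
    unfolding subst_branch_mult using keys_mult by blast
  then show "q \<le> e + e'" using assms by (auto simp: dle_def intro: add_mono)
qed

lemma dle_laurent_monom: "of_int k \<le> e \<Longrightarrow> dle \<phi> \<omega> (laurent_monom c k) e"
  by (simp add: dle_def subst_branch_laurent_monom)

lemma dle_power: "dle \<phi> \<omega> f e \<Longrightarrow> dle \<phi> \<omega> (f ^ n) (of_nat n * e)"
proof (induction n)
  case 0
  then show ?case using dle_laurent_monom[of 0 0 \<phi> \<omega> 1] by (simp add: laurent_monom_one)
next
  case (Suc n)
  then show ?case using dle_mult[of \<phi> \<omega> f e "f ^ n" "of_nat n * e"] by (simp add: algebra_simps)
qed

lemma dle_semidegree: "dle \<phi> \<omega> f (semidegree \<phi> \<omega> f)"
  by (auto simp: dle_def semidegree_def)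

lemma semidegree_le: "dle \<phi> \<omega> f e \<Longrightarrow> subst_branch \<phi> \<omega> f \<noteq> 0 \<Longrightarrow> semidegree \<phi> \<omega> f \<le> e"
  by (auto simp: dle_def semidegree_def)

lemma semidegree_u: "semidegree \<phi> \<omega> (laurent_monom 1 1) = 1"
  by (simp add: semidegree_def subst_branch_laurent_monom)

section \<open>Evaluation at real points\<close>

definition phi_eval :: "(rat \<Rightarrow>\<^sub>0 real) \<Rightarrow> real \<Rightarrow> real" where
  "phi_eval \<phi> u = (\<Sum>q\<in>Poly_Mapping.keys \<phi>. Poly_Mapping.lookup \<phi> q * u powr of_rat q)"

definition laurent_eval :: "real \<Rightarrow> laurent \<Rightarrow> complex" where
  "laurent_eval u = pm_eval (\<lambda>c. c) (\<lambda>k. of_real (u powr of_int k))"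

definition eval_at :: "laurent poly \<Rightarrow> real \<Rightarrow> real \<Rightarrow> complex" where
  "eval_at f u v = poly (map_poly (laurent_eval u) f) (of_real v)"

definition xi_eval :: "real \<Rightarrow> real \<Rightarrow> puiseux_xi \<Rightarrow> complex" where
  "xi_eval u \<xi> = pm_eval (\<lambda>a. poly a (of_real \<xi>)) (\<lambda>q. of_real (u powr of_rat q))"

interpretation laurent_ev: pm_hom "\<lambda>c::complex. c" "\<lambda>k::int. complex_of_real (u powr of_int k)" for u
  by unfold_locales (simp_all add: powr_add)

interpretation xi_ev: pm_hom "\<lambda>a::complex poly. poly a (of_real \<xi>)"
    "\<lambda>q::rat. complex_of_real (u powr of_rat q)" for u \<xi>
  by unfold_locales (simp_all add: powr_add of_rat_add)

interpretation eval_at: poly_subst "laurent_eval u" "complex_of_real v" for u v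
  by unfold_locales (simp_all add: laurent_eval_def laurent_ev.pm_eval_add laurent_ev.pm_eval_mult)

lemma eval_at_add: "eval_at (f + g) u v = eval_at f u v + eval_at g u v"
  and eval_at_mult: "eval_at (f * g) u v = eval_at f u v * eval_at g u v"
  by (simp_all add: eval_at_def eval_at.sub_add eval_at.sub_mult)

lemma eval_at_laurent_monom: "eval_at (laurent_monom c k) u v = c * of_real (u powr of_int k)"
  unfolding eval_at_def laurent_monom_def eval_at.sub_pCons by (simp add: laurent_eval_def)

lemma xi_eval_embed: "xi_eval u \<xi> (laurent_embed a) = laurent_eval u a"
proof -
  have "xi_eval u \<xi> (laurent_embed a) =
      (\<Sum>k\<in>Poly_Mapping.keys a. Poly_Mapping.lookup a k * complex_of_real (u powr real_of_rat (of_int k)))"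
    by (simp add: laurent_embed_def xi_eval_def xi_ev.pm_eval_sum)
  then show ?thesis by (simp add: laurent_eval_def pm_eval_def)
qed

lemma xi_eval_generic_branch:
  "xi_eval u \<xi> (generic_branch \<phi> \<omega>) = of_real (phi_eval \<phi> u + \<xi> * u powr of_rat \<omega>)"
proof -
  let ?m = "Poly_Mapping.map (\<lambda>c. [:complex_of_real c:]) \<phi>"
  have lk: "Poly_Mapping.lookup ?m k = [:complex_of_real (Poly_Mapping.lookup \<phi> k):]" for k
    by (simp add: Poly_Mapping.map.rep_eq when_def)
  have "Poly_Mapping.keys ?m \<subseteq> Poly_Mapping.keys \<phi>" by (auto simp: in_keys_iff lk)
  then have "xi_eval u \<xi> ?m = of_real (phi_eval \<phi> u)"
    unfolding xi_eval_def phi_eval_def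
    by (subst pm_eval_superset[where K = "Poly_Mapping.keys \<phi>"]) (auto simp: lk)
  then show ?thesis
    by (simp add: generic_branch_def xi_eval_def xi_ev.pm_eval_add)
qed

text \<open>The link between the semidegree and actual growth: for fixed \<open>\<xi>\<close> the
  exponents of \<open>u\<close> in the substitution describe \<open>f\<close> along the curve
  \<open>v = \<phi>(u) + \<xi> u^\<omega>\<close>.\<close>

lemma xi_eval_subst_branch:
  "xi_eval u \<xi> (subst_branch \<phi> \<omega> f) = eval_at f u (phi_eval \<phi> u + \<xi> * u powr of_rat \<omega>)"
proof (induction f)
  case 0
  then show ?case by (simp add: subst_branch_def eval_at_def xi_eval_def)
next
  case (pCons a f)
  have "xi_eval u \<xi> (subst_branch \<phi> \<omega> (pCons a f))
      = laurent_eval u a + xi_eval u \<xi> (generic_branch \<phi> \<omega>) * xi_eval u \<xi> (subst_branch \<phi> \<omega> f)"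
    unfolding subst_branch_def subst.sub_pCons
    by (simp add: xi_eval_def xi_ev.pm_eval_add xi_ev.pm_eval_mult xi_eval_embed[unfolded xi_eval_def])
  then show ?case
    unfolding eval_at_def eval_at.sub_pCons xi_eval_generic_branch pCons.IH by (simp add: eval_at_def)
qed

subsection \<open>Polynomials of nonpositive degree by counting conditions\<close>

text \<open>Gaussian elimination: one equation with a nonzero entry removes one unknown.\<close>

lemma homogeneous_system:
  fixes M :: "'i \<Rightarrow> 'j \<Rightarrow> 'a::field"
  assumes "finite J" "finite I" "card J < card I"
  shows "\<exists>x. (\<exists>i\<in>I. x i \<noteq> 0) \<and> (\<forall>j\<in>J. (\<Sum>i\<in>I. x i * M i j) = 0)"
  using assms
proof (induction J arbitrary: I M rule: finite_induct)
  case empty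
  then obtain i where "i \<in> I" by (metis card.empty card_gt_0_iff ex_in_conv)
  then show ?case by (intro exI[of _ "\<lambda>_. 1"]) auto
next
  case (insert j J)
  show ?case
  proof (cases "\<forall>i\<in>I. M i j = 0")
    case True
    have "card J < card I" using insert by simp
    from insert.IH[OF insert.prems(1) this, of M] True show ?thesis by auto
  next
    case False
    then obtain i0 where i0: "i0 \<in> I" "M i0 j \<noteq> 0" by blast
    let ?I = "I - {i0}" and ?r = "\<lambda>i. M i j / M i0 j"
    let ?M = "\<lambda>i k. M i k - ?r i * M i0 k"
    have "finite ?I" "card J < card ?I" using insert i0 by auto
    from insert.IH[OF this, of ?M] obtain x where
      x: "\<exists>i\<in>?I. x i \<noteq> 0" "\<forall>k\<in>J. (\<Sum>i\<in>?I. x i * ?M i k) = 0" by blast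
    \<comment> \<open>The value of the eliminated unknown prescribed by equation
      \<open>j\<close>.\<close>
    define x0 where "x0 = - (\<Sum>i\<in>?I. x i * ?r i)"
    define y where "y = x(i0 := x0)"
    have sum: "(\<Sum>i\<in>I. y i * M i k) = x0 * M i0 k + (\<Sum>i\<in>?I. x i * M i k)" for k
      using insert.prems(1) i0(1) by (subst sum.remove[of _ i0]) (auto simp: y_def intro!: sum.cong)
    have "(\<Sum>i\<in>I. y i * M i k) = (\<Sum>i\<in>?I. x i * ?M i k)" for k
      unfolding sum x0_def by (simp add: algebra_simps sum_subtractf sum_distrib_left)
    moreover have "(\<Sum>i\<in>?I. x i * ?M i j) = 0" using i0(2) by simp
    ultimately have "\<forall>k\<in>insert j J. (\<Sum>i\<in>I. y i * M i k) = 0" using x(2) by auto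
    moreover have "\<exists>i\<in>I. y i \<noteq> 0" using x(1) by (auto simp: y_def)
    ultimately show ?thesis by blast
  qed
qed

text \<open>Weighted degree with weight 1 for \<open>u\<close> and \<open>s\<close> for
  \<open>v\<close>.\<close>

definition weighted_le :: "int \<Rightarrow> laurent poly \<Rightarrow> int \<Rightarrow> bool" where
  "weighted_le s f e \<longleftrightarrow> (\<forall>i. \<forall>k\<in>Poly_Mapping.keys (coeff f i). k + s * int i \<le> e)"

lemma weighted_le_mult:
  assumes "weighted_le s f e" "weighted_le s g e'"
  shows "weighted_le s (f * g) (e + e')"
  unfolding weighted_le_def
proof (intro allI ballI)
  fix i k assume "k \<in> Poly_Mapping.keys (coeff (f * g) i)"
  then obtain r where r: "r \<le> i" "k \<in> Poly_Mapping.keys (coeff f r * coeff g (i - r))"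
    unfolding coeff_mult using Poly_Mapping.keys_sum[of "\<lambda>r. coeff f r * coeff g (i - r)" "{..i}"] by blast
  then obtain a b where ab: "k = a + b" "a \<in> Poly_Mapping.keys (coeff f r)"
    "b \<in> Poly_Mapping.keys (coeff g (i - r))"
    using keys_mult by blast
  then have "a + s * int r \<le> e" "b + s * int (i - r) \<le> e'" using assms by (auto simp: weighted_le_def)
  then show "k + s * int i \<le> e + e'" using ab(1) r(1) by (simp add: of_nat_diff algebra_simps)
qed

lemma weighted_le_1: "weighted_le s 1 0"
  by (auto simp: weighted_le_def coeff_1 split: if_splits)

lemma weighted_le_power: "weighted_le s f e \<Longrightarrow> weighted_le s (f ^ n) (int n * e)"
  by (induction n) (auto simp: weighted_le_1 ring_distribs intro: weighted_le_mult)

locale weighted_basis =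
  fixes b :: "nat \<Rightarrow> laurent poly" and s :: int
  assumes monic: "lead_coeff (b m) = 1" and deg: "degree (b m) = m" and weight: "weighted_le s (b m) (s * int m)"
begin

text \<open>Triangular elimination: the top coefficient is removed with the monic
  \<open>b (Suc M)\<close>, and the product subtracted stays within the weighted degree.\<close>

lemma basis_expansion:
  assumes "weighted_le s f e" "\<And>i. i > M \<Longrightarrow> coeff f i = 0"
  shows "\<exists>a. f = (\<Sum>m\<le>M. [:a m:] * b m) \<and> (\<forall>m. \<forall>k\<in>Poly_Mapping.keys (a m). k \<le> e - s * int m)"
  using assms
proof (induction M arbitrary: f)
  case 0
  have "b 0 = 1" using monic[of 0] deg[of 0] by (metis degree_eq_zeroE lead_coeff_pCons(2) one_pCons pCons_0_0)
  moreover have "f = [:coeff f 0:]"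
    using 0(2) by (intro poly_eqI) (auto simp: coeff_pCons split: nat.splits)
  moreover have "\<forall>k\<in>Poly_Mapping.keys (coeff f 0). k \<le> e" using 0(1) by (force simp: weighted_le_def)
  ultimately show ?case by (intro exI[of _ "\<lambda>m. if m = 0 then coeff f 0 else 0"]) auto
next
  case (Suc M)
  let ?a = "coeff f (Suc M)" and ?b = "b (Suc M)"
  let ?f = "f - [:?a:] * ?b"
  have a: "\<forall>k\<in>Poly_Mapping.keys ?a. k \<le> e - s * int (Suc M)"
    using Suc.prems(1) unfolding weighted_le_def by (metis le_diff_eq)
  have wa: "weighted_le s ([:?a:] * ?b) e"
  proof -
    have "weighted_le s [:?a:] (e - s * int (Suc M))"
      using a by (auto simp: weighted_le_def coeff_pCons split: nat.splits)
    from weighted_le_mult[OF this weight[of "Suc M"]] show ?thesis by simp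
  qed
  have "weighted_le s ?f e"
    unfolding weighted_le_def
  proof (intro allI ballI)
    fix i k assume "k \<in> Poly_Mapping.keys (coeff ?f i)"
    then have "k \<in> Poly_Mapping.keys (coeff f i) \<or> k \<in> Poly_Mapping.keys (coeff ([:?a:] * ?b) i)"
      unfolding coeff_diff in_keys_iff lookup_minus by auto
    then show "k + s * int i \<le> e" using Suc.prems(1) wa unfolding weighted_le_def by blast
  qed
  moreover have "coeff ?f i = 0" if "i > M" for i
  proof (cases "i = Suc M")
    case True
    then show ?thesis using monic[of "Suc M"] deg[of "Suc M"] by simp
  next
    case False
    then show ?thesis using that Suc.prems(2)[of i] deg[of "Suc M"] by (simp add: coeff_eq_0)
  qed
  ultimately obtain c where c: "?f = (\<Sum>m\<le>M. [:c m:] * b m)"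
    "\<forall>m. \<forall>k\<in>Poly_Mapping.keys (c m). k \<le> e - s * int m"
    using Suc.IH[of ?f] by blast
  let ?c = "c(Suc M := ?a)"
  have "(\<Sum>m\<le>M. [:?c m:] * b m) = (\<Sum>m\<le>M. [:c m:] * b m)" by (intro sum.cong) auto
  then have "f = (\<Sum>m\<le>Suc M. [:?c m:] * b m)" using c(1) by (simp add: algebra_simps)
  then show ?case using c(2) a by (intro exI[of _ ?c]) auto
qed

text \<open>
  The coefficient of \<open>u\<^sup>k\<close> in the \<open>m\<close>-th coordinate is allowed to be nonzero if \<open>k + \<tau>\<^sub>m \<le> 0\<close>. Among the
  polynomials of weighted degree at most \<open>d\<close> the number of conditions exceeds the number of
  unknowns by an amount independent of \<open>d\<close> at the finitely many \<open>m\<close> with \<open>\<tau>\<^sub>m > 0\<close>, while every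
  other \<open>m\<close> with \<open>s m \<le> d\<close> has at least one condition less than unknowns.
\<close>

lemma exists_nonconstant:
  assumes s: "s \<ge> 1"
    and \<tau>: "\<And>m. dle \<phi> \<omega> (b m) (\<tau> m)" "\<And>m. m \<ge> m0 \<Longrightarrow> \<tau> m \<le> 0"
  shows "\<exists>p. is_polynomial p \<and> dle \<phi> \<omega> p 0 \<and> (\<forall>c. p \<noteq> laurent_monom c 0)"
proof -
  \<comment> \<open>The possible conditions at negative exponents. They concern only
    \<open>m < m0\<close>, so their number is independent of the degree bound chosen later.\<close>
  define J0 where "J0 = (SIGMA m:{..<m0}. {k::int. - \<tau> m < of_int k \<and> k < 0})"
  have finint: "finite {k::int. - \<tau> m < of_int k \<and> k \<le> e}" for m e
  proof (rule finite_subset)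
    show "{k::int. - \<tau> m < of_int k \<and> k \<le> e} \<subseteq> {\<lfloor>- \<tau> m\<rfloor>..e}" by (auto simp: floor_le_iff)
  qed auto
  have "finite {k::int. - \<tau> m < of_int k \<and> k < 0}" for m
    by (rule finite_subset[OF _ finint[of m 0]]) auto
  then have finJ0: "finite J0" unfolding J0_def by (intro finite_SigmaI) auto
  \<comment> \<open>Then the unknowns at exponent 0 with \<open>m0 \<le> m \<le> N\<close>, which
    match no condition, are \<open>card J0 + 2\<close> in number: one makes up for dropping the
    constant monomial, one for strictness.\<close>
  define N where "N = m0 + card J0 + 1"
  define d where "d = s * int N"
  have d0: "d \<ge> 0" using s by (simp add: d_def)
  \<comment> \<open>A pair in \<open>I0\<close> stands for the monomial \<open>u^k v^j\<close>. In
    \<open>I\<close> the constant monomial is left out, so that any nontrivial solution is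
    nonconstant. A pair in \<open>J\<close> asks the coefficient of \<open>u^k\<close> at
    \<open>b m\<close> to vanish.\<close>
  define I0 where "I0 = {(j::nat, k::int). 0 \<le> k \<and> k + s * int j \<le> d}"
  define I where "I = I0 - {(0, 0)}"
  define J where "J = (SIGMA m:{..nat d}. {k::int. - \<tau> m < of_int k \<and> k \<le> d - s * int m})"
  have jd: "j \<le> nat d" if "(j, k) \<in> I0" for j k
  proof -
    have "1 * int j \<le> s * int j" using s by (intro mult_right_mono) auto
    then show ?thesis using that by (auto simp: I0_def)
  qed
  have "I0 \<subseteq> {..nat d} \<times> {0..d}"
  proof
    fix z assume z: "z \<in> I0"
    obtain j k where jk: "z = (j, k)" by fastforce
    have "s * int j \<ge> 0" using s by simp
    then have "k \<in> {0..d}" using z jk by (auto simp: I0_def)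
    then show "z \<in> {..nat d} \<times> {0..d}" using jd[of j k] z jk by simp
  qed
  then have finI0: "finite I0" by (rule finite_subset) auto
  have finJ: "finite J" unfolding J_def by (intro finite_SigmaI finint) auto
  have "J - I0 \<subseteq> J0"
  proof
    fix z assume zJ: "z \<in> J - I0"
    obtain m k where "z = (m, k)" by fastforce
    with zJ have z: "z = (m, k)" "- \<tau> m < of_int k" "k < 0" by (auto simp: J_def I0_def)
    then have "of_int k < (0::rat)" by simp
    then have "\<tau> m > 0" using z(2) by linarith
    then have "m < m0" using \<tau>(2) not_le by (metis linorder_not_less)
    then show "z \<in> J0" using z by (simp add: J0_def)
  qed
  then have c1: "card (J - I0) \<le> card J0" using finJ0 by (rule card_mono[rotated])
  have "{m0..N} \<times> {0::int} \<subseteq> I0 - J"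
  proof
    fix z assume "z \<in> {m0..N} \<times> {0::int}"
    then obtain m where m: "z = (m, 0)" "m0 \<le> m" "m \<le> N" by auto
    have "int m \<le> int N" using m(3) by (simp only: of_nat_le_iff)
    then have "s * int m \<le> d" unfolding d_def by (rule mult_left_mono) (use s in linarith)
    then have "(m, 0) \<in> I0" by (simp add: I0_def)
    moreover have "(m, 0) \<notin> J" using \<tau>(2)[OF m(2)] by (simp add: J_def)
    ultimately show "z \<in> I0 - J" unfolding m(1) by blast
  qed
  then have "card ({m0..N} \<times> {0::int}) \<le> card (I0 - J)"
    using finI0 by (intro card_mono) auto
  moreover have "card ({m0..N} \<times> {0::int}) = card J0 + 2"
    by (simp add: card_cartesian_product N_def)
  moreover have "card J = card (J \<inter> I0) + card (J - I0)" "card I0 = card (J \<inter> I0) + card (I0 - J)"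
    using card_Int_Diff[OF finJ, of I0] card_Int_Diff[OF finI0, of J] by (auto simp: Int_commute)
  moreover have "card I0 = Suc (card I)"
  proof -
    have "(0, 0) \<in> I0" using d0 by (simp add: I0_def)
    from card.remove[OF finI0 this] show ?thesis by (simp add: I_def)
  qed
  ultimately have card: "card J < card I" using c1 by linarith
  have finI: "finite I" using finI0 by (simp add: I_def)
  define e where "e = (\<lambda>(j, k). monom (Poly_Mapping.single k (1::complex)) j :: laurent poly)"
  have "\<exists>a. e z = (\<Sum>m\<le>nat d. [:a m:] * b m) \<and> (\<forall>m. \<forall>k\<in>Poly_Mapping.keys (a m). k \<le> d - s * int m)"
    if "z \<in> I" for z
  proof (rule basis_expansion)
    obtain j k where z: "z = (j, k)" by fastforce
    show "weighted_le s (e z) d" using that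
      by (auto simp: z e_def weighted_le_def I_def I0_def split: if_splits)
    show "coeff (e z) i = 0" if i: "i > nat d" for i
      using jd[of j k] \<open>z \<in> I\<close> i by (auto simp: z e_def I_def)
  qed
  then obtain a where a: "\<And>z. z \<in> I \<Longrightarrow> e z = (\<Sum>m\<le>nat d. [:a z m:] * b m)"
    "\<And>z m k. z \<in> I \<Longrightarrow> k \<in> Poly_Mapping.keys (a z m) \<Longrightarrow> k \<le> d - s * int m" by metis
  obtain x where x: "\<exists>z\<in>I. x z \<noteq> 0"
    "\<forall>y\<in>J. (\<Sum>z\<in>I. x z * Poly_Mapping.lookup (a z (fst y)) (snd y)) = 0"
    using homogeneous_system[OF finJ finI card, of "\<lambda>z y. Poly_Mapping.lookup (a z (fst y)) (snd y)"] by blast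
  define p where "p = (\<Sum>z\<in>I. laurent_monom (x z) 0 * e z)"
  define A where "A m = (\<Sum>z\<in>I. Poly_Mapping.single 0 (x z) * a z m)" for m
  have lookup_scale: "Poly_Mapping.lookup (Poly_Mapping.single 0 c * g) k = c * Poly_Mapping.lookup g k"
    for c and g :: laurent and k
    unfolding mult_map_scale_conv_mult[symmetric] by (simp add: Poly_Mapping.map.rep_eq when_def)
  have lA: "Poly_Mapping.lookup (A m) k = (\<Sum>z\<in>I. x z * Poly_Mapping.lookup (a z m) k)" for m k
    by (simp add: A_def lookup_sum lookup_scale)
  have "p = (\<Sum>z\<in>I. \<Sum>m\<le>nat d. [:Poly_Mapping.single 0 (x z) * a z m:] * b m)"
    unfolding p_def
  proof (rule sum.cong[OF refl])
    fix z assume z: "z \<in> I"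
    show "laurent_monom (x z) 0 * e z = (\<Sum>m\<le>nat d. [:Poly_Mapping.single 0 (x z) * a z m:] * b m)"
      by (simp add: a(1)[OF z] sum_distrib_left laurent_monom_def mult.commute)
  qed
  also have "\<dots> = (\<Sum>m\<le>nat d. (\<Sum>z\<in>I. [:Poly_Mapping.single 0 (x z) * a z m:]) * b m)"
    by (subst sum.swap) (simp add: sum_distrib_right)
  also have "\<dots> = (\<Sum>m\<le>nat d. [:A m:] * b m)"
  proof -
    have "(\<Sum>z\<in>I. [:Poly_Mapping.single 0 (x z) * a z m:]) = [:A m:]" for m
      by (rule poly_eqI) (auto simp: A_def coeff_sum coeff_pCons split: nat.splits)
    then show ?thesis by simp
  qed
  finally have pA: "p = (\<Sum>m\<le>nat d. [:A m:] * b m)" .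
  have kA: "of_int k \<le> - \<tau> m" if k: "k \<in> Poly_Mapping.keys (A m)" and m: "m \<le> nat d" for k m
  proof (rule ccontr)
    assume n: "\<not> of_int k \<le> - \<tau> m"
    have "\<exists>z\<in>I. Poly_Mapping.lookup (a z m) k \<noteq> 0"
    proof (rule ccontr)
      assume "\<not> (\<exists>z\<in>I. Poly_Mapping.lookup (a z m) k \<noteq> 0)"
      then have "Poly_Mapping.lookup (A m) k = 0" unfolding lA by (intro sum.neutral) auto
      then show False using k by (simp add: in_keys_iff)
    qed
    then have "k \<le> d - s * int m" using a(2) by (auto simp: in_keys_iff)
    then have "(m, k) \<in> J" using n m by (simp add: J_def)
    from x(2)[rule_format, OF this] have "Poly_Mapping.lookup (A m) k = 0" by (simp add: lA)
    then show False using k by (simp add: in_keys_iff)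
  qed
  have "dle \<phi> \<omega> [:A m:] (- \<tau> m)" if "m \<le> nat d" for m
    unfolding laurent_expand[of "A m"] using kA[OF _ that] by (intro dle_sum dle_laurent_monom) auto
  then have "dle \<phi> \<omega> ([:A m:] * b m) (- \<tau> m + \<tau> m)" if "m \<le> nat d" for m
    by (rule dle_mult[OF _ \<tau>(1)]) (rule that)
  then have "dle \<phi> \<omega> ([:A m:] * b m) 0" if "m \<le> nat d" for m
    using that by simp
  then have "dle \<phi> \<omega> p 0" unfolding pA by (intro dle_sum) auto
  moreover have "is_polynomial p"
    unfolding p_def
  proof (intro is_polynomial_sum is_polynomial_mult is_polynomial_laurent_monom)
    fix z assume "z \<in> I"
    then show "is_polynomial (e z)"
      by (cases z) (auto simp: is_polynomial_def e_def I_def I0_def split: if_splits)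
  qed simp
  \<comment> \<open>A nonzero unknown is the coefficient of \<open>p\<close> at a monomial other
    than 1.\<close>
  moreover have "p \<noteq> laurent_monom c 0" for c
  proof
    assume pc: "p = laurent_monom c 0"
    obtain j k where z: "(j, k) \<in> I" "x (j, k) \<noteq> 0" using x(1) by auto
    have le: "Poly_Mapping.lookup (coeff (e (j', k')) j) k = (if (j', k') = (j, k) then 1 else 0)" for j' k'
      by (auto simp: e_def lookup_single)
    have "Poly_Mapping.lookup (coeff p j) k = (\<Sum>z\<in>I. x z * Poly_Mapping.lookup (coeff (e z) j) k)"
      by (simp add: p_def coeff_sum lookup_sum laurent_monom_def lookup_scale)
    also have "\<dots> = (\<Sum>z\<in>I. if z = (j, k) then x z else 0)"
      by (rule sum.cong) (auto simp: le split: if_splits)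
    also have "\<dots> = x (j, k)" using finI z(1) by simp
    finally have "Poly_Mapping.lookup (coeff p j) k \<noteq> 0" using z(2) by simp
    moreover have "(j, k) \<noteq> (0, 0)" using z(1) by (simp add: I_def)
    ultimately show False
      unfolding pc laurent_monom_def by (auto simp: coeff_pCons lookup_single split: nat.splits)
  qed
  ultimately show ?thesis by blast
qed

end

text \<open>The powers of \<open>F\<close> make the semidegree of the basis elements tend to minus
  infinity, so only finitely many of the bounds \<open>\<tau>\<close> are positive.\<close>

lemma exists_nonconstant_of_negative:
  assumes F: "lead_coeff F = 1" "degree F > 0" "dle \<phi> \<omega> F e" "e < 0"
  shows "\<exists>p. is_polynomial p \<and> dle \<phi> \<omega> p 0 \<and> (\<forall>c. p \<noteq> laurent_monom c 0)"
proof -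
  let ?D = "degree F" and ?v = "[:0, 1:] :: laurent poly"
  \<comment> \<open>With \<open>s\<close> above all exponents of \<open>u\<close> in
    \<open>F\<close>, the term of top weighted degree of \<open>F\<close> is the pure power of
    \<open>v\<close>; the element 1 ensures \<open>s \<ge> 1\<close>.\<close>
  define K where "K = insert 1 (\<Union>i\<le>?D. Poly_Mapping.keys (coeff F i))"
  have "finite K" by (simp add: K_def)
  define s where "s = Max K"
  have s: "s \<ge> 1" "\<And>i k. i \<le> ?D \<Longrightarrow> k \<in> Poly_Mapping.keys (coeff F i) \<Longrightarrow> k \<le> s"
    unfolding s_def by (rule Max_ge[OF \<open>finite K\<close>], force simp: K_def)+
  \<comment> \<open>One monic element in each degree: division with remainder by
    \<open>degree F\<close> splits \<open>m\<close>.\<close>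
  define b where "b m = ?v ^ (m mod ?D) * F ^ (m div ?D)" for m
  have wF: "weighted_le s F (s * int ?D)"
    unfolding weighted_le_def
  proof (intro allI ballI)
    fix i k assume k: "k \<in> Poly_Mapping.keys (coeff F i)"
    then have i: "i \<le> ?D" by (metis coeff_eq_0 keys_zero empty_iff not_le)
    show "k + s * int i \<le> s * int ?D"
    proof (cases "i = ?D")
      case True
      then show ?thesis using k F(1) by (auto split: if_splits)
    next
      case False
      have "s * (int i + 1) \<le> s * int ?D" using s(1) i False by (intro mult_left_mono) auto
      then show ?thesis using s(2)[OF i k] by (simp add: algebra_simps)
    qed
  qed
  have v: "lead_coeff ?v = 1" "degree ?v = 1" "weighted_le s ?v s"
    by (auto simp: weighted_le_def coeff_pCons split: nat.splits if_splits)
  have F0: "F \<noteq> 0" using F(2) by auto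
  interpret weighted_basis b s
  proof
    fix m
    have "?v ^ (m mod ?D) \<noteq> 0" by simp
    note d = degree_mult_monic_power[OF F(1) this, of "m div ?D"]
    show "lead_coeff (b m) = 1"
      unfolding b_def d(2) by (rule lead_coeff_monic_power) simp
    show "degree (b m) = m"
      unfolding b_def d(1) by (simp add: degree_power_eq)
    have "weighted_le s (b m) (int (m mod ?D) * s + int (m div ?D) * (s * int ?D))"
      unfolding b_def by (intro weighted_le_mult weighted_le_power v wF)
    also have "int (m mod ?D) * s + int (m div ?D) * (s * int ?D) = s * int (m mod ?D + m div ?D * ?D)"
      by (simp only: of_nat_add of_nat_mult algebra_simps)
    finally show "weighted_le s (b m) (s * int m)" by simp
  qed
  define C where "C = max 0 (semidegree \<phi> \<omega> ?v)"
  define \<tau> where "\<tau> m = of_nat ?D * C + of_nat (m div ?D) * e" for m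
  have \<tau>: "dle \<phi> \<omega> (b m) (\<tau> m)" for m
  proof -
    have "dle \<phi> \<omega> ?v C" by (rule dle_mono[OF dle_semidegree]) (simp add: C_def)
    then have bm: "dle \<phi> \<omega> (b m) (of_nat (m mod ?D) * C + of_nat (m div ?D) * e)"
      unfolding b_def by (intro dle_mult dle_power F(3))
    have "of_nat (m mod ?D) * C \<le> of_nat ?D * C"
      using F(2) by (intro mult_right_mono) (auto simp: C_def)
    then show ?thesis unfolding \<tau>_def by (intro dle_mono[OF bm]) simp
  qed
  \<comment> \<open>From \<open>n\<close> factors \<open>F\<close> on, their negative weight
    outweighs the contribution of the powers of \<open>v\<close>.\<close>
  obtain n :: nat where "of_nat ?D * C / (- e) < of_nat n" using reals_Archimedean2 by blast
  then have n: "of_nat ?D * C / (- e) \<le> of_nat n" by simp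
  have "\<tau> m \<le> 0" if "m \<ge> n * ?D" for m
  proof -
    have "n \<le> m div ?D" using that F(2) by (simp add: less_eq_div_iff_mult_less_eq)
    then have "of_nat ?D * C / (- e) \<le> of_nat (m div ?D)" using n order_trans of_nat_mono by blast
    then show ?thesis using F(4) by (simp add: \<tau>_def field_simps)
  qed
  from exists_nonconstant[OF s(1) \<tau> this] show ?thesis by blast
qed

subsection \<open>Real polynomial functions\<close>

lemma eval2_add [simp]: "eval2 (p + q) z = eval2 p z + eval2 q z"
  and eval2_mult [simp]: "eval2 (p * q) z = eval2 p z * eval2 q z"
  and eval2_diff [simp]: "eval2 (p - q) z = eval2 p z - eval2 q z"
  and eval2_0 [simp]: "eval2 0 z = 0"
  and eval2_pCons [simp]: "eval2 (pCons a p) z = poly a (fst z) + snd z * eval2 p z"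
  by (simp_all add: eval2_def)

lemma continuous_on_eval2: "continuous_on T (eval2 p)"
  by (induction p) (auto intro!: continuous_intros simp: eval2_0[abs_def] eval2_pCons[abs_def])

lemma eval2_linear:
  assumes "linear B"
  shows "\<exists>q. \<forall>z. eval2 q z = eval2 p (B z)"
proof -
  have B: "B z = fst z *\<^sub>R B (1, 0) + snd z *\<^sub>R B (0, 1)" for z
  proof -
    have "z = fst z *\<^sub>R (1, 0) + snd z *\<^sub>R (0, 1)" by (simp add: prod_eq_iff)
    then have "B z = B (fst z *\<^sub>R (1, 0) + snd z *\<^sub>R (0, 1))" by simp
    then show ?thesis by (simp only: linear_add[OF assms] linear_scale[OF assms])
  qed
  define X where "X = [:[:0, fst (B (1, 0)):], [:fst (B (0, 1)):]:]"
  define Y where "Y = [:[:0, snd (B (1, 0)):], [:snd (B (0, 1)):]:]"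
  have XY: "eval2 X z = fst (B z)" "eval2 Y z = snd (B z)" for z
    by (subst B, simp add: X_def Y_def)+
  have inner: "\<exists>q. \<forall>z. eval2 q z = poly a (fst (B z))" for a
  proof (induction a)
    case (pCons c a)
    then obtain q where "\<forall>z. eval2 q z = poly a (fst (B z))" by blast
    then show ?case by (intro exI[of _ "[:[:c:]:] + X * q"]) (simp add: XY)
  qed (auto intro: exI[of _ 0])
  show ?thesis
  proof (induction p)
    case (pCons a p)
    then obtain q where "\<forall>z. eval2 q z = eval2 p (B z)" by blast
    moreover obtain r where "\<forall>z. eval2 r z = poly a (fst (B z))" using inner by blast
    ultimately show ?case by (intro exI[of _ "r + Y * q"]) (simp add: XY)
  qed (auto intro: exI[of _ 0])
qed

lemma poly_zero_if_zero_above: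
  fixes p :: "'a::{real_normed_field} poly"
  assumes "\<And>u. u > u0 \<Longrightarrow> poly p (of_real u) = 0"
  shows "p = 0"
proof (rule ccontr)
  assume "p \<noteq> 0"
  then have "finite {x. poly p x = 0}" by (rule poly_roots_finite)
  moreover have "(of_real :: real \<Rightarrow> 'a) ` {u0<..} \<subseteq> {x. poly p x = 0}" using assms by auto
  ultimately have "finite ((of_real :: real \<Rightarrow> 'a) ` {u0<..})" by (rule finite_subset[rotated])
  then have "finite {u0<..}" by (rule finite_imageD) (auto simp: inj_on_def)
  then show False using infinite_Ioi by blast
qed

text \<open>Finiteness of roots is used in \<open>v\<close> for fixed \<open>u\<close>, then in
  \<open>u\<close>. Restricting to \<open>u > u0\<close> fits the evaluations by
  \<open>powr\<close>, which agree with polynomials for positive \<open>u\<close>.\<close>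

lemma eval2_zero_if_zero_above:
  assumes "\<And>u v. u > u0 \<Longrightarrow> eval2 p (u, v) = 0"
  shows "p = 0"
proof (rule poly_eqI)
  fix i
  have "poly (coeff p i) u = 0" if u: "u > u0" for u
  proof -
    let ?q = "map_poly (\<lambda>a. poly a u) p"
    have "poly ?q v = eval2 p (u, v)" for v
      by (induction p) (simp_all add: map_poly_pCons)
    then have "?q = 0" using assms[OF u] by (simp add: poly_all_0_iff_0[symmetric])
    then have "coeff ?q i = 0" by simp
    then show ?thesis by (simp add: coeff_map_poly)
  qed
  then show "coeff p i = coeff 0 i" using poly_zero_if_zero_above[of u0 "coeff p i"] by simp
qed

lemma constant_polys_above:
  assumes "\<And>u v. u > u0 \<Longrightarrow> eval2 p (u, v) = c"
  shows "p \<in> constant_polys"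
proof -
  have "p - [:[:c:]:] = 0" by (rule eval2_zero_if_zero_above[of u0]) (simp add: assms)
  then show ?thesis by (simp add: constant_polys_def)
qed

lemma constant_polys_eval2: "p \<in> constant_polys \<Longrightarrow> \<exists>c. \<forall>z. eval2 p z = c"
  by (auto simp: constant_polys_def)

section \<open>The algebra of bounded polynomials\<close>

lemma total_degree_0:
  assumes "total_degree q \<le> 0"
  shows "q \<in> constant_polys"
proof (cases "q = 0")
  case True
  then show ?thesis by (auto simp: constant_polys_def intro!: image_eqI[of _ _ 0])
next
  case False
  let ?S = "{degree (coeff q j) + j |j. coeff q j \<noteq> 0}"
  have "finite {j. coeff q j \<noteq> 0}" by (rule finite_subset[of _ "{..degree q}"]) (auto intro: le_degree)
  then have fin: "finite ?S" by simp
  have z: "degree (coeff q j) = 0 \<and> j = 0" if "coeff q j \<noteq> 0" for j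
  proof -
    have "degree (coeff q j) + j \<in> ?S" using that by blast
    then have "degree (coeff q j) + j \<le> total_degree q" using Max_ge[OF fin] False by (simp add: total_degree_def)
    then have "degree (coeff q j) + j \<le> 0" using assms by (rule order_trans)
    then show ?thesis by auto
  qed
  have "q = [:coeff q 0:]"
  proof (rule poly_eqI)
    fix j
    show "coeff q j = coeff [:coeff q 0:] j" using z[of j] by (cases j) auto
  qed
  moreover have "coeff q 0 = [:coeff (coeff q 0) 0:]"
    using z[of 0] by (metis degree_0 degree_eq_zeroE coeff_pCons_0)
  ultimately show ?thesis unfolding constant_polys_def by (metis rangeI)
qed

text \<open>For degree bound 0 the majorant is a constant: its square root bounds the polynomial,
  and conversely the square of a bound is a majorant.\<close>

lemma B0_iff: "p \<in> \<B> 0 S \<longleftrightarrow> (\<exists>K. \<forall>z\<in>S. \<bar>eval2 p z\<bar> \<le> K)"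
proof
  assume "p \<in> \<B> 0 S"
  then obtain q where q: "total_degree q \<le> 0" "\<forall>z\<in>S. (eval2 p z)\<^sup>2 \<le> eval2 q z" by (auto simp: \<B>_def)
  obtain c where "\<forall>z. eval2 q z = c" using constant_polys_eval2[OF total_degree_0[OF q(1)]] by blast
  then have "\<forall>z\<in>S. \<bar>eval2 p z\<bar> \<le> sqrt c" using q(2) by (metis real_sqrt_abs real_sqrt_le_iff)
  then show "\<exists>K. \<forall>z\<in>S. \<bar>eval2 p z\<bar> \<le> K" by blast
next
  assume "\<exists>K. \<forall>z\<in>S. \<bar>eval2 p z\<bar> \<le> K"
  then obtain K where K: "\<forall>z\<in>S. \<bar>eval2 p z\<bar> \<le> K" by blast
  have "(eval2 p z)\<^sup>2 \<le> eval2 [:[:K\<^sup>2:]:] z" if "z \<in> S" for z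
    using K that by (simp add: abs_le_square_iff[symmetric]) (smt (verit))
  moreover have "total_degree [:[:K\<^sup>2:]:] \<le> 2 * 0"
  proof (cases "K = 0")
    case False
    let ?S = "{degree (coeff [:[:K\<^sup>2:]:] j) + j |j. coeff [:[:K\<^sup>2:]:] j \<noteq> 0}"
    have "j = 0" if "coeff [:[:K\<^sup>2:]:] j \<noteq> 0" for j using that by (cases j) auto
    then have sub: "?S \<subseteq> {0}" by force
    have "degree (coeff [:[:K\<^sup>2:]:] 0) + 0 \<in> ?S"
      by (intro CollectI exI[of _ 0] conjI refl) (use False in simp)
    then have "?S \<noteq> {}" by (metis empty_iff)
    moreover have "finite ?S" by (rule finite_subset[OF sub]) simp
    ultimately have "Max ?S \<in> ?S" by (rule Max_in[rotated])
    then have "Max ?S \<in> {0}" by (rule subsetD[OF sub])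
    then have Max: "Max ?S = 0" by (simp only: singleton_iff)
    have nz: "[:[:K\<^sup>2:]:] \<noteq> 0" using False by simp
    have "total_degree [:[:K\<^sup>2:]:] = Max ?S" unfolding total_degree_def by (rule if_not_P[OF nz])
    then show ?thesis by (simp only: Max mult_0_right order_refl)
  qed (simp add: total_degree_def)
  ultimately show "p \<in> \<B> 0 S" unfolding \<B>_def by blast
qed

lemma constant_polys_B0: "constant_polys \<subseteq> \<B> 0 S"
  by (auto simp: B0_iff constant_polys_def)

section \<open>Passage between real and Laurent polynomials\<close>

lemma eval_at_pCons: "eval_at (pCons a f) u v = laurent_eval u a + of_real v * eval_at f u v"
  by (simp add: eval_at_def eval_at.sub_pCons)

lemma laurent_of_real_poly:
  "\<exists>f. is_polynomial f \<and> (\<forall>u>0. \<forall>v. eval_at f u v = of_real (eval2 r (u, v)))"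
proof (induction r)
  case 0
  show ?case by (intro exI[of _ 0]) (simp add: is_polynomial_0 eval_at_def)
next
  case (pCons a r)
  have "\<exists>f. is_polynomial f \<and> (\<forall>u>0. \<forall>v. eval_at f u v = of_real (poly a u))" for a
  proof (induction a)
    case 0
    show ?case by (intro exI[of _ 0]) (simp add: is_polynomial_0 eval_at_def)
  next
    case (pCons c a)
    then obtain f where "is_polynomial f" "\<forall>u>0. \<forall>v. eval_at f u v = of_real (poly a u)" by blast
    then show ?case
      by (intro exI[of _ "laurent_monom (of_real c) 0 + laurent_monom 1 1 * f"])
        (auto simp: eval_at_add eval_at_mult eval_at_laurent_monom
          intro!: is_polynomial_add is_polynomial_mult is_polynomial_laurent_monom)
  qed
  then obtain g where "is_polynomial g" "\<forall>u>0. \<forall>v. eval_at g u v = of_real (poly a u)" by blast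
  moreover obtain f where "is_polynomial f" "\<forall>u>0. \<forall>v. eval_at f u v = of_real (eval2 r (u, v))"
    using pCons.IH by blast
  moreover from this have "is_polynomial (pCons 0 f)"
    by (auto simp: is_polynomial_def coeff_pCons split: nat.splits)
  ultimately show ?case
    by (intro exI[of _ "g + pCons 0 f"])
      (simp add: eval_at_add eval_at_pCons eval_at.h0 is_polynomial_add)
qed

lemma laurent_eval_nonneg:
  assumes "\<forall>k\<in>Poly_Mapping.keys a. k \<ge> 0" "u > 0"
  shows "laurent_eval u a = (\<Sum>k\<in>Poly_Mapping.keys a. Poly_Mapping.lookup a k * of_real u ^ nat k)"
  unfolding laurent_eval_def pm_eval_def
proof (rule sum.cong[OF refl])
  fix k assume "k \<in> Poly_Mapping.keys a"
  then have "of_int k = real (nat k)" using assms(1) by simp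
  then show "Poly_Mapping.lookup a k * of_real (u powr of_int k) = Poly_Mapping.lookup a k * of_real u ^ nat k"
    by (simp only: powr_realpow[OF assms(2)] of_real_power)
qed

lemma is_polynomial_pCons:
  assumes "is_polynomial (pCons a f)"
  shows "\<forall>k\<in>Poly_Mapping.keys a. k \<ge> 0" "is_polynomial f"
  using assms unfolding is_polynomial_def by (metis coeff_pCons_0, metis coeff_pCons_Suc)

text \<open>Key forms and the counting argument yield complex coefficients, while bounded
  polynomials are real; real and imaginary part are separated.\<close>

lemma real_polys_of_laurent:
  assumes "is_polynomial f"
  shows "\<exists>p q. \<forall>u>0. \<forall>v. eval_at f u v = Complex (eval2 p (u, v)) (eval2 q (u, v))"
  using assms
proof (induction f)
  case 0
  show ?case by (intro exI[of _ 0]) (simp add: eval_at_def Complex_eq)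
next
  case (pCons a f)
  from is_polynomial_pCons[OF pCons.prems] have a: "\<forall>k\<in>Poly_Mapping.keys a. k \<ge> 0" and "is_polynomial f" by auto
  then obtain p q where pq: "\<forall>u>0. \<forall>v. eval_at f u v = Complex (eval2 p (u, v)) (eval2 q (u, v))"
    using pCons.IH by blast
  let ?R = "\<lambda>R::complex \<Rightarrow> real. (\<Sum>k\<in>Poly_Mapping.keys a. monom (R (Poly_Mapping.lookup a k)) (nat k))"
  have "laurent_eval u a = Complex (poly (?R Re) u) (poly (?R Im) u)" if "u > 0" for u
    unfolding laurent_eval_nonneg[OF a that]
    by (rule complex_eqI) (simp_all add: poly_sum poly_monom flip: of_real_power)
  then show ?case
    using pq by (intro exI[of _ "pCons (?R Re) p"] exI[of _ "pCons (?R Im) q"])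
      (auto simp: eval_at_pCons Complex_eq algebra_simps)
qed

lemma eval_at_constant:
  assumes "is_polynomial f" "\<And>u v. u > 0 \<Longrightarrow> eval_at f u v = c"
  shows "f = laurent_monom c 0"
proof -
  define g where "g = f + laurent_monom (- c) 0"
  have g: "is_polynomial g" unfolding g_def by (intro is_polynomial_add assms is_polynomial_laurent_monom) simp
  have g0: "eval_at g u v = 0" if "u > 0" for u v
    using that assms(2) by (simp add: g_def eval_at_add eval_at_laurent_monom)
  have "coeff g i = 0" for i
  proof -
    define P where "P = (\<Sum>k\<in>Poly_Mapping.keys (coeff g i). monom (Poly_Mapping.lookup (coeff g i) k) (nat k))"
    have nn: "\<forall>k\<in>Poly_Mapping.keys (coeff g i). k \<ge> 0" using g by (simp add: is_polynomial_def)
    have "poly P (of_real u) = 0" if u: "u > 0" for u :: real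
    proof -
      have "map_poly (laurent_eval u) g = 0"
        by (rule poly_zero_if_zero_above[of 0]) (use g0[OF u] in \<open>simp add: eval_at_def\<close>)
      then have "coeff (map_poly (laurent_eval u) g) i = 0" by simp
      then have "laurent_eval u (coeff g i) = 0" by (simp add: coeff_map_poly eval_at.h0)
      then show ?thesis unfolding laurent_eval_nonneg[OF nn u] P_def by (simp add: poly_sum poly_monom)
    qed
    then have P0: "P = 0" by (rule poly_zero_if_zero_above)
    have "Poly_Mapping.lookup (coeff g i) k = 0" for k
    proof (rule ccontr)
      assume "Poly_Mapping.lookup (coeff g i) k \<noteq> 0"
      then have k: "k \<in> Poly_Mapping.keys (coeff g i)" by (simp add: in_keys_iff)
      have "coeff P (nat k) = (\<Sum>m\<in>Poly_Mapping.keys (coeff g i). if m = k then Poly_Mapping.lookup (coeff g i) m else 0)"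
        unfolding P_def coeff_sum by (rule sum.cong) (use nn k in \<open>auto simp: eq_nat_nat_iff\<close>)
      also have "\<dots> = Poly_Mapping.lookup (coeff g i) k" using k by simp
      finally show False using P0 k by (simp add: in_keys_iff)
    qed
    then show ?thesis by (intro poly_mapping_eqI) simp
  qed
  then have "g = 0" by (intro poly_eqI) simp
  then show ?thesis by (simp add: g_def laurent_monom_uminus)
qed

subsection \<open>Growth along the branches\<close>

text \<open>Beyond \<open>\<phi>\<close> and the term at \<open>\<omega>\<close>, all exponents are
  at most \<open>\<omega> - 1/N\<close>. The remaining series is therefore dominated by its absolute
  sum at one point \<open>u0\<close> times a single smaller power.\<close>

lemma branch_asymptotics:
  assumes conv: "puiseux_convergent c"
    and N: "N > 0" "\<And>q. c q \<noteq> 0 \<Longrightarrow> of_nat N * q \<in> \<int>" "of_nat N * \<omega> \<in> \<int>"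
    and \<phi>: "\<And>q. Poly_Mapping.lookup \<phi> q = (if q > \<omega> then c q else 0)"
  shows "((\<lambda>u. (puiseux_eval c u - phi_eval \<phi> u) / u powr of_rat \<omega>) \<longlongrightarrow> c \<omega>) at_top"
proof -
  let ?t = "puiseux_term c"
  obtain u1 where u1: "\<And>u. u \<ge> u1 \<Longrightarrow> ?t u summable_on UNIV"
    using conv by (auto simp: puiseux_convergent_def eventually_at_top_linorder)
  define u0 where "u0 = max 1 u1"
  have u0: "u0 \<ge> 1" "\<And>u. u \<ge> u0 \<Longrightarrow> ?t u summable_on UNIV" using u1 by (auto simp: u0_def)
  define T where "T = insert \<omega> (Poly_Mapping.keys \<phi>)"
  define rest where "rest u = infsum (?t u) (- T)" for u
  define \<eta> where "\<eta> = of_rat \<omega> - 1 / real N"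
  have sub: "?t u summable_on X" if "u \<ge> u0" for u X
    using summable_on_subset_banach[OF u0(2)[OF that]] by blast
  have split: "puiseux_eval c u = phi_eval \<phi> u + c \<omega> * u powr of_rat \<omega> + rest u" if u: "u \<ge> u0" for u
  proof -
    have "puiseux_eval c u = infsum (?t u) (T \<union> - T)" by (simp add: puiseux_eval_def)
    also have "\<dots> = infsum (?t u) T + rest u"
      unfolding rest_def by (rule infsum_Un_disjoint) (use sub[OF u] in auto)
    also have "infsum (?t u) T = (\<Sum>q\<in>T. ?t u q)" by (rule infsum_finite) (simp add: T_def)
    also have "\<dots> = ?t u \<omega> + (\<Sum>q\<in>Poly_Mapping.keys \<phi>. ?t u q)"
      unfolding T_def by (rule sum.insert) (auto simp: in_keys_iff \<phi>)
    also have "(\<Sum>q\<in>Poly_Mapping.keys \<phi>. ?t u q) = phi_eval \<phi> u"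
      unfolding phi_eval_def by (rule sum.cong) (auto simp: in_keys_iff \<phi> puiseux_term_def split: if_splits)
    finally show ?thesis by (simp add: puiseux_term_def)
  qed
  define K where "K = infsum (\<lambda>q. norm (?t u0 q)) (- T)"
  have bound: "norm (rest u) \<le> K * (u / u0) powr \<eta>" if u: "u \<ge> u0" for u
  proof -
    have abs: "(\<lambda>q. norm (?t u q)) summable_on - T" if "u \<ge> u0" for u
      using sub[OF that, of "- T"] summable_on_iff_abs_summable_on_real[of "?t u" "- T"] by blast
    have le: "norm (?t u q) \<le> norm (?t u0 q) * (u / u0) powr \<eta>" if q: "q \<in> - T" for q
    proof (cases "c q = 0")
      case False
      have "\<not> q > \<omega>" using q False by (auto simp: T_def in_keys_iff \<phi>)
      then have "q < \<omega>" using q by (auto simp: T_def)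
      obtain i j where ij: "of_nat N * q = of_int i" "of_nat N * \<omega> = of_int j"
        using N(2)[OF False] N(3) by (auto elim!: Ints_cases)
      have "of_nat N * q < of_nat N * \<omega>" using \<open>q < \<omega>\<close> N(1) by simp
      then have "i < j" unfolding ij by simp
      then have "(of_int i :: rat) \<le> of_int j - 1" by (metis of_int_1 of_int_diff of_int_le_iff zle_diff1_eq)
      then have "of_nat N * q \<le> of_nat N * \<omega> - 1" using ij by simp
      then have "q \<le> \<omega> - 1 / of_nat N" using N(1) by (simp add: field_simps)
      then have "of_rat q \<le> (of_rat (\<omega> - 1 / of_nat N) :: real)" by (simp add: of_rat_less_eq)
      then have q\<eta>: "of_rat q \<le> \<eta>" by (simp add: \<eta>_def of_rat_diff of_rat_divide)
      \<comment> \<open>As \<open>u / u0 \<ge> 1\<close>, every exponent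
        \<open>q \<le> \<eta>\<close> may be raised to \<open>\<eta>\<close>; the factors left over
        are summable at \<open>u0\<close>.\<close>
      have "u powr of_rat q = u0 powr of_rat q * (u / u0) powr of_rat q"
        using u u0 by (simp add: powr_mult[symmetric])
      also have "\<dots> \<le> u0 powr of_rat q * (u / u0) powr \<eta>"
        using q\<eta> u u0 by (intro mult_left_mono powr_mono) auto
      finally have "\<bar>c q\<bar> * u powr of_rat q \<le> \<bar>c q\<bar> * (u0 powr of_rat q * (u / u0) powr \<eta>)"
        by (intro mult_left_mono) auto
      then show ?thesis by (simp add: puiseux_term_def abs_mult mult.assoc)
    qed (simp add: puiseux_term_def)
    have "norm (rest u) \<le> infsum (\<lambda>q. norm (?t u q)) (- T)"
      unfolding rest_def by (rule norm_infsum_bound) (use abs[OF u] in simp)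
    also have "\<dots> \<le> infsum (\<lambda>q. norm (?t u0 q) * (u / u0) powr \<eta>) (- T)"
      by (rule infsum_mono[OF abs[OF u] _ le]) (use abs[of u0] in \<open>auto intro: summable_on_cmult_left\<close>)
    also have "\<dots> = K * (u / u0) powr \<eta>"
      unfolding K_def using abs[of u0] by (intro infsum_cmult_left) auto
    finally show ?thesis .
  qed
  have lim0: "((\<lambda>u. rest u / u powr of_rat \<omega>) \<longlongrightarrow> 0) at_top"
  proof (rule Lim_null_comparison)
    show "\<forall>\<^sub>F u in at_top. norm (rest u / u powr of_rat \<omega>) \<le> K / u0 powr \<eta> * u powr (- (1 / real N))"
      using eventually_ge_at_top[of u0]
    proof eventually_elim
      case (elim u)
      then have "norm (rest u / u powr of_rat \<omega>) \<le> K * (u / u0) powr \<eta> / u powr of_rat \<omega>"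
        using bound[OF elim] by (simp add: divide_right_mono)
      also have "\<dots> = K / u0 powr \<eta> * u powr (\<eta> - of_rat \<omega>)"
        using elim u0 by (simp add: powr_divide powr_diff)
      finally show ?case by (simp add: \<eta>_def)
    qed
    have "((\<lambda>u. u powr (- (1 / real N))) \<longlongrightarrow> 0) at_top"
      by (rule tendsto_neg_powr) (use N(1) in \<open>auto simp: filterlim_ident\<close>)
    from tendsto_mult_right_zero[OF this]
    show "((\<lambda>u. K / u0 powr \<eta> * u powr (- (1 / real N))) \<longlongrightarrow> 0) at_top" .
  qed
  have "((\<lambda>u. c \<omega> + rest u / u powr of_rat \<omega>) \<longlongrightarrow> c \<omega> + 0) at_top"
    by (intro tendsto_add tendsto_const lim0)
  moreover have "\<forall>\<^sub>F u in at_top. c \<omega> + rest u / u powr of_rat \<omega>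
      = (puiseux_eval c u - phi_eval \<phi> u) / u powr of_rat \<omega>"
    using eventually_ge_at_top[of u0]
  proof eventually_elim
    case (elim u)
    then have "u powr of_rat \<omega> \<noteq> 0" using u0 by simp
    then show ?case using split[OF elim] by (simp add: field_simps)
  qed
  ultimately show ?thesis by (simp add: tendsto_cong)
qed

text \<open>The exponents at which the series differ are fractions with a common denominator and at
  most 1, so there is a largest one, and it must be \<open>\<omega>\<close>.\<close>

lemma exponent_attained:
  assumes "puiseux c1" "puiseux c2" "c1 \<noteq> c2"
    and "\<forall>q>\<omega>. c1 q = c2 q" "\<forall>w. (\<forall>q>w. c1 q = c2 q) \<longrightarrow> \<omega> \<le> w"
  obtains N where "N > 0" "\<And>q. c1 q \<noteq> 0 \<Longrightarrow> of_nat N * q \<in> \<int>" "\<And>q. c2 q \<noteq> 0 \<Longrightarrow> of_nat N * q \<in> \<int>"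
    "of_nat N * \<omega> \<in> \<int>" "c1 \<omega> \<noteq> c2 \<omega>"
proof -
  obtain N1 N2 :: nat where N: "N1 > 0" "N2 > 0"
    "\<And>q. c1 q \<noteq> 0 \<Longrightarrow> q \<le> 1 \<and> of_nat N1 * q \<in> \<int>" "\<And>q. c2 q \<noteq> 0 \<Longrightarrow> q \<le> 1 \<and> of_nat N2 * q \<in> \<int>"
    using assms(1,2) by (auto simp: puiseux_def)
  define N where "N = N1 * N2"
  have "of_nat N * q = of_nat N2 * (of_nat N1 * q)" "of_nat N * q = of_nat N1 * (of_nat N2 * q)" for q :: rat
    by (simp_all add: N_def)
  then have int: "of_nat N * q \<in> \<int>" if "c1 q \<noteq> 0 \<or> c2 q \<noteq> 0" for q
    using that N(3,4)[of q] by (metis Ints_mult Ints_of_nat)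
  have pos: "N > 0" using N by (simp add: N_def)
  define F where "F = {k. \<exists>q. c1 q \<noteq> c2 q \<and> of_nat N * q = of_int k}"
  have F: "\<exists>k\<in>F. of_nat N * q = of_int k" if "c1 q \<noteq> c2 q" for q
  proof -
    have "of_nat N * q \<in> \<int>" using int that by (cases "c1 q = 0") auto
    then obtain k where "of_nat N * q = of_int k" by (auto elim: Ints_cases)
    then show ?thesis using that by (auto simp: F_def)
  qed
  have bound: "k \<le> int N" if k: "k \<in> F" for k
  proof -
    obtain q where q: "c1 q \<noteq> c2 q" "of_nat N * q = of_int k" using k by (auto simp: F_def)
    then have "q \<le> 1" using N(3,4)[of q] by (cases "c1 q = 0") auto
    then have "of_nat N * q \<le> of_nat N * 1" by (intro mult_left_mono) auto
    then have "(of_int k :: rat) \<le> of_int (int N)" using q(2) by simp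
    then show ?thesis by (simp only: of_int_le_iff)
  qed
  obtain q1 where "c1 q1 \<noteq> c2 q1" using assms(3) by auto
  then obtain k1 where k1: "k1 \<in> F" using F by blast
  \<comment> \<open>The numerators in \<open>F\<close> are bounded above but possibly infinite in
    number; cutting at one element \<open>k1\<close> makes the maximum available.\<close>
  define k where "k = Max (F \<inter> {k1..int N})"
  have fin: "finite (F \<inter> {k1..int N})" by simp
  have "k1 \<in> F \<inter> {k1..int N}" using k1 bound by auto
  then have "k \<in> F \<inter> {k1..int N}" unfolding k_def by (intro Max_in fin) auto
  then have kF: "k \<in> F" "k1 \<le> k" by auto
  have kmax: "m \<le> k" if m: "m \<in> F" for m
  proof (cases "m \<ge> k1")
    case True
    then have "m \<in> F \<inter> {k1..int N}" using m bound by auto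
    then show ?thesis unfolding k_def by (rule Max_ge[OF fin])
  qed (use kF in auto)
  obtain q where q: "c1 q \<noteq> c2 q" "of_nat N * q = of_int k" using kF(1) by (auto simp: F_def)
  have "c1 r = c2 r" if r: "r > q" for r
  proof (rule ccontr)
    assume "c1 r \<noteq> c2 r"
    then obtain m where m: "m \<in> F" "of_nat N * r = of_int m" using F by blast
    have "of_nat N * q < of_nat N * r" using r pos by simp
    then have "k < m" using q(2) m(2) by simp
    then show False using kmax[OF m(1)] by simp
  qed
  then have "\<omega> \<le> q" using assms(5) by blast
  moreover have "\<not> \<omega> < q" using assms(4) q(1) by blast
  ultimately have "\<omega> = q" by simp
  then show ?thesis using that[OF pos] int q by auto
qed

text \<open>The substitution is a finite sum of terms \<open>a(\<xi>) u^q\<close> with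
  \<open>q \<le> 0\<close>, where \<open>u \<ge> 1\<close> and \<open>\<xi>\<close> stays in a
  compact interval.\<close>

lemma bounded_of_dle:
  assumes "dle \<phi> \<omega> f 0"
  shows "\<exists>K. \<forall>u\<ge>1. \<forall>\<xi>. \<bar>\<xi>\<bar> \<le> X \<longrightarrow> cmod (eval_at f u (phi_eval \<phi> u + \<xi> * u powr of_rat \<omega>)) \<le> K"
proof -
  let ?h = "subst_branch \<phi> \<omega> f"
  have "\<exists>B. \<forall>\<xi>. \<bar>\<xi>\<bar> \<le> X \<longrightarrow> cmod (poly a (of_real \<xi>)) \<le> B" for a
  proof -
    have "compact ((\<lambda>\<xi>. poly a (complex_of_real \<xi>)) ` {-X..X})"
      by (intro compact_continuous_image continuous_intros) auto
    then have "bounded ((\<lambda>\<xi>. poly a (complex_of_real \<xi>)) ` {-X..X})" by (rule compact_imp_bounded)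
    then obtain B where "\<forall>x\<in>(\<lambda>\<xi>. poly a (complex_of_real \<xi>)) ` {-X..X}. norm x \<le> B"
      by (auto simp: bounded_iff)
    then show ?thesis by (intro exI[of _ B]) (auto simp: abs_le_iff)
  qed
  then obtain B where B: "\<And>a \<xi>. \<bar>\<xi>\<bar> \<le> X \<Longrightarrow> cmod (poly a (of_real \<xi>)) \<le> B a" by metis
  let ?K = "\<Sum>q\<in>Poly_Mapping.keys ?h. B (Poly_Mapping.lookup ?h q)"
  show ?thesis
  proof (intro exI[of _ ?K] allI impI)
    fix u \<xi> :: real assume u: "u \<ge> 1" and \<xi>: "\<bar>\<xi>\<bar> \<le> X"
    have "cmod (poly (Poly_Mapping.lookup ?h q) (of_real \<xi>) * of_real (u powr of_rat q)) \<le> B (Poly_Mapping.lookup ?h q)"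
      if q: "q \<in> Poly_Mapping.keys ?h" for q
    proof -
      have "q \<le> 0" using assms q by (simp add: dle_def)
      then have "(of_rat q :: real) \<le> 0" by simp
      then have "u powr of_rat q \<le> u powr 0" using u by (intro powr_mono) auto
      then have p: "u powr of_rat q \<le> 1" using u by simp
      have "cmod (poly (Poly_Mapping.lookup ?h q) (of_real \<xi>)) * u powr of_rat q
          \<le> cmod (poly (Poly_Mapping.lookup ?h q) (of_real \<xi>)) * 1"
        using p by (intro mult_left_mono) auto
      then show ?thesis using B[OF \<xi>, of "Poly_Mapping.lookup ?h q"] by (simp add: norm_mult)
    qed
    then have "cmod (xi_eval u \<xi> ?h) \<le> ?K"
      unfolding xi_eval_def pm_eval_def by (intro order_trans[OF norm_sum] sum_mono)
    then show "cmod (eval_at f u (phi_eval \<phi> u + \<xi> * u powr of_rat \<omega>)) \<le> ?K"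
      by (simp add: xi_eval_subst_branch)
  qed
qed

text \<open>The coefficient of the highest power of \<open>u\<close> is a nonzero polynomial in
  \<open>\<xi>\<close>, so some \<open>\<xi>\<close> in the interval is not a root. If that power
  were positive, dividing by it would give a nonzero limit and the limit 0 at once.\<close>

lemma dle_of_bounded:
  assumes "a < b"
    and bounded: "\<And>\<xi>. a < \<xi> \<Longrightarrow> \<xi> < b \<Longrightarrow>
      \<forall>\<^sub>F u in at_top. cmod (eval_at f u (phi_eval \<phi> u + \<xi> * u powr of_rat \<omega>)) \<le> K"
  shows "dle \<phi> \<omega> f 0"
proof (rule ccontr)
  let ?h = "subst_branch \<phi> \<omega> f"
  assume "\<not> dle \<phi> \<omega> f 0"
  then obtain q1 where q1: "q1 \<in> Poly_Mapping.keys ?h" "q1 > 0" by (auto simp: dle_def)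
  define q0 where "q0 = Max (Poly_Mapping.keys ?h)"
  have q0: "q0 \<in> Poly_Mapping.keys ?h" unfolding q0_def by (rule Max_in) (use q1 in auto)
  have max: "q \<le> q0" if "q \<in> Poly_Mapping.keys ?h" for q unfolding q0_def using that by simp
  have "q0 > 0" using max[OF q1(1)] q1(2) by simp
  let ?a = "Poly_Mapping.lookup ?h q0"
  have "?a \<noteq> 0" using q0 by (simp add: in_keys_iff)
  then have "finite {x. poly ?a x = 0}" by (rule poly_roots_finite)
  moreover have "infinite (complex_of_real ` {a<..<b})"
    using assms(1) by (subst finite_image_iff) (auto simp: inj_on_def)
  ultimately have "\<not> complex_of_real ` {a<..<b} \<subseteq> {x. poly ?a x = 0}" using finite_subset by blast
  then obtain x where x: "x \<in> complex_of_real ` {a<..<b}" "poly ?a x \<noteq> 0" by blast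
  then obtain \<xi> where "x = of_real \<xi>" "\<xi> \<in> {a<..<b}" by blast
  with x(2) have \<xi>: "a < \<xi>" "\<xi> < b" "poly ?a (of_real \<xi>) \<noteq> 0" by simp_all
  let ?E = "\<lambda>u. eval_at f u (phi_eval \<phi> u + \<xi> * u powr of_rat \<omega>)"
  let ?t = "\<lambda>u q. poly (Poly_Mapping.lookup ?h q) (of_real \<xi>) * complex_of_real (u powr (of_rat q - of_rat q0))"
  have "((\<lambda>u. \<Sum>q\<in>Poly_Mapping.keys ?h. ?t u q) \<longlongrightarrow>
      (\<Sum>q\<in>Poly_Mapping.keys ?h. if q = q0 then poly ?a (of_real \<xi>) else 0)) at_top"
  proof (rule tendsto_sum)
    fix q assume q: "q \<in> Poly_Mapping.keys ?h"
    show "((\<lambda>u. ?t u q) \<longlongrightarrow> (if q = q0 then poly ?a (of_real \<xi>) else 0)) at_top"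
    proof (cases "q = q0")
      case True
      have "\<forall>\<^sub>F u in at_top. ?t u q = poly ?a (of_real \<xi>)"
        using eventually_gt_at_top[of 0] by eventually_elim (simp add: True)
      then show ?thesis using True by (simp add: tendsto_eventually)
    next
      case False
      then have "q < q0" using max[OF q] by simp
      then have "of_rat q - of_rat q0 < (0::real)" by (simp add: of_rat_less)
      then have "((\<lambda>u. u powr (of_rat q - of_rat q0)) \<longlongrightarrow> (0::real)) at_top"
        by (rule tendsto_neg_powr) (simp add: filterlim_ident)
      then have "((\<lambda>u. complex_of_real (u powr (of_rat q - of_rat q0))) \<longlongrightarrow> of_real 0) at_top"
        by (rule tendsto_of_real)
      then show ?thesis using False by (auto intro: tendsto_mult_right_zero)
    qed
  qed
  then have lim: "((\<lambda>u. \<Sum>q\<in>Poly_Mapping.keys ?h. ?t u q) \<longlongrightarrow> poly ?a (of_real \<xi>)) at_top"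
    using q0 by simp
  have "((\<lambda>u. \<Sum>q\<in>Poly_Mapping.keys ?h. ?t u q) \<longlongrightarrow> 0) at_top"
  proof (rule Lim_null_comparison)
    show "\<forall>\<^sub>F u in at_top. norm (\<Sum>q\<in>Poly_Mapping.keys ?h. ?t u q) \<le> K * u powr (- of_rat q0)"
      using eventually_gt_at_top[of 0] bounded[OF \<xi>(1,2)]
    proof eventually_elim
      case (elim u)
      have "(\<Sum>q\<in>Poly_Mapping.keys ?h. ?t u q) = xi_eval u \<xi> ?h * of_real (u powr (- of_rat q0))"
        unfolding xi_eval_def pm_eval_def sum_distrib_right
        by (rule sum.cong) (auto simp: powr_diff powr_minus divide_inverse)
      then have "norm (\<Sum>q\<in>Poly_Mapping.keys ?h. ?t u q) = cmod (?E u) * u powr (- of_rat q0)"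
        by (simp add: norm_mult xi_eval_subst_branch)
      then show ?case using elim(2) by (simp add: mult_right_mono)
    qed
    have "((\<lambda>u. u powr (- of_rat q0)) \<longlongrightarrow> (0::real)) at_top"
      by (rule tendsto_neg_powr) (use \<open>q0 > 0\<close> in \<open>auto simp: filterlim_ident\<close>)
    from tendsto_mult_right_zero[OF this]
    show "((\<lambda>u. K * u powr (- of_rat q0)) \<longlongrightarrow> 0) at_top" .
  qed
  from tendsto_unique[OF _ lim this] \<xi>(3) show False by simp
qed

section \<open>The case of one point at infinity\<close>

lemma linear_bij_inverse:
  fixes A :: "real \<times> real \<Rightarrow> real \<times> real"
  assumes "linear A" "bij A"
  obtains B where "linear B" "\<And>z. B (A z) = z" "\<And>z. A (B z) = z"
proof -
  obtain B where B: "linear B" "B \<circ> A = id"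
    using linear_injective_left_inverse[OF assms(1) bij_is_inj[OF assms(2)]] by blast
  then have BA: "B (A z) = z" for z by (metis comp_apply id_apply)
  have "A (B z) = z" for z
  proof -
    obtain y where "z = A y" using bij_is_surj[OF assms(2)] by (metis surjD)
    then show ?thesis by (simp add: BA)
  qed
  with B BA that show ?thesis by blast
qed

lemma eval2_linear_constant:
  assumes "\<And>z. eval2 q z = eval2 p (A z)" "\<And>z. A (B z) = z" "q \<in> constant_polys"
  shows "p \<in> constant_polys"
proof -
  obtain c where c: "\<forall>z. eval2 q z = c" using constant_polys_eval2[OF assms(3)] by blast
  have "eval2 p z = c" for z
    using assms(1)[of "B z"] c[rule_format, of "B z"] unfolding assms(2) by (rule trans[OF sym])
  then show ?thesis by (rule constant_polys_above[of 0])
qed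

text \<open>In the coordinate \<open>\<xi>\<close> the region between the branches lies between two
  functions with distinct limits, the coefficients of the two series at
  \<open>\<omega>\<close>.\<close>

lemma branch_limits:
  assumes "branch_data S P A \<phi> \<omega>"
  obtains g1 g2 :: "real \<Rightarrow> real" and a b where "a \<noteq> b" "(g1 \<longlongrightarrow> a) at_top" "(g2 \<longlongrightarrow> b) at_top"
    "\<forall>\<^sub>F u in at_top. \<forall>\<xi>. \<xi> \<in> open_segment (g1 u) (g2 u) \<longrightarrow> (u, phi_eval \<phi> u + \<xi> * u powr of_rat \<omega>) \<in> A ` S"
    "\<forall>\<^sub>F u in at_top. \<forall>v. (u, v) \<in> A ` S \<longrightarrow>
       (\<exists>\<xi>\<in>closed_segment (g1 u) (g2 u). v = phi_eval \<phi> u + \<xi> * u powr of_rat \<omega>)"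
proof -
  obtain c1 c2 where c: "puiseux c1" "puiseux c2" "c1 \<noteq> c2" "puiseux_convergent c1" "puiseux_convergent c2"
    and seg: "\<forall>\<^sub>F u in at_top.
           open_segment (puiseux_eval c1 u) (puiseux_eval c2 u) \<subseteq> {v. (u, v) \<in> A ` S} \<and>
           {v. (u, v) \<in> A ` S} \<subseteq> closed_segment (puiseux_eval c1 u) (puiseux_eval c2 u)"
    and \<omega>: "\<forall>q>\<omega>. c1 q = c2 q" "\<forall>w. (\<forall>q>w. c1 q = c2 q) \<longrightarrow> \<omega> \<le> w"
    and \<phi>: "\<forall>q. Poly_Mapping.lookup \<phi> q = (if q > \<omega> then c1 q else 0)"
    using assms unfolding branch_data_def by blast
  obtain N where N: "N > 0" "\<And>q. c1 q \<noteq> 0 \<Longrightarrow> of_nat N * q \<in> \<int>" "\<And>q. c2 q \<noteq> 0 \<Longrightarrow> of_nat N * q \<in> \<int>"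
    "of_nat N * \<omega> \<in> \<int>" "c1 \<omega> \<noteq> c2 \<omega>"
    using exponent_attained[OF c(1-3) \<omega>] by blast
  have \<phi>2: "Poly_Mapping.lookup \<phi> q = (if q > \<omega> then c2 q else 0)" for q using \<phi> \<omega>(1) by simp
  let ?g = "\<lambda>c u. (puiseux_eval c u - phi_eval \<phi> u) / u powr of_rat \<omega>"
  have pe: "puiseux_eval c u = phi_eval \<phi> u + u powr of_rat \<omega> * ?g c u" if "u > 0" for c u
    using that by simp
  have lin: "\<xi> \<in> open_segment (?g c1 u) (?g c2 u) \<longleftrightarrow>
      phi_eval \<phi> u + \<xi> * u powr of_rat \<omega> \<in> open_segment (puiseux_eval c1 u) (puiseux_eval c2 u)"
    and linc: "\<xi> \<in> closed_segment (?g c1 u) (?g c2 u) \<longleftrightarrow>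
      phi_eval \<phi> u + \<xi> * u powr of_rat \<omega> \<in> closed_segment (puiseux_eval c1 u) (puiseux_eval c2 u)"
    if "u > 0" for u \<xi>
  proof -
    have pos: "u powr of_rat \<omega> > 0" using that by simp
    show "\<xi> \<in> open_segment (?g c1 u) (?g c2 u) \<longleftrightarrow>
      phi_eval \<phi> u + \<xi> * u powr of_rat \<omega> \<in> open_segment (puiseux_eval c1 u) (puiseux_eval c2 u)"
      "\<xi> \<in> closed_segment (?g c1 u) (?g c2 u) \<longleftrightarrow>
      phi_eval \<phi> u + \<xi> * u powr of_rat \<omega> \<in> closed_segment (puiseux_eval c1 u) (puiseux_eval c2 u)"
      using pos by (auto simp: open_segment_eq_real_ivl closed_segment_eq_real_ivl field_simps)
  qed
  show ?thesis
  proof (rule that[OF N(5)])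
    show "(?g c1 \<longlongrightarrow> c1 \<omega>) at_top"
      by (rule branch_asymptotics[OF c(4) N(1) N(2) N(4)]) (use \<phi> in auto)
    show "(?g c2 \<longlongrightarrow> c2 \<omega>) at_top"
      by (rule branch_asymptotics[OF c(5) N(1) N(3) N(4)]) (use \<phi>2 in auto)
    show "\<forall>\<^sub>F u in at_top. \<forall>\<xi>. \<xi> \<in> open_segment (?g c1 u) (?g c2 u) \<longrightarrow>
        (u, phi_eval \<phi> u + \<xi> * u powr of_rat \<omega>) \<in> A ` S"
      using eventually_gt_at_top[of 0] seg
    proof eventually_elim
      case (elim u)
      then show ?case using lin[of u] by blast
    qed
    show "\<forall>\<^sub>F u in at_top. \<forall>v. (u, v) \<in> A ` S \<longrightarrow>
       (\<exists>\<xi>\<in>closed_segment (?g c1 u) (?g c2 u). v = phi_eval \<phi> u + \<xi> * u powr of_rat \<omega>)"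
      using eventually_gt_at_top[of 0] seg
    proof eventually_elim
      case (elim u)
      show ?case
      proof (intro allI impI)
        fix v assume "(u, v) \<in> A ` S"
        then have v: "v \<in> closed_segment (puiseux_eval c1 u) (puiseux_eval c2 u)" using elim(2) by blast
        let ?\<xi> = "(v - phi_eval \<phi> u) / u powr of_rat \<omega>"
        have eq: "v = phi_eval \<phi> u + ?\<xi> * u powr of_rat \<omega>" using elim(1) by simp
        then show "\<exists>\<xi>\<in>closed_segment (?g c1 u) (?g c2 u). v = phi_eval \<phi> u + \<xi> * u powr of_rat \<omega>"
          using linc[OF elim(1), of ?\<xi>] v by (intro bexI[of _ ?\<xi>]) auto
      qed
    qed
  qed
qed

text \<open>Far out on \<open>S\<close> the coordinate \<open>\<xi>\<close> is bounded, hence so is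
  the polynomial; what is left of \<open>S\<close> lies in a ball, where continuity
  suffices.\<close>

lemma B0_nonconstant_of_dle:
  assumes bd: "branch_data S P A \<phi> \<omega>"
    and f: "is_polynomial f" "dle \<phi> \<omega> f 0" "\<And>c. f \<noteq> laurent_monom c 0"
  shows "\<B> 0 S \<noteq> constant_polys"
proof -
  have A: "linear A" "bij A" and lim: "filterlim (\<lambda>z. fst (A z)) at_top (inf at_infinity (principal S))"
    using bd by (auto simp: branch_data_def)
  obtain B where B: "linear B" "\<And>z. B (A z) = z" "\<And>z. A (B z) = z" using linear_bij_inverse[OF A] by metis
  obtain g1 g2 a b where "a \<noteq> b" and g: "(g1 \<longlongrightarrow> a) at_top" "(g2 \<longlongrightarrow> b) at_top"
    and "\<forall>\<^sub>F u in at_top. \<forall>\<xi>. \<xi> \<in> open_segment (g1 u) (g2 u) \<longrightarrow> (u, phi_eval \<phi> u + \<xi> * u powr of_rat \<omega>) \<in> A ` S"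
    and g3: "\<forall>\<^sub>F u in at_top. \<forall>v. (u, v) \<in> A ` S \<longrightarrow>
       (\<exists>\<xi>\<in>closed_segment (g1 u) (g2 u). v = phi_eval \<phi> u + \<xi> * u powr of_rat \<omega>)"
    by (rule branch_limits[OF bd])
  obtain p q where pq: "\<forall>u>0. \<forall>v. eval_at f u v = Complex (eval2 p (u, v)) (eval2 q (u, v))"
    using real_polys_of_laurent[OF f(1)] by blast
  have "p \<notin> constant_polys \<or> q \<notin> constant_polys"
  proof (rule ccontr)
    assume "\<not> (p \<notin> constant_polys \<or> q \<notin> constant_polys)"
    then obtain c d where "\<forall>z. eval2 p z = c" "\<forall>z. eval2 q z = d"
      using constant_polys_eval2 by metis
    then have "f = laurent_monom (Complex c d) 0" using pq by (intro eval_at_constant f) auto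
    then show False using f(3) by blast
  qed
  then obtain r where r: "r \<notin> constant_polys" "\<And>u v. u > 0 \<Longrightarrow> \<bar>eval2 r (u, v)\<bar> \<le> cmod (eval_at f u v)"
    using pq abs_Re_le_cmod abs_Im_le_cmod by (metis complex.sel)
  obtain s where s: "\<And>z. eval2 s z = eval2 r (A z)" using eval2_linear[OF A(1), of r] by blast
  \<comment> \<open>Eventually the ends of the segment are within 1 of their limits, so
    \<open>X\<close> bounds every \<open>\<xi>\<close> between them.\<close>
  define X where "X = \<bar>a\<bar> + \<bar>b\<bar> + 1"
  obtain K where K: "\<And>u \<xi>. u \<ge> 1 \<Longrightarrow> \<bar>\<xi>\<bar> \<le> X \<Longrightarrow>
      cmod (eval_at f u (phi_eval \<phi> u + \<xi> * u powr of_rat \<omega>)) \<le> K"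
    using bounded_of_dle[OF f(2), of X] by blast
  have "\<forall>\<^sub>F u in at_top. \<forall>v. (u, v) \<in> A ` S \<longrightarrow> \<bar>eval2 r (u, v)\<bar> \<le> K"
  proof -
    have "\<forall>\<^sub>F u in at_top. dist (g1 u) a < 1" "\<forall>\<^sub>F u in at_top. dist (g2 u) b < 1"
      using tendstoD[OF g(1), of 1] tendstoD[OF g(2), of 1] by simp_all
    then show ?thesis using g3 eventually_ge_at_top[of 1]
    proof eventually_elim
      case (elim u)
      have u: "u \<ge> 1" by fact
      show ?case
      proof (intro allI impI)
        fix v assume "(u, v) \<in> A ` S"
        then obtain \<xi> where \<xi>: "\<xi> \<in> closed_segment (g1 u) (g2 u)" "v = phi_eval \<phi> u + \<xi> * u powr of_rat \<omega>"
          using elim(3) by blast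
        have "\<bar>\<xi>\<bar> \<le> X"
          using \<xi>(1) elim(1,2) by (auto simp: closed_segment_eq_real_ivl X_def dist_real_def split: if_splits)
        then have "cmod (eval_at f u v) \<le> K" using K[OF u] \<xi>(2) by simp
        then show "\<bar>eval2 r (u, v)\<bar> \<le> K" using r(2)[of u v] u by simp
      qed
    qed
  qed
  then obtain u1 where u1: "\<And>u v. u \<ge> u1 \<Longrightarrow> (u, v) \<in> A ` S \<Longrightarrow> \<bar>eval2 r (u, v)\<bar> \<le> K"
    by (auto simp: eventually_at_top_linorder)
  have "\<forall>\<^sub>F z in inf at_infinity (principal S). u1 \<le> fst (A z)"
    using lim unfolding filterlim_at_top by blast
  then obtain R where R: "\<And>z. norm z \<ge> R \<Longrightarrow> z \<in> S \<Longrightarrow> u1 \<le> fst (A z)"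
    by (auto simp: eventually_inf_principal eventually_at_infinity)
  have "compact (eval2 s ` cball 0 R)"
    by (intro compact_continuous_image continuous_on_eval2) auto
  then have "bounded (eval2 s ` cball 0 R)" by (rule compact_imp_bounded)
  then obtain M where M: "\<forall>x\<in>eval2 s ` cball 0 R. norm x \<le> M"
    unfolding bounded_iff by (elim exE)
  have "\<bar>eval2 s z\<bar> \<le> max K M" if z: "z \<in> S" for z
  proof (cases "norm z \<ge> R")
    case True
    then have "u1 \<le> fst (A z)" using R z by blast
    then have "\<bar>eval2 r (fst (A z), snd (A z))\<bar> \<le> K" using u1[of "fst (A z)" "snd (A z)"] z by auto
    then show ?thesis by (simp add: s)
  next
    case False
    then have "norm (eval2 s z) \<le> M" using M by (intro bspec[OF M]) auto
    then show ?thesis by simp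
  qed
  then have "s \<in> \<B> 0 S" unfolding B0_iff by blast
  moreover have "s \<notin> constant_polys" using eval2_linear_constant[of s r A B] s B(3) r(1) by blast
  ultimately show ?thesis by blast
qed

lemma dle_of_B0_nonconstant:
  assumes bd: "branch_data S P A \<phi> \<omega>" and ne: "\<B> 0 S \<noteq> constant_polys"
  obtains f where "is_polynomial f" "dle \<phi> \<omega> f 0" "\<And>c. f \<noteq> laurent_monom c 0" "subst_branch \<phi> \<omega> f \<noteq> 0"
proof -
  obtain p where p: "p \<in> \<B> 0 S" "p \<notin> constant_polys" using ne constant_polys_B0[of S] by blast
  obtain K where K: "\<And>z. z \<in> S \<Longrightarrow> \<bar>eval2 p z\<bar> \<le> K" using p(1) unfolding B0_iff by blast
  have A: "linear A" "bij A" using bd by (auto simp: branch_data_def)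
  obtain B where B: "linear B" "\<And>z. B (A z) = z" "\<And>z. A (B z) = z" using linear_bij_inverse[OF A] by metis
  obtain r where r: "\<And>z. eval2 r z = eval2 p (B z)" using eval2_linear[OF B(1), of p] by blast
  have rnc: "r \<notin> constant_polys" using eval2_linear_constant[of r p B A] r B(2) p(2) by blast
  obtain f where f: "is_polynomial f" "\<And>u v. u > 0 \<Longrightarrow> eval_at f u v = of_real (eval2 r (u, v))"
    using laurent_of_real_poly[of r] by blast
  obtain g1 g2 a b where g: "a \<noteq> b" "(g1 \<longlongrightarrow> a) at_top" "(g2 \<longlongrightarrow> b) at_top"
    "\<forall>\<^sub>F u in at_top. \<forall>\<xi>. \<xi> \<in> open_segment (g1 u) (g2 u) \<longrightarrow> (u, phi_eval \<phi> u + \<xi> * u powr of_rat \<omega>) \<in> A ` S"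
    and "\<forall>\<^sub>F u in at_top. \<forall>v. (u, v) \<in> A ` S \<longrightarrow>
       (\<exists>\<xi>\<in>closed_segment (g1 u) (g2 u). v = phi_eval \<phi> u + \<xi> * u powr of_rat \<omega>)"
    by (rule branch_limits[OF bd])
  have "dle \<phi> \<omega> f 0"
  proof (rule dle_of_bounded)
    \<comment> \<open>Any \<open>\<xi>\<close> strictly between the two limits lies eventually in
      the open segment, that is, its curve runs inside \<open>S\<close>.\<close>
    show "min a b < max a b" using g(1) by auto
    fix \<xi> assume \<xi>: "min a b < \<xi>" "\<xi> < max a b"
    have "\<forall>\<^sub>F u in at_top. \<xi> \<in> open_segment (g1 u) (g2 u)"
    proof (cases "a < b")
      case True
      then have "\<forall>\<^sub>F u in at_top. g1 u < \<xi>" "\<forall>\<^sub>F u in at_top. \<xi> < g2 u"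
        using order_tendstoD(2)[OF g(2)] order_tendstoD(1)[OF g(3)] \<xi> by auto
      then show ?thesis by eventually_elim (auto simp: open_segment_eq_real_ivl)
    next
      case False
      then have "\<forall>\<^sub>F u in at_top. g2 u < \<xi>" "\<forall>\<^sub>F u in at_top. \<xi> < g1 u"
        using order_tendstoD(1)[OF g(2)] order_tendstoD(2)[OF g(3)] \<xi> by auto
      then show ?thesis by eventually_elim (auto simp: open_segment_eq_real_ivl)
    qed
    then show "\<forall>\<^sub>F u in at_top. cmod (eval_at f u (phi_eval \<phi> u + \<xi> * u powr of_rat \<omega>)) \<le> K"
      using g(4) eventually_gt_at_top[of 0]
    proof eventually_elim
      case (elim u)
      then obtain z where z: "z \<in> S" "A z = (u, phi_eval \<phi> u + \<xi> * u powr of_rat \<omega>)" by force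
      then have "\<bar>eval2 r (u, phi_eval \<phi> u + \<xi> * u powr of_rat \<omega>)\<bar> \<le> K"
        using K[OF z(1)] r[of "A z"] B(2)[of z] by simp
      then show ?case using f(2)[OF elim(3)] by simp
    qed
  qed
  moreover have "f \<noteq> laurent_monom c 0" for c
  proof
    assume "f = laurent_monom c 0"
    then have "eval2 r (u, v) = Re c" if "u > 0" for u v
      using f(2)[OF that, of v] that by (simp add: eval_at_laurent_monom)
    then show False using constant_polys_above[of 0 r] rnc by blast
  qed
  moreover have "subst_branch \<phi> \<omega> f \<noteq> 0"
  proof
    assume 0: "subst_branch \<phi> \<omega> f = 0"
    have "eval2 r (u, v) = 0" if u: "u > 0" for u v
    proof -
      \<comment> \<open>For \<open>u > 0\<close> every point lies on the curve of some
        \<open>\<xi>\<close>, so a vanishing substitution forces \<open>f\<close> to vanish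
        there.\<close>
      have "v = phi_eval \<phi> u + (v - phi_eval \<phi> u) / u powr of_rat \<omega> * u powr of_rat \<omega>" using u by simp
      then have "eval_at f u v = xi_eval u ((v - phi_eval \<phi> u) / u powr of_rat \<omega>) (subst_branch \<phi> \<omega> f)"
        by (simp add: xi_eval_subst_branch)
      then show ?thesis using f(2)[OF u, of v] by (simp add: 0 xi_eval_def pm_eval_def)
    qed
    then show False using constant_polys_above[of 0 r 0] rnc by blast
  qed
  ultimately show ?thesis using that f(1) by blast
qed

theorem bounded_polynomials_one_point:
  assumes bd: "branch_data S P A \<phi> \<omega>" and kf: "key_forms (semidegree \<phi> \<omega>) fs"
  shows "\<B> 0 S = constant_polys \<longleftrightarrow>
    semidegree \<phi> \<omega> (last fs) > 0 \<or>
    semidegree \<phi> \<omega> (last fs) = 0 \<and> \<not> is_polynomial (last fs)"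
proof -
  let ?w = "\<lambda>i. semidegree \<phi> \<omega> (fs ! i)"
  obtain \<alpha> \<kappa> \<beta> \<theta> l where ks: "key_sequence ((!) fs) ?w \<alpha> \<kappa> \<beta> \<theta> l" and len: "length fs = Suc l"
    and fil: "\<And>g. g \<noteq> 0 \<Longrightarrow> g \<in> key_sequence.fil ((!) fs) ?w l (semidegree \<phi> \<omega> g)"
    using key_forms_sequence[OF kf semidegree_u] by metis
  interpret key_sequence "(!) fs" ?w \<alpha> \<kappa> \<beta> \<theta> l by (rule ks)
  have last: "last fs = fs ! l" using len by (metis diff_Suc_1 last_conv_nth length_0_conv nat.distinct(1))
  let ?F = "fs ! l"
  have F: "lead_coeff ?F = 1" "degree ?F > 0"
    using key_monic[of l] D_pos[of l] l by (metis order_refl)+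
  show ?thesis unfolding last
  proof
    assume c: "\<B> 0 S = constant_polys"
    show "?w l > 0 \<or> ?w l = 0 \<and> \<not> is_polynomial ?F"
    proof (rule ccontr)
      assume n: "\<not> (?w l > 0 \<or> ?w l = 0 \<and> \<not> is_polynomial ?F)"
      have "\<exists>p. is_polynomial p \<and> dle \<phi> \<omega> p 0 \<and> (\<forall>c. p \<noteq> laurent_monom c 0)"
      proof (cases "?w l < 0")
        case True
        then show ?thesis using exists_nonconstant_of_negative[OF F dle_semidegree] by blast
      next
        case False
        then have "?w l = 0" "is_polynomial ?F" using n by auto
        moreover have "?F \<noteq> laurent_monom c 0" for c
          using F(2) by (auto simp: laurent_monom_def)
        ultimately show ?thesis using dle_semidegree[of \<phi> \<omega> ?F] by (intro exI[of _ ?F]) simp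
      qed
      then show False using B0_nonconstant_of_dle[OF bd] c by blast
    qed
  next
    assume w: "?w l > 0 \<or> ?w l = 0 \<and> \<not> is_polynomial ?F"
    show "\<B> 0 S = constant_polys"
    proof (rule ccontr)
      assume "\<B> 0 S \<noteq> constant_polys"
      then obtain f where f: "is_polynomial f" "dle \<phi> \<omega> f 0" "\<And>c. f \<noteq> laurent_monom c 0" "subst_branch \<phi> \<omega> f \<noteq> 0"
        using dle_of_B0_nonconstant[OF bd] by blast
      have "f \<noteq> 0" using f(3)[of 0] by simp
      then have "f \<in> fil l 0" by (rule fil_mono[OF fil semidegree_le[OF f(2,4)]])
      then show False using polynomials_constant[OF _ f(1) w] f(3) by blast
    qed
  qed
qed

subsection \<open>Several points at infinity\<close>

lemma span_singleton_eq:
  fixes w w' :: "'a::real_vector"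
  assumes "span {w} = span {w'}" "w \<noteq> 0"
  obtains c where "w = c *\<^sub>R w'" "c \<noteq> 0"
proof -
  have "w \<in> span {w'}" using assms(1) span_base[of w "{w}"] by simp
  then obtain c where "w = c *\<^sub>R w'" by (auto simp: span_singleton)
  with assms(2) that show ?thesis by auto
qed

lemma span_scaleR_singleton:
  fixes w :: "'a::real_vector"
  assumes "c \<noteq> 0"
  shows "span {c *\<^sub>R w} = span {w}"
proof -
  have "inverse c *\<^sub>R (c *\<^sub>R w) \<in> span {c *\<^sub>R w}" by (intro span_mul span_base) simp
  moreover have "c *\<^sub>R w \<in> span {w}" by (intro span_mul span_base) simp
  ultimately show ?thesis using assms by (simp add: span_eq)
qed

text \<open>The sign of a function homogeneous of degree 2 depends only on the line through the
  point, so its positivity defines an open subset of the projective plane. This set must meet the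
  affine image of \<open>S\<close>.\<close>

lemma near_point_at_infinity:
  fixes h :: "real \<times> real \<times> real \<Rightarrow> real"
  assumes P: "span {(0, y)} \<in> points_at_infinity S" "y \<noteq> 0"
    and h: "continuous_on UNIV h" "\<And>c w. h (c *\<^sub>R w) = c\<^sup>2 * h w" "h (0, y) > 0"
  obtains z where "z \<in> S" "h (1, z) > 0"
proof -
  define U where "U = {span {w} |w. w \<noteq> 0 \<and> h w > 0}"
  have U_iff: "span {w} \<in> U \<longleftrightarrow> h w > 0" if w: "w \<noteq> 0" for w
  proof
    assume "span {w} \<in> U"
    then obtain w' where w': "span {w} = span {w'}" "h w' > 0" by (auto simp: U_def)
    then obtain c where "w = c *\<^sub>R w'" "c \<noteq> 0" using span_singleton_eq w by metis
    then show "h w > 0" using h(2) w'(2) by simp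
  next
    assume "h w > 0"
    then show "span {w} \<in> U" unfolding U_def using w by blast
  qed
  have "{w. w \<noteq> 0 \<and> span {w} \<in> U} = {w. h w > 0} - {0}" using U_iff by auto
  moreover have "open {w. h w > 0}"
    using h(1) by (intro open_Collect_less continuous_on_const) auto
  ultimately have "openin RP2_topology U"
    unfolding openin_RP2_topology by (auto simp: U_def RP2_def)
  moreover have "span {(0, y)} \<in> U" using U_iff[of "(0, y)"] P(2) h(3) by (simp add: zero_prod_def)
  moreover have "span {(0, y)} \<in> RP2_topology closure_of (affine_chart ` S)"
    using P(1) by (simp add: points_at_infinity_def projective_closure_def)
  ultimately obtain z where z: "z \<in> S" "affine_chart z \<in> U"
    unfolding in_closure_of by blast
  have "affine_chart z = span {(1, z)}" by (simp add: affine_chart_def)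
  then have "h (1, z) > 0" using z(2) U_iff[of "(1, z)"] by (simp add: zero_prod_def)
  with z(1) that show ?thesis by blast
qed

lemma connected_at_infinity:
  assumes "exactly_one_tentacle S"
  shows "\<forall>\<^sub>F r in at_top. connected (S - ball 0 r)"
  using assms unfolding exactly_one_tentacle_def
proof eventually_elim
  case (elim r)
  then obtain C where "components (S - ball 0 r) = {C}" by (auto simp: card_1_singleton_iff)
  then show ?case using Union_components[of "S - ball 0 r"] in_components_connected[of C "S - ball 0 r"] by simp
qed

lemma direction_at_infinity:
  assumes tent: "exactly_one_tentacle S"
    and P: "span {(0, e)} \<in> points_at_infinity S" and Q: "span {(0, f)} \<in> points_at_infinity S" "f \<noteq> 0"
    and t: "(e \<bullet> f)\<^sup>2 < t * (f \<bullet> f)" "t < e \<bullet> e" "t > 0"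
  shows "\<exists>z\<in>S. norm z \<ge> R \<and> (e \<bullet> z)\<^sup>2 = t * (z \<bullet> z)"
proof -
  have e: "e \<noteq> 0" using t by auto
  obtain r0 where r0: "\<And>r. r \<ge> r0 \<Longrightarrow> connected (S - ball 0 r)"
    using connected_at_infinity[OF tent] by (auto simp: eventually_at_top_linorder)
  define r where "r = Max {0, r0, R}"
  have r: "r \<ge> 0" "r \<ge> r0" "r \<ge> R" by (auto simp: r_def)
  \<comment> \<open>Chosen so that a value of \<open>?q\<close> beyond \<open>M\<close> in absolute
    value forces the norm to be at least \<open>r\<close>.\<close>
  define M where "M = r\<^sup>2 * (e \<bullet> e)"
  have M: "M \<ge> 0" by (simp add: M_def)
  let ?q = "\<lambda>z. (e \<bullet> z)\<^sup>2 - t * (z \<bullet> z)"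
  have far: "z \<notin> ball 0 r" if "z \<bullet> z \<ge> r\<^sup>2" for z :: "real \<times> real"
    using that by (auto simp: norm_eq_sqrt_inner not_less real_le_rsqrt)
  have scale: "(e \<bullet> (c *\<^sub>R x))\<^sup>2 = c\<^sup>2 * (e \<bullet> x)\<^sup>2" "(c *\<^sub>R x) \<bullet> (c *\<^sub>R x) = c\<^sup>2 * (x \<bullet> x)" for c x
    by (simp_all add: power_mult_distrib power2_eq_square)
  \<comment> \<open>The subtracted \<open>M * (fst w)\<^sup>2\<close> homogenizes the constant
    \<open>M\<close>: at \<open>(1, z)\<close> positivity reads \<open>?q z > M\<close>, and at
    infinity it does not matter.\<close>
  obtain z1 where z1: "z1 \<in> S" "?q z1 > M"
  proof (rule near_point_at_infinity[OF P e, of "\<lambda>w. ?q (snd w) - M * (fst w)\<^sup>2"])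
    show "continuous_on UNIV (\<lambda>w::real \<times> real \<times> real. ?q (snd w) - M * (fst w)\<^sup>2)"
      by (intro continuous_intros)
    show "?q (snd (c *\<^sub>R w)) - M * (fst (c *\<^sub>R w))\<^sup>2 = c\<^sup>2 * (?q (snd w) - M * (fst w)\<^sup>2)" for c and w :: "real \<times> real \<times> real"
      unfolding snd_scaleR fst_scaleR scale by (simp add: algebra_simps power_mult_distrib)
    have "t * (e \<bullet> e) < (e \<bullet> e) * (e \<bullet> e)" using t e by (intro mult_strict_right_mono) auto
    then show "?q (snd (0, e)) - M * (fst (0, e))\<^sup>2 > 0" by (simp add: power2_eq_square)
  qed auto
  obtain z2 where z2: "z2 \<in> S" "- ?q z2 > M"
  proof (rule near_point_at_infinity[OF Q, of "\<lambda>w. - ?q (snd w) - M * (fst w)\<^sup>2"])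
    show "continuous_on UNIV (\<lambda>w::real \<times> real \<times> real. - ?q (snd w) - M * (fst w)\<^sup>2)"
      by (intro continuous_intros)
    show "- ?q (snd (c *\<^sub>R w)) - M * (fst (c *\<^sub>R w))\<^sup>2 = c\<^sup>2 * (- ?q (snd w) - M * (fst w)\<^sup>2)" for c and w :: "real \<times> real \<times> real"
      unfolding snd_scaleR fst_scaleR scale by (simp add: algebra_simps power_mult_distrib)
    show "- ?q (snd (0, f)) - M * (fst (0, f))\<^sup>2 > 0" using t(1) by simp
  qed auto
  have "z1 \<notin> ball 0 r"
  proof (rule far)
    have "M \<le> (e \<bullet> z1)\<^sup>2" using z1(2) t(3) by (smt (verit) inner_ge_zero mult_nonneg_nonneg)
    also have "\<dots> \<le> (e \<bullet> e) * (z1 \<bullet> z1)" by (rule Cauchy_Schwarz_ineq)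
    finally have "(e \<bullet> e) * r\<^sup>2 \<le> (e \<bullet> e) * (z1 \<bullet> z1)" by (simp add: M_def mult.commute)
    then show "r\<^sup>2 \<le> z1 \<bullet> z1" using e by (simp add: mult_le_cancel_left_pos)
  qed
  moreover have "z2 \<notin> ball 0 r"
  proof (rule far)
    have "M \<le> t * (z2 \<bullet> z2)" using z2(2) by (smt (verit) zero_le_power2)
    also have "\<dots> \<le> (e \<bullet> e) * (z2 \<bullet> z2)" using t by (intro mult_right_mono) auto
    finally have "(e \<bullet> e) * r\<^sup>2 \<le> (e \<bullet> e) * (z2 \<bullet> z2)" by (simp add: M_def mult.commute)
    then show "r\<^sup>2 \<le> z2 \<bullet> z2" using e by (simp add: mult_le_cancel_left_pos)
  qed
  moreover have "connected (?q ` (S - ball 0 r))"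
    by (intro connected_continuous_image continuous_intros r0 r)
  ultimately have "0 \<in> ?q ` (S - ball 0 r)"
    using connectedD_interval[of "?q ` (S - ball 0 r)" "?q z2" "?q z1" 0] z1 z2 M by force
  then obtain z where "z \<in> S" "z \<notin> ball 0 r" "?q z = 0" by auto
  then show ?thesis using r by (intro bexI[of _ z]) auto
qed

section \<open>Polynomials on lines through the origin\<close>

lemma poly_line: "poly (poly p [:0, m:]) x = eval2 p (x, m * x)"
  by (induction p) (simp_all add: algebra_simps)

text \<open>\<open>poly q [:0, m:]\<close> is the restriction to the line of slope \<open>m\<close>.
  For each \<open>u > 0\<close> these lines give infinitely many roots \<open>m u\<close> of
  \<open>q\<close> in \<open>v\<close>.\<close>

lemma zero_on_infinitely_many_lines:
  fixes q :: "real poly poly"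
  assumes "infinite {m. poly q [:0, m:] = 0}"
  shows "q = 0"
proof (rule eval2_zero_if_zero_above[of 0])
  fix u v :: real assume u: "u > 0"
  let ?q = "map_poly (\<lambda>a. poly a u) q"
  have q: "poly ?q v = eval2 q (u, v)" for v
    by (induction q) (simp_all add: map_poly_pCons)
  have "(\<lambda>m. m * u) ` {m. poly q [:0, m:] = 0} \<subseteq> {v. poly ?q v = 0}"
    unfolding q by (auto simp: poly_line[symmetric])
  moreover have "infinite ((\<lambda>m. m * u) ` {m. poly q [:0, m:] = 0})"
    using assms u by (subst finite_image_iff) (auto simp: inj_on_def)
  ultimately have "infinite {v. poly ?q v = 0}" using finite_subset by blast
  then have "?q = 0" using poly_roots_finite by blast
  then show "eval2 q (u, v) = 0" using q[of v] by simp
qed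

text \<open>A polynomial in one variable that is bounded on an unbounded set is constant, and its
  value is the one at the origin.\<close>

lemma bounded_on_line:
  assumes K: "\<And>z. z \<in> S \<Longrightarrow> \<bar>eval2 p z\<bar> \<le> K"
    and far: "\<And>R. \<exists>x. (x, m * x) \<in> S \<and> norm (x, m * x) \<ge> R"
  shows "poly (p - [:[:eval2 p 0:]:]) [:0, m:] = 0"
proof -
  obtain a P where P: "poly p [:0, m:] = pCons a P" using pCons_cases by blast
  have "P = 0"
  proof (rule ccontr)
    assume "P \<noteq> 0"
    then obtain r where r: "\<And>x. r \<le> \<bar>x\<bar> \<Longrightarrow> K + 1 \<le> \<bar>poly (pCons a P) x\<bar>"
      using poly_infinity[of P "K + 1" a] by auto
    obtain x where x: "(x, m * x) \<in> S" "norm (x, m * x) \<ge> (1 + \<bar>m\<bar>) * r" using far by blast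
    have "norm (x, m * x) \<le> \<bar>x\<bar> + \<bar>m * x\<bar>" using norm_Pair_le[of x "m * x"] by simp
    also have "\<dots> = (1 + \<bar>m\<bar>) * \<bar>x\<bar>" by (simp add: abs_mult algebra_simps)
    finally have "(1 + \<bar>m\<bar>) * r \<le> (1 + \<bar>m\<bar>) * \<bar>x\<bar>" using x(2) by linarith
    then have "r \<le> \<bar>x\<bar>" by (simp add: mult_le_cancel_left_pos)
    from r[OF this] K[OF x(1)] show False unfolding P[symmetric] poly_line by simp
  qed
  moreover have "a = eval2 p 0" using poly_line[of p m 0] by (simp add: P zero_prod_def)
  ultimately show ?thesis using P by simp
qed

theorem bounded_polynomials_several_points:
  assumes tent: "exactly_one_tentacle S" and PQ: "P \<in> points_at_infinity S" "Q \<in> points_at_infinity S" "P \<noteq> Q"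
  shows "\<B> 0 S = constant_polys"
proof
  show "constant_polys \<subseteq> \<B> 0 S" by (rule constant_polys_B0)
  show "\<B> 0 S \<subseteq> constant_polys"
  proof
    fix p assume "p \<in> \<B> 0 S"
    then obtain K where K: "\<And>z. z \<in> S \<Longrightarrow> \<bar>eval2 p z\<bar> \<le> K" unfolding B0_iff by blast
    have "P \<in> line_at_infinity" "Q \<in> line_at_infinity" using PQ by (auto simp: points_at_infinity_def)
    then obtain e f where e: "P = span {(0, e)}" "e \<noteq> 0" and f: "Q = span {(0, f)}" "f \<noteq> 0"
      by (fastforce simp: line_at_infinity_def zero_prod_def)
    \<comment> \<open>The value at \<open>f\<close> of the quotient of
      \<open>(e \<bullet> z)\<^sup>2\<close> by \<open>z \<bullet> z\<close>. It is below
      \<open>e \<bullet> e\<close> by strict Cauchy-Schwarz, because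
      \<open>P \<noteq> Q\<close>.\<close>
    define t0 where "t0 = (e \<bullet> f)\<^sup>2 / (f \<bullet> f)"
    have ff: "f \<bullet> f > 0" using f by simp
    have "t0 < e \<bullet> e"
    proof (rule ccontr)
      assume "\<not> t0 < e \<bullet> e"
      then have "(e \<bullet> f)\<^sup>2 \<ge> (e \<bullet> e) * (f \<bullet> f)" using ff by (simp add: t0_def field_simps)
      then have ef: "(e \<bullet> f)\<^sup>2 = (e \<bullet> e) * (f \<bullet> f)" using Cauchy_Schwarz_ineq[of e f] by simp
      \<comment> \<open>A multiple of the component of \<open>e\<close> orthogonal to
        \<open>f\<close>; equality in Cauchy-Schwarz makes it vanish.\<close>
      define d where "d = (f \<bullet> f) *\<^sub>R e - (e \<bullet> f) *\<^sub>R f"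
      have "d \<bullet> d = (f \<bullet> f) * ((f \<bullet> f) * (e \<bullet> e) - (e \<bullet> f)\<^sup>2)"
        by (simp add: d_def inner_diff_left inner_diff_right inner_commute power2_eq_square algebra_simps)
      then have "d = 0" using ef by (simp add: mult.commute)
      then have "(f \<bullet> f) *\<^sub>R e = (e \<bullet> f) *\<^sub>R f" by (simp add: d_def)
      moreover have "e = inverse (f \<bullet> f) *\<^sub>R ((f \<bullet> f) *\<^sub>R e)" using ff by simp
      ultimately have "e = (inverse (f \<bullet> f) * (e \<bullet> f)) *\<^sub>R f" by (simp only: scaleR_scaleR)
      then obtain c where c: "e = c *\<^sub>R f" "c \<noteq> 0" using e(2) by (metis scaleR_zero_left)
      have "(0, e) = c *\<^sub>R (0::real, f)" by (simp add: c)
      then have "span {(0, e)} = span {(0::real, f)}" by (simp only: span_scaleR_singleton[OF c(2)])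
      then show False using PQ(3) e f by simp
    qed
    let ?\<M> = "{m. poly (p - [:[:eval2 p 0:]:]) [:0, m:] = 0}"
    let ?F = "\<lambda>m. (fst e + snd e * m)\<^sup>2 / (1 + m\<^sup>2)"
    have t0: "t0 \<ge> 0" using ff by (simp add: t0_def)
    \<comment> \<open>\<open>?F m\<close> is the quotient above on the line of slope
      \<open>m\<close>. Thus each \<open>t\<close> yields a slope in \<open>?\<M>\<close>; the value
      \<open>(snd e)\<^sup>2\<close> is left out since it belongs to the vertical line.\<close>
    have "{t0<..<e \<bullet> e} - {(snd e)\<^sup>2} \<subseteq> ?F ` ?\<M>"
    proof
      fix t assume "t \<in> {t0<..<e \<bullet> e} - {(snd e)\<^sup>2}"
      then have t: "t0 < t" "t < e \<bullet> e" "t \<noteq> (snd e)\<^sup>2" by auto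
      have "(e \<bullet> f)\<^sup>2 < t * (f \<bullet> f)" using t(1) ff by (simp add: t0_def field_simps)
      note dir = direction_at_infinity[OF tent PQ(1)[unfolded e] PQ(2)[unfolded f] f(2) this t(2)]
      define Mt where "Mt = {m. poly [:(fst e)\<^sup>2 - t, 2 * fst e * snd e, (snd e)\<^sup>2 - t:] m = 0}"
      have "finite Mt" unfolding Mt_def by (rule poly_roots_finite) (use t(3) in simp)
      have Mt: "m \<in> Mt \<longleftrightarrow> (fst e + snd e * m)\<^sup>2 = t * (1 + m\<^sup>2)" for m
        by (auto simp: Mt_def power2_eq_square algebra_simps)
      have ex: "\<exists>m\<in>Mt. \<exists>x. (x, m * x) \<in> S \<and> norm (x, m * x) \<ge> R" for R
      proof -
        obtain z where z: "z \<in> S" "norm z \<ge> max R 1" "(e \<bullet> z)\<^sup>2 = t * (z \<bullet> z)"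
          using dir[of "max R 1"] t(1) t0 by auto
        have zz: "(fst e * fst z + snd e * snd z)\<^sup>2 = t * ((fst z)\<^sup>2 + (snd z)\<^sup>2)"
          using z(3) by (simp add: inner_prod_def power2_eq_square)
        have nz: "fst z \<noteq> 0"
        proof
          assume 0: "fst z = 0"
          then have "snd z \<noteq> 0" using z(2) by (auto simp: norm_prod_def)
          then show False using zz t(3) by (simp add: 0 power_mult_distrib)
        qed
        define m where "m = snd z / fst z"
        have sz: "snd z = m * fst z" using nz by (simp add: m_def)
        have "(fst z)\<^sup>2 * (fst e + snd e * m)\<^sup>2 = (fst z)\<^sup>2 * (t * (1 + m\<^sup>2))"
          using zz unfolding sz by (simp add: power2_eq_square algebra_simps)
        then have "m \<in> Mt" using nz by (simp add: Mt)
        moreover have "z = (fst z, m * fst z)" using sz by (simp add: prod_eq_iff)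
        then have "(fst z, m * fst z) \<in> S" "norm (fst z, m * fst z) \<ge> R" using z by auto
        ultimately show ?thesis by blast
      qed
      \<comment> \<open>Pigeonhole: points arbitrarily far out are spread over finitely many lines,
        so one line carries arbitrarily far points.\<close>
      have "\<exists>m\<in>Mt. \<forall>R. \<exists>x. (x, m * x) \<in> S \<and> norm (x, m * x) \<ge> R"
      proof (rule ccontr)
        assume "\<not> (\<exists>m\<in>Mt. \<forall>R. \<exists>x. (x, m * x) \<in> S \<and> norm (x, m * x) \<ge> R)"
        then obtain R where R: "\<And>m x. m \<in> Mt \<Longrightarrow> (x, m * x) \<in> S \<Longrightarrow> norm (x, m * x) < R m"
          by (metis not_le)
        obtain m x where mx: "m \<in> Mt" "(x, m * x) \<in> S" "norm (x, m * x) \<ge> Max (R ` Mt)" using ex by blast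
        have "R m \<le> Max (R ` Mt)" using \<open>finite Mt\<close> mx(1) by (intro Max_ge) auto
        then show False using R[OF mx(1,2)] mx(3) by linarith
      qed
      then obtain m where m: "m \<in> Mt" "\<And>R. \<exists>x. (x, m * x) \<in> S \<and> norm (x, m * x) \<ge> R" by blast
      have "m \<in> ?\<M>" using bounded_on_line[OF K m(2)] by simp
      moreover have "1 + m\<^sup>2 > 0" by (smt (verit) zero_le_power2)
      then have "t = ?F m" using m(1) by (simp add: Mt)
      ultimately show "t \<in> ?F ` ?\<M>" by blast
    qed
    moreover have "infinite ({t0<..<e \<bullet> e} - {(snd e)\<^sup>2})" using \<open>t0 < e \<bullet> e\<close> by simp
    ultimately have "infinite ?\<M>" using finite_surj by blast
    then have "p - [:[:eval2 p 0:]:] = 0" by (rule zero_on_infinitely_many_lines)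
    then show "p \<in> constant_polys" by (auto simp: constant_polys_def)
  qed
qed

section \<open>Key forms of the usual degree\<close>

lemma single_power: "Poly_Mapping.single k c ^ n = Poly_Mapping.single (of_nat n * k) (c ^ n)"
  for k :: rat and c :: "complex poly"
  by (induction n) (simp_all add: mult_single algebra_simps)

text \<open>A second step would give \<open>v^\<alpha> - \<theta> u^\<alpha>\<close>. After the
  substitution the coefficient of \<open>u^\<alpha>\<close> is
  \<open>\<xi>^\<alpha> - \<theta>\<close>, which is not 0, so the degree does not drop. Hence the
  last key form is \<open>v\<close>, of degree 1.\<close>

lemma degree_key_forms:
  assumes "key_forms (semidegree 0 1) fs"
  shows "semidegree 0 1 (last fs) > 0"
proof -
  let ?w = "\<lambda>i. semidegree 0 1 (fs ! i)"
  obtain \<alpha> \<kappa> \<beta> \<theta> l where ks: "key_sequence ((!) fs) ?w \<alpha> \<kappa> \<beta> \<theta> l" and len: "length fs = Suc l"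
    using key_forms_sequence[OF assms semidegree_u] by metis
  interpret key_sequence "(!) fs" ?w \<alpha> \<kappa> \<beta> \<theta> l by (rule ks)
  have gb: "generic_branch 0 1 = Poly_Mapping.single 1 [:0, 1:]"
  proof -
    have "Poly_Mapping.map (\<lambda>c. [:complex_of_real c:]) 0 = (0 :: puiseux_xi)"
      by (rule poly_mapping_eqI) (simp add: Poly_Mapping.map.rep_eq)
    then show ?thesis by (simp add: generic_branch_def)
  qed
  have sv: "subst_branch 0 1 [:0, 1:] = Poly_Mapping.single 1 [:0, 1:]"
  proof -
    have "[:0, 1:] = pCons 0 (laurent_monom 1 0)" by (simp add: laurent_monom_def)
    moreover have "subst_branch 0 1 (pCons 0 (laurent_monom 1 0))
        = laurent_embed 0 + generic_branch 0 1 * Poly_Mapping.single (of_int 0) [:1:]"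
      using subst_branch_laurent_monom[of 0 1 1 0] by (simp only: subst_branch_def subst.sub_pCons)
    ultimately show ?thesis by (simp add: gb mult_single laurent_embed_def)
  qed
  have w1: "?w 1 = 1" unfolding f1 by (simp add: semidegree_def sv)
  have "\<not> 1 < l"
  proof
    assume l1: "1 < l"
    \<comment> \<open>With both weights equal to 1 the weight equation says that the exponents of
      \<open>u\<close> and \<open>v\<close> in this step coincide.\<close>
    have \<alpha>: "\<alpha> 1 > 0" "of_nat (\<alpha> 1) = (of_int (\<kappa> 1) :: rat)" using \<alpha>_pos[of 1] weight[of 1] l1 w1 by auto
    have "fs ! Suc 1 + laurent_monom (\<theta> 1) (\<kappa> 1) = [:0, 1:] ^ \<alpha> 1" using step[of 1] l1 f1 by simp
    then have "subst_branch 0 1 (fs ! Suc 1) + Poly_Mapping.single (of_int (\<kappa> 1)) [:\<theta> 1:]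
        = subst_branch 0 1 ([:0, 1:] ^ \<alpha> 1)"
      by (metis subst_branch_add subst_branch_laurent_monom)
    moreover have "subst_branch 0 1 (g ^ n) = subst_branch 0 1 g ^ n" for g n
      using subst_branch_laurent_monom[of 0 1 1 0]
      by (induction n) (simp_all add: subst_branch_mult laurent_monom_one flip: one_pCons)
    ultimately have "subst_branch 0 1 (fs ! Suc 1) + Poly_Mapping.single (of_nat (\<alpha> 1)) [:\<theta> 1:]
        = Poly_Mapping.single (of_nat (\<alpha> 1)) ([:0, 1:] ^ \<alpha> 1)"
      by (simp add: sv single_power \<alpha>(2)[symmetric, simplified])
    then have eq: "subst_branch 0 1 (fs ! Suc 1) = Poly_Mapping.single (of_nat (\<alpha> 1)) ([:0, 1:] ^ \<alpha> 1 - [:\<theta> 1:])"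
      by (metis add_diff_cancel_right' single_diff)
    have "degree ([:0, 1:] ^ \<alpha> 1 :: complex poly) = \<alpha> 1" by (simp add: degree_power_eq)
    then have "[:0, 1:] ^ \<alpha> 1 - [:\<theta> 1:] \<noteq> 0" using \<alpha>(1) by (metis degree_pCons_0 eq_iff_diff_eq_0 less_numeral_extra(3))
    then have "?w (Suc 1) = of_nat (\<alpha> 1)" unfolding semidegree_def eq by simp
    then show False using w_less[of 1] l1 w1 by simp
  qed
  then have "l = 1" using l by simp
  then have "last fs = fs ! 1" using len by (metis diff_Suc_1 last_conv_nth length_0_conv nat.distinct(1))
  then show ?thesis using w1 by simp
qed

section \<open>The two cases of \<open>delta_star_data\<close> combined\<close>

theorem proposition4p17:
  fixes S :: "(real \<times> real) set"
    and A :: "real \<times> real \<Rightarrow> real \<times> real"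
    and \<phi> :: "rat \<Rightarrow>\<^sub>0 real" and \<omega> :: rat
    and fs :: "laurent poly list"
  assumes "semialgebraic S"
    and "exactly_one_tentacle S"
    and "tentacles_regular S"
    and "delta_star_data S A \<phi> \<omega>"
    and "key_forms (semidegree \<phi> \<omega>) fs"
  shows "\<B> 0 S = constant_polys \<longleftrightarrow>
    semidegree \<phi> \<omega> (last fs) > 0 \<or>
    semidegree \<phi> \<omega> (last fs) = 0 \<and> \<not> is_polynomial (last fs)"
  using assms(4) unfolding delta_star_data_def
proof (elim disjE conjE exE)
  assume "\<exists>P\<in>points_at_infinity S. \<exists>Q\<in>points_at_infinity S. P \<noteq> Q" and *: "\<phi> = 0" "\<omega> = 1"
  then have "\<B> 0 S = constant_polys" using bounded_polynomials_several_points[OF assms(2)] by blast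
  moreover have "semidegree \<phi> \<omega> (last fs) > 0" using degree_key_forms assms(5) * by simp
  ultimately show ?thesis by simp
next
  fix P assume "branch_data S P A \<phi> \<omega>"
  then show ?thesis using assms(5) by (rule bounded_polynomials_one_point)
qed

end
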